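(* Let $K$ be a field and let $A$ be a finite dimensional $K$-algebra. Then $A$ is gendo-symmetric if and only if there exist $A$-bimodule homomorphisms $\mu: D(A)\to D(A)\otimes_A D(A)$ (comultiplication) and $\epsilon: D(A)\to A$ (counit) such that $(A,D(A))$, equipped with $\mu$ and $\epsilon$, is a bocs.
   Context: $D=\operatorname{Hom}_K(-,K)$ is the natural duality; $D(A)$ carries its natural $A$-bimodule structure. Modules are finite dimensional right modules unless otherwise stated. Gendo-symmetric: a finite dimensional $K$-algebra $B$ is symmetric if $B\cong D(B)$ as $B$-bimodules. A finite dimensional $K$-algebra $A$ is called gendo-symmetric if $A\cong \operatorname{End}_B(M)$ as $K$-algebras for some finite dimensional symmetric $K$-algebra $B$ and some $M\in \operatorname{mod-}B$ that is a generator (i.e. $B_B$ is a direct summand of a finite direct sum of copies of $M$). Bocs: let $W$ be an $A$-bimodule and let $c_r: W\to A\otimes_A W$, $c_l: W\to W\otimes_A A$ be the canonical isomorphisms. The pair $(A,W)$ with $A$-bimodule maps $\mu: W\to W\otimes_A W$ and $\epsilon: W\to A$ is a bocs (equivalently $W$ is an $A$-coring) if $(1_W\otimes_A\epsilon)\mu=c_l$, $(\epsilon\otimes_A 1_W)\mu=c_r$ and $(\mu\otimes_A 1_W)\mu=(1_W\otimes_A\mu)\mu$. *)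

theory Defs
  imports
    "HOL-Algebra.Free_Abelian_Groups"
    "Jordan_Normal_Form.Missing_VectorSpace"
begin

section \<open>Algebras, modules and bimodules over a field\<close>

text \<open>
  The locale \<open>algebra\<close> of HOL-Algebra is commutative, so it cannot be used here.  A possibly
  noncommutative algebra uses the same record type.  The zero algebra is allowed, since
  \<^locale>\<open>ring\<close> does not require \<open>\<one> \<noteq> \<zero>\<close>.
\<close>

locale fd_algebra = vectorspace K A + ring A for K and A +
  assumes smult_mult_left:
      "\<lbrakk>k \<in> carrier K; x \<in> carrier A; y \<in> carrier A\<rbrakk>
        \<Longrightarrow> (k \<odot>\<^bsub>A\<^esub> x) \<otimes>\<^bsub>A\<^esub> y = k \<odot>\<^bsub>A\<^esub> (x \<otimes>\<^bsub>A\<^esub> y)"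
    and smult_mult_right:
      "\<lbrakk>k \<in> carrier K; x \<in> carrier A; y \<in> carrier A\<rbrakk>
        \<Longrightarrow> x \<otimes>\<^bsub>A\<^esub> (k \<odot>\<^bsub>A\<^esub> y) = k \<odot>\<^bsub>A\<^esub> (x \<otimes>\<^bsub>A\<^esub> y)"
    and finite_dimensional: "fin_dim"

text \<open>
  As for \<^typ>\<open>('k, 'm) module\<close> itself, the ring multiplication and unit that the records below
  inherit carry no information.
\<close>

record ('k, 'a, 'm) rmod = "('k, 'm) module" +
  ract :: "'m \<Rightarrow> 'a \<Rightarrow> 'm" (infixl \<open>\<triangleleft>\<index>\<close> 70)

record ('k, 'a, 'm) bimod = "('k, 'a, 'm) rmod" +
  lact :: "'a \<Rightarrow> 'm \<Rightarrow> 'm" (infixr \<open>\<triangleright>\<index>\<close> 70)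

locale right_module = A: fd_algebra K A + vectorspace K M
  for K :: "('k, 'c) ring_scheme" and A :: "('k, 'a, 'y) module_scheme"
    and M :: "('k, 'a, 'm, 'z) rmod_scheme" (structure) +
  assumes ract_closed:
      "\<lbrakk>x \<in> carrier M; a \<in> carrier A\<rbrakk> \<Longrightarrow> x \<triangleleft> a \<in> carrier M"
    and ract_add_left:
      "\<lbrakk>x \<in> carrier M; y \<in> carrier M; a \<in> carrier A\<rbrakk> \<Longrightarrow> (x \<oplus> y) \<triangleleft> a = x \<triangleleft> a \<oplus> y \<triangleleft> a"
    and ract_add_right:
      "\<lbrakk>x \<in> carrier M; a \<in> carrier A; b \<in> carrier A\<rbrakk>
        \<Longrightarrow> x \<triangleleft> (a \<oplus>\<^bsub>A\<^esub> b) = x \<triangleleft> a \<oplus> x \<triangleleft> b"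
    and ract_smult_left:
      "\<lbrakk>k \<in> carrier K; x \<in> carrier M; a \<in> carrier A\<rbrakk> \<Longrightarrow> (k \<odot> x) \<triangleleft> a = k \<odot> (x \<triangleleft> a)"
    and ract_smult_right:
      "\<lbrakk>k \<in> carrier K; x \<in> carrier M; a \<in> carrier A\<rbrakk>
        \<Longrightarrow> x \<triangleleft> (k \<odot>\<^bsub>A\<^esub> a) = k \<odot> (x \<triangleleft> a)"
    and ract_mult:
      "\<lbrakk>x \<in> carrier M; a \<in> carrier A; b \<in> carrier A\<rbrakk>
        \<Longrightarrow> x \<triangleleft> (a \<otimes>\<^bsub>A\<^esub> b) = (x \<triangleleft> a) \<triangleleft> b"
    and ract_one: "x \<in> carrier M \<Longrightarrow> x \<triangleleft> \<one>\<^bsub>A\<^esub> = x"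

locale bimodule = right_module K A M
  for K :: "('k, 'c) ring_scheme" and A :: "('k, 'a, 'y) module_scheme"
    and M :: "('k, 'a, 'm, 'z) bimod_scheme" (structure) +
  assumes lact_closed:
      "\<lbrakk>a \<in> carrier A; x \<in> carrier M\<rbrakk> \<Longrightarrow> a \<triangleright> x \<in> carrier M"
    and lact_add_right:
      "\<lbrakk>a \<in> carrier A; x \<in> carrier M; y \<in> carrier M\<rbrakk> \<Longrightarrow> a \<triangleright> (x \<oplus> y) = (a \<triangleright> x) \<oplus> (a \<triangleright> y)"
    and lact_add_left:
      "\<lbrakk>a \<in> carrier A; b \<in> carrier A; x \<in> carrier M\<rbrakk>
        \<Longrightarrow> (a \<oplus>\<^bsub>A\<^esub> b) \<triangleright> x = (a \<triangleright> x) \<oplus> (b \<triangleright> x)"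
    and lact_smult_right:
      "\<lbrakk>k \<in> carrier K; a \<in> carrier A; x \<in> carrier M\<rbrakk> \<Longrightarrow> a \<triangleright> (k \<odot> x) = k \<odot> (a \<triangleright> x)"
    and lact_smult_left:
      "\<lbrakk>k \<in> carrier K; a \<in> carrier A; x \<in> carrier M\<rbrakk>
        \<Longrightarrow> (k \<odot>\<^bsub>A\<^esub> a) \<triangleright> x = k \<odot> (a \<triangleright> x)"
    and lact_mult:
      "\<lbrakk>a \<in> carrier A; b \<in> carrier A; x \<in> carrier M\<rbrakk>
        \<Longrightarrow> (a \<otimes>\<^bsub>A\<^esub> b) \<triangleright> x = a \<triangleright> (b \<triangleright> x)"
    and lact_one: "x \<in> carrier M \<Longrightarrow> \<one>\<^bsub>A\<^esub> \<triangleright> x = x"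
    and lact_ract:
      "\<lbrakk>a \<in> carrier A; x \<in> carrier M; b \<in> carrier A\<rbrakk> \<Longrightarrow> (a \<triangleright> x) \<triangleleft> b = a \<triangleright> (x \<triangleleft> b)"

definition rmod_hom where
  "rmod_hom K A M N =
    {f \<in> module_hom K M N. \<forall>x\<in>carrier M. \<forall>a\<in>carrier A. f (x \<triangleleft>\<^bsub>M\<^esub> a) = f x \<triangleleft>\<^bsub>N\<^esub> a}"

definition bimod_hom where
  "bimod_hom K A M N =
    {f \<in> rmod_hom K A M N. \<forall>a\<in>carrier A. \<forall>x\<in>carrier M. f (a \<triangleright>\<^bsub>M\<^esub> x) = a \<triangleright>\<^bsub>N\<^esub> f x}"

definition rmod_isomorphic where
  "rmod_isomorphic K A M N \<longleftrightarrow> (\<exists>f \<in> rmod_hom K A M N. bij_betw f (carrier M) (carrier N))"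

definition bimod_isomorphic where
  "bimod_isomorphic K A M N \<longleftrightarrow> (\<exists>f \<in> bimod_hom K A M N. bij_betw f (carrier M) (carrier N))"

definition alg_isomorphic where
  "alg_isomorphic K A B \<longleftrightarrow>
    (\<exists>f \<in> module_hom K A B \<inter> ring_hom A B. bij_betw f (carrier A) (carrier B))"

definition regular_bimod :: "('k, 'a, 'z) module_scheme \<Rightarrow> ('k, 'a, 'a) bimod" where
  "regular_bimod A =
    \<lparr>carrier = carrier A, monoid.mult = monoid.mult A, one = one A, zero = zero A, add = add A,
     smult = smult A, ract = monoid.mult A, lact = monoid.mult A\<rparr>"

text \<open>
  Linear forms are taken extensional, so that equality in the dual is equality of functions.
  The left action comes from the right multiplication of the argument and vice versa.
\<close>

definition dual_bimod ::
  "('k, 'c) ring_scheme \<Rightarrow> ('k, 'a, 'z) module_scheme \<Rightarrow> ('k, 'a, 'a \<Rightarrow> 'k) bimod" where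
  "dual_bimod K A =
    \<lparr>carrier = {f \<in> carrier A \<rightarrow>\<^sub>E carrier K.
        (\<forall>x\<in>carrier A. \<forall>y\<in>carrier A. f (x \<oplus>\<^bsub>A\<^esub> y) = f x \<oplus>\<^bsub>K\<^esub> f y) \<and>
        (\<forall>k\<in>carrier K. \<forall>x\<in>carrier A. f (k \<odot>\<^bsub>A\<^esub> x) = k \<otimes>\<^bsub>K\<^esub> f x)},
     monoid.mult = undefined, one = undefined,
     zero = (\<lambda>x\<in>carrier A. \<zero>\<^bsub>K\<^esub>),
     add = (\<lambda>f g. \<lambda>x\<in>carrier A. f x \<oplus>\<^bsub>K\<^esub> g x),
     smult = (\<lambda>k f. \<lambda>x\<in>carrier A. k \<otimes>\<^bsub>K\<^esub> f x),
     ract = (\<lambda>f a. \<lambda>x\<in>carrier A. f (a \<otimes>\<^bsub>A\<^esub> x)),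
     lact = (\<lambda>a f. \<lambda>x\<in>carrier A. f (x \<otimes>\<^bsub>A\<^esub> a))\<rparr>"


lemma dual_bimodule:
  assumes "fd_algebra K A"
  shows "bimodule K A (dual_bimod K A)"
proof -
  interpret K: field K using assms by (simp add: fd_algebra_def vectorspace_def)
  interpret A: ring A using assms by (simp add: fd_algebra_def)
  interpret fd_algebra K A by fact
  let ?D = "dual_bimod K A"
  have mem: "f \<in> carrier ?D \<longleftrightarrow> f \<in> carrier A \<rightarrow>\<^sub>E carrier K \<and>
        (\<forall>x\<in>carrier A. \<forall>y\<in>carrier A. f (x \<oplus>\<^bsub>A\<^esub> y) = f x \<oplus>\<^bsub>K\<^esub> f y) \<and>
        (\<forall>k\<in>carrier K. \<forall>x\<in>carrier A. f (k \<odot>\<^bsub>A\<^esub> x) = k \<otimes>\<^bsub>K\<^esub> f x)" for f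
    by (simp add: dual_bimod_def)
  have app: "f x \<in> carrier K" if "f \<in> carrier ?D" "x \<in> carrier A" for f x
    using that unfolding mem by blast
  have arb: "f x = undefined" if "f \<in> carrier ?D" "x \<notin> carrier A" for f x
    using that unfolding mem by (blast intro: PiE_arb)
  have lin_add: "f (x \<oplus>\<^bsub>A\<^esub> y) = f x \<oplus>\<^bsub>K\<^esub> f y"
    if "f \<in> carrier ?D" "x \<in> carrier A" "y \<in> carrier A" for f x y
    using that unfolding mem by blast
  have lin_smult: "f (k \<odot>\<^bsub>A\<^esub> x) = k \<otimes>\<^bsub>K\<^esub> f x"
    if "f \<in> carrier ?D" "x \<in> carrier A" "k \<in> carrier K" for f x k
    using that unfolding mem by blast
  have memI: "f \<in> carrier ?D" if "f \<in> extensional (carrier A)" "\<And>x. x \<in> carrier A \<Longrightarrow> f x \<in> carrier K"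
      "\<And>x y. \<lbrakk>x \<in> carrier A; y \<in> carrier A\<rbrakk> \<Longrightarrow> f (x \<oplus>\<^bsub>A\<^esub> y) = f x \<oplus>\<^bsub>K\<^esub> f y"
      "\<And>k x. \<lbrakk>k \<in> carrier K; x \<in> carrier A\<rbrakk> \<Longrightarrow> f (k \<odot>\<^bsub>A\<^esub> x) = k \<otimes>\<^bsub>K\<^esub> f x" for f
    using that by (simp add: mem PiE_iff)
  have ops: "\<zero>\<^bsub>?D\<^esub> = (\<lambda>x\<in>carrier A. \<zero>\<^bsub>K\<^esub>)" "f \<oplus>\<^bsub>?D\<^esub> g = (\<lambda>x\<in>carrier A. f x \<oplus>\<^bsub>K\<^esub> g x)"
    "k \<odot>\<^bsub>?D\<^esub> f = (\<lambda>x\<in>carrier A. k \<otimes>\<^bsub>K\<^esub> f x)"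
    "f \<triangleleft>\<^bsub>?D\<^esub> a = (\<lambda>x\<in>carrier A. f (a \<otimes>\<^bsub>A\<^esub> x))"
    "a \<triangleright>\<^bsub>?D\<^esub> f = (\<lambda>x\<in>carrier A. f (x \<otimes>\<^bsub>A\<^esub> a))" for f g k a
    by (simp_all add: dual_bimod_def)
  have closed: "\<zero>\<^bsub>?D\<^esub> \<in> carrier ?D"
    "\<lbrakk>f \<in> carrier ?D; g \<in> carrier ?D\<rbrakk> \<Longrightarrow> f \<oplus>\<^bsub>?D\<^esub> g \<in> carrier ?D"
    "\<lbrakk>k \<in> carrier K; f \<in> carrier ?D\<rbrakk> \<Longrightarrow> k \<odot>\<^bsub>?D\<^esub> f \<in> carrier ?D"
    "\<lbrakk>f \<in> carrier ?D; a \<in> carrier A\<rbrakk> \<Longrightarrow> f \<triangleleft>\<^bsub>?D\<^esub> a \<in> carrier ?D"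
    "\<lbrakk>f \<in> carrier ?D; a \<in> carrier A\<rbrakk> \<Longrightarrow> a \<triangleright>\<^bsub>?D\<^esub> f \<in> carrier ?D" for f g k a
    unfolding ops
    by (rule memI; simp add: lin_add lin_smult app K.add.m_ac K.r_distr K.m_ac smult_mult_left smult_mult_right A.l_distr A.r_distr)+
  note ext = extensionalityI[where A = "carrier A"]
  have "abelian_group ?D"
  proof (rule abelian_groupI)
    fix f assume f: "f \<in> carrier ?D"
    show "\<exists>g\<in>carrier ?D. g \<oplus>\<^bsub>?D\<^esub> f = \<zero>\<^bsub>?D\<^esub>"
    proof
      show "(\<ominus>\<^bsub>K\<^esub> \<one>\<^bsub>K\<^esub>) \<odot>\<^bsub>?D\<^esub> f \<in> carrier ?D"
        using f by (intro closed) simp_all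
      show "((\<ominus>\<^bsub>K\<^esub> \<one>\<^bsub>K\<^esub>) \<odot>\<^bsub>?D\<^esub> f) \<oplus>\<^bsub>?D\<^esub> f = \<zero>\<^bsub>?D\<^esub>"
        unfolding ops by (rule restrict_ext) (simp add: app[OF f] K.l_minus K.l_neg)
    qed
  next
    fix f assume f: "f \<in> carrier ?D"
    show "\<zero>\<^bsub>?D\<^esub> \<oplus>\<^bsub>?D\<^esub> f = f"
      unfolding ops by (intro ext) (simp_all add: app[OF f] arb[OF f] extensional_def)
  qed (auto simp: closed(1,2)[unfolded ops] ops app K.add.m_ac intro!: restrict_ext)
  then have mod: "module K ?D"
    by (intro moduleI) (auto simp: closed(3)[unfolded ops] ops app K.l_distr K.r_distr K.m_assoc arb fun_eq_iff K.is_cring)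
  show ?thesis
    using mod assms
    by (auto simp: bimodule_def bimodule_axioms_def right_module_def right_module_axioms_def
        vectorspace_def K.field_axioms closed
       , auto simp: ops fun_eq_iff app arb lin_add lin_smult A.m_assoc A.l_distr A.r_distr smult_mult_left smult_mult_right)
qed


section \<open>Gendo-symmetric algebras\<close>

definition symmetric_algebra where
  "symmetric_algebra K B \<longleftrightarrow>
    fd_algebra K B \<and> bimod_isomorphic K B (regular_bimod B) (dual_bimod K B)"

definition rmod_power ::
  "nat \<Rightarrow> ('k, 'a, 'm, 'z) rmod_scheme \<Rightarrow> ('k, 'a, nat \<Rightarrow> 'm) rmod" where
  "rmod_power n M =
    \<lparr>carrier = {..<n} \<rightarrow>\<^sub>E carrier M, monoid.mult = undefined, one = undefined,
     zero = (\<lambda>i\<in>{..<n}. \<zero>\<^bsub>M\<^esub>),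
     add = (\<lambda>x y. \<lambda>i\<in>{..<n}. x i \<oplus>\<^bsub>M\<^esub> y i),
     smult = (\<lambda>k x. \<lambda>i\<in>{..<n}. k \<odot>\<^bsub>M\<^esub> x i),
     ract = (\<lambda>x a. \<lambda>i\<in>{..<n}. x i \<triangleleft>\<^bsub>M\<^esub> a)\<rparr>"

definition rsubmodule where
  "rsubmodule K A U M \<longleftrightarrow>
    submodule K U M \<and> (\<forall>x\<in>U. \<forall>a\<in>carrier A. x \<triangleleft>\<^bsub>M\<^esub> a \<in> U)"

definition direct_summand where
  "direct_summand K A X M \<longleftrightarrow>
    (\<exists>U V. rsubmodule K A U M \<and> rsubmodule K A V M \<and>
      U \<inter> V = {\<zero>\<^bsub>M\<^esub>} \<and> (\<forall>x\<in>carrier M. \<exists>u\<in>U. \<exists>v\<in>V. x = u \<oplus>\<^bsub>M\<^esub> v) \<and>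
      rmod_isomorphic K A X (M\<lparr>carrier := U\<rparr>))"

definition generator_module where
  "generator_module K A M \<longleftrightarrow> (\<exists>n. direct_summand K A (regular_bimod A) (rmod_power n M))"

definition end_algebra ::
  "('k, 'c) ring_scheme \<Rightarrow> ('k, 'a, 'y) module_scheme \<Rightarrow> ('k, 'a, 'm, 'z) rmod_scheme
    \<Rightarrow> ('k, 'm \<Rightarrow> 'm) module" where
  "end_algebra K A M =
    \<lparr>carrier = rmod_hom K A M M \<inter> extensional (carrier M),
     monoid.mult = compose (carrier M),
     one = (\<lambda>x\<in>carrier M. x),
     zero = (\<lambda>x\<in>carrier M. \<zero>\<^bsub>M\<^esub>),
     add = (\<lambda>f g. \<lambda>x\<in>carrier M. f x \<oplus>\<^bsub>M\<^esub> g x),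
     smult = (\<lambda>k f. \<lambda>x\<in>carrier M. k \<odot>\<^bsub>M\<^esub> f x)\<rparr>"

text \<open>
  HOL cannot quantify existentially over types, so the carriers of \<open>B\<close> and \<open>M\<close> are taken inside
  \<^typ>\<open>nat \<Rightarrow> 'k\<close>, which contains a copy of every finite-dimensional space over \<open>K\<close>.  The lemma
  \<open>gendo_symmetricI\<close> below shows that \<open>B\<close> and \<open>M\<close> may live on arbitrary types.
\<close>

definition gendo_symmetric ::
  "('k, 'c) ring_scheme \<Rightarrow> ('k, 'a, 'z) module_scheme \<Rightarrow> bool" where
  "gendo_symmetric K A \<longleftrightarrow>
    (\<exists>(B :: ('k, nat \<Rightarrow> 'k) module) (M :: ('k, nat \<Rightarrow> 'k, nat \<Rightarrow> 'k) rmod).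
      symmetric_algebra K B \<and> right_module K B M \<and> vectorspace.fin_dim K M \<and>
      generator_module K B M \<and> alg_isomorphic K A (end_algebra K B M))"


subsection \<open>Independence of the carrier types\<close>

text \<open>Structures carried over along an injection \<open>h\<close> of the carrier.\<close>

definition alg_copy :: "('b \<Rightarrow> 'd) \<Rightarrow> ('k, 'b, 'z) module_scheme \<Rightarrow> ('k, 'd) module" where
  "alg_copy h B = (let g = inv_into (carrier B) h in
    \<lparr>carrier = h ` carrier B, monoid.mult = (\<lambda>x y. h (g x \<otimes>\<^bsub>B\<^esub> g y)), one = h \<one>\<^bsub>B\<^esub>,
     zero = h \<zero>\<^bsub>B\<^esub>, add = (\<lambda>x y. h (g x \<oplus>\<^bsub>B\<^esub> g y)), smult = (\<lambda>k x. h (k \<odot>\<^bsub>B\<^esub> g x))\<rparr>)"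

definition rmod_copy ::
  "('b \<Rightarrow> 'd) \<Rightarrow> ('k, 'b, 'y) module_scheme \<Rightarrow> ('m \<Rightarrow> 'e) \<Rightarrow> ('k, 'b, 'm, 'z) rmod_scheme
    \<Rightarrow> ('k, 'd, 'e) rmod" where
  "rmod_copy h B p M = module.extend (alg_copy p M)
    \<lparr>ract = (\<lambda>x b. p (inv_into (carrier M) p x \<triangleleft>\<^bsub>M\<^esub> inv_into (carrier B) h b))\<rparr>"

lemma alg_copy_simps:
  "carrier (alg_copy h B) = h ` carrier B" "\<one>\<^bsub>alg_copy h B\<^esub> = h \<one>\<^bsub>B\<^esub>" "\<zero>\<^bsub>alg_copy h B\<^esub> = h \<zero>\<^bsub>B\<^esub>"
  by (simp_all add: alg_copy_def Let_def)

lemma alg_copy_ops: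
  assumes "inj_on h (carrier B)" "x \<in> carrier B"
  shows "y \<in> carrier B \<Longrightarrow> h x \<otimes>\<^bsub>alg_copy h B\<^esub> h y = h (x \<otimes>\<^bsub>B\<^esub> y)"
    and "y \<in> carrier B \<Longrightarrow> h x \<oplus>\<^bsub>alg_copy h B\<^esub> h y = h (x \<oplus>\<^bsub>B\<^esub> y)"
    and "k \<odot>\<^bsub>alg_copy h B\<^esub> h x = h (k \<odot>\<^bsub>B\<^esub> x)"
  using assms by (simp_all add: alg_copy_def Let_def)

lemma rmod_copy_simps:
  "carrier (rmod_copy h B p M) = p ` carrier M" "\<zero>\<^bsub>rmod_copy h B p M\<^esub> = p \<zero>\<^bsub>M\<^esub>"
  by (simp_all add: rmod_copy_def alg_copy_def Let_def module.defs)

lemma rmod_copy_ops: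
  assumes "inj_on p (carrier M)" "x \<in> carrier M"
  shows "y \<in> carrier M \<Longrightarrow> p x \<oplus>\<^bsub>rmod_copy h B p M\<^esub> p y = p (x \<oplus>\<^bsub>M\<^esub> y)"
    and "k \<odot>\<^bsub>rmod_copy h B p M\<^esub> p x = p (k \<odot>\<^bsub>M\<^esub> x)"
    and "\<lbrakk>inj_on h (carrier B); b \<in> carrier B\<rbrakk> \<Longrightarrow> p x \<triangleleft>\<^bsub>rmod_copy h B p M\<^esub> h b = p (x \<triangleleft>\<^bsub>M\<^esub> b)"
  using assms by (simp_all add: rmod_copy_def alg_copy_def Let_def module.defs)


lemma vectorspace_image:
  fixes N :: "('k, 'n, 'z) module_scheme"
  assumes "vectorspace K V" and carr: "carrier N = h ` carrier V"
    and zero: "\<zero>\<^bsub>N\<^esub> = h \<zero>\<^bsub>V\<^esub>"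
    and add: "\<And>x y. \<lbrakk>x \<in> carrier V; y \<in> carrier V\<rbrakk> \<Longrightarrow> h x \<oplus>\<^bsub>N\<^esub> h y = h (x \<oplus>\<^bsub>V\<^esub> y)"
    and smult: "\<And>k x. \<lbrakk>k \<in> carrier K; x \<in> carrier V\<rbrakk> \<Longrightarrow> k \<odot>\<^bsub>N\<^esub> h x = h (k \<odot>\<^bsub>V\<^esub> x)"
  shows "vectorspace K N" "vectorspace.fin_dim K V \<Longrightarrow> vectorspace.fin_dim K N"
proof -
  interpret V: vectorspace K V by fact
  have "abelian_group N"
  proof (rule abelian_groupI)
    fix x assume "x \<in> carrier N"
    then obtain u where u: "u \<in> carrier V" "x = h u" using carr by blast
    show "\<exists>y\<in>carrier N. y \<oplus>\<^bsub>N\<^esub> x = \<zero>\<^bsub>N\<^esub>"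
      using u by (intro bexI[of _ "h (\<ominus>\<^bsub>V\<^esub> u)"]) (auto simp: carr add zero V.M.l_neg)
  qed (auto simp: carr add zero V.M.add.m_ac)
  then have "module K N"
    by (intro moduleI) (auto simp: carr add zero smult V.smult_l_distr V.smult_r_distr
      V.smult_assoc1 V.is_cring)
  then show N: "vectorspace K N"
    by (simp add: vectorspace_def V.field_axioms)
  assume fd: "vectorspace.fin_dim K V"
  interpret linear_map K V N h
    using N V.vectorspace_axioms
    by (auto simp: linear_map_def mod_hom_def mod_hom_axioms_def module_hom_def vectorspace_def
        carr add smult)
  show "vectorspace.fin_dim K N"
    using rank_nullity_main(2) fd carr by simp
qed

lemma fin_dim_inj:
  assumes "vectorspace K V" "vectorspace.fin_dim K V"
  obtains h :: "'v \<Rightarrow> nat \<Rightarrow> 'k" where "inj_on h (carrier (V :: ('k, 'v, 'z) module_scheme))"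
proof -
  interpret V: vectorspace K V by fact
  obtain S where S: "finite S" "S \<subseteq> carrier V" "V.span S = carrier V"
    using assms(2) V.fin_dim_def by auto
  obtain e :: "_ \<Rightarrow> nat" where e: "inj_on e S"
    using finite_imp_inj_to_nat_seg[OF S(1)] by auto
  have "\<exists>a \<in> S \<rightarrow> carrier K. V.lincomb a S = v" if "v \<in> carrier V" for v
  proof -
    have "v \<in> {V.lincomb a S |a. a \<in> S \<rightarrow> carrier K}"
      using that S(3) V.finite_span[OF S(1,2)] by simp
    then show ?thesis by blast
  qed
  then obtain c where c: "\<And>v. v \<in> carrier V \<Longrightarrow> c v \<in> S \<rightarrow> carrier K"
      "\<And>v. v \<in> carrier V \<Longrightarrow> V.lincomb (c v) S = v" by metis
  have "inj_on (\<lambda>v n. c v (inv_into S e n)) (carrier V)"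
  proof (rule inj_onI)
    fix v w assume vw: "v \<in> carrier V" "w \<in> carrier V"
      and eq: "(\<lambda>n. c v (inv_into S e n)) = (\<lambda>n. c w (inv_into S e n))"
    have "c v s = c w s" if "s \<in> S" for s
      using fun_cong[OF eq, of "e s"] e that by simp
    then have "V.lincomb (c v) S = V.lincomb (c w) S"
      unfolding V.lincomb_def using c(1)[OF vw(1)] c(1)[OF vw(2)] S(2)
      by (intro V.M.finsum_cong') (auto simp: Pi_iff subset_iff)
    then show "v = w" using c vw by simp
  qed
  then show ?thesis by (rule that)
qed

locale alg_image =
  fixes K :: "('k, 'c) ring_scheme" and B :: "('k, 'b, 'y) module_scheme"
    and B' :: "('k, 'd, 'z) module_scheme" and h :: "'b \<Rightarrow> 'd"
  assumes B: "fd_algebra K B" and inj: "inj_on h (carrier B)"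
    and carr: "carrier B' = h ` carrier B"
    and one: "\<one>\<^bsub>B'\<^esub> = h \<one>\<^bsub>B\<^esub>" and zero: "\<zero>\<^bsub>B'\<^esub> = h \<zero>\<^bsub>B\<^esub>"
    and mult: "\<And>x y. \<lbrakk>x \<in> carrier B; y \<in> carrier B\<rbrakk> \<Longrightarrow> h x \<otimes>\<^bsub>B'\<^esub> h y = h (x \<otimes>\<^bsub>B\<^esub> y)"
    and add: "\<And>x y. \<lbrakk>x \<in> carrier B; y \<in> carrier B\<rbrakk> \<Longrightarrow> h x \<oplus>\<^bsub>B'\<^esub> h y = h (x \<oplus>\<^bsub>B\<^esub> y)"
    and smult: "\<And>k x. \<lbrakk>k \<in> carrier K; x \<in> carrier B\<rbrakk> \<Longrightarrow> k \<odot>\<^bsub>B'\<^esub> h x = h (k \<odot>\<^bsub>B\<^esub> x)"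
begin

sublocale B: fd_algebra K B by (rule B)

lemma fd_image: "fd_algebra K B'"
proof -
  have V: "vectorspace K B'" "vectorspace.fin_dim K B'"
    using vectorspace_image[OF B.vectorspace_axioms carr zero add smult] B.finite_dimensional by auto
  then interpret V: vectorspace K B' by simp
  have "ring B'"
    by (intro ringI V.M.abelian_group_axioms Group.monoidI)
      (auto simp: carr add mult one B.m_assoc B.l_distr B.r_distr)
  then show ?thesis
    using V by (auto simp: fd_algebra_def fd_algebra_axioms_def carr smult mult
      B.smult_mult_left B.smult_mult_right)
qed

definition "g = inv_into (carrier B) h"

lemma g [simp]: "x \<in> carrier B \<Longrightarrow> g (h x) = x"
  by (simp add: g_def inj)

lemma symmetric_image:
  assumes "symmetric_algebra K B"
  shows "symmetric_algebra K B'"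
proof -
  obtain f where f: "f \<in> bimod_hom K B (regular_bimod B) (dual_bimod K B)"
    and bij: "bij_betw f (carrier B) (carrier (dual_bimod K B))"
    using assms by (auto simp: symmetric_algebra_def bimod_isomorphic_def regular_bimod_def)
  define d where "d = (\<lambda>u. \<lambda>y\<in>carrier B'. u (g y) :: 'k)"
  have d_bij: "bij_betw d (carrier (dual_bimod K B)) (carrier (dual_bimod K B'))"
  proof (rule bij_betwI[where g = "\<lambda>u. \<lambda>x\<in>carrier B. u (h x)"])
    show "d \<in> carrier (dual_bimod K B) \<rightarrow> carrier (dual_bimod K B')"
    proof
      fix u assume u: "u \<in> carrier (dual_bimod K B)"
      then show "d u \<in> carrier (dual_bimod K B')"
        by (simp add: d_def dual_bimod_def carr add smult PiE_iff)
    qed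
    show "(\<lambda>u. \<lambda>x\<in>carrier B. u (h x)) \<in> carrier (dual_bimod K B') \<rightarrow> carrier (dual_bimod K B)"
    proof
      fix u assume u: "u \<in> carrier (dual_bimod K B')"
      have "u (h (x \<oplus>\<^bsub>B\<^esub> y)) = u (h x) \<oplus>\<^bsub>K\<^esub> u (h y)" if "x \<in> carrier B" "y \<in> carrier B" for x y
        using u that by (simp add: dual_bimod_def carr add[OF that, symmetric])
      moreover have "u (h (k \<odot>\<^bsub>B\<^esub> x)) = k \<otimes>\<^bsub>K\<^esub> u (h x)" if "k \<in> carrier K" "x \<in> carrier B" for k x
        using u that by (simp add: dual_bimod_def carr smult[OF that, symmetric])
      ultimately show "(\<lambda>x\<in>carrier B. u (h x)) \<in> carrier (dual_bimod K B)"
        using u by (simp add: dual_bimod_def carr PiE_iff)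
    qed
  next
    fix u assume "u \<in> carrier (dual_bimod K B)"
    then show "(\<lambda>x\<in>carrier B. d u (h x)) = u"
      by (auto simp: d_def dual_bimod_def carr fun_eq_iff PiE_iff extensional_def)
  next
    fix u assume "u \<in> carrier (dual_bimod K B')"
    then show "d (\<lambda>x\<in>carrier B. u (h x)) = u"
      by (auto simp: d_def dual_bimod_def carr fun_eq_iff PiE_iff extensional_def)
  qed
  have g_bij: "bij_betw g (carrier B') (carrier B)"
    by (auto simp: bij_betw_def inj_on_def carr image_image)
  have dual_carr: "f x \<in> carrier (dual_bimod K B)" if "x \<in> carrier B" for x
    using bij that by (auto simp: bij_betw_def)
  let ?D = "dual_bimod K B" and ?D' = "dual_bimod K B'"
  have d_eqI: "d u = (\<lambda>y\<in>carrier B'. w y)" if "\<And>z. z \<in> carrier B \<Longrightarrow> u z = w (h z)" for u w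
    unfolding d_def by (rule restrict_ext) (use that in \<open>auto simp: carr\<close>)
  have d_app: "d u (h z) = u z" if "z \<in> carrier B" for u z
    using that by (simp add: d_def carr)
  have d_add: "d (u \<oplus>\<^bsub>?D\<^esub> v) = d u \<oplus>\<^bsub>?D'\<^esub> d v" for u v
    by (simp add: dual_bimod_def) (rule d_eqI, simp add: d_app)
  have d_smult: "d (k \<odot>\<^bsub>?D\<^esub> u) = k \<odot>\<^bsub>?D'\<^esub> d u" for k u
    by (simp add: dual_bimod_def) (rule d_eqI, simp add: d_app)
  have d_ract: "d (u \<triangleleft>\<^bsub>?D\<^esub> b) = d u \<triangleleft>\<^bsub>?D'\<^esub> h b" if "b \<in> carrier B" for u b
    using that by (simp add: dual_bimod_def) (rule d_eqI, simp add: d_app mult)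
  have d_lact: "d (b \<triangleright>\<^bsub>?D\<^esub> u) = h b \<triangleright>\<^bsub>?D'\<^esub> d u" if "b \<in> carrier B" for u b
    using that by (simp add: dual_bimod_def) (rule d_eqI, simp add: d_app mult)
  have "(\<lambda>x. d (f (g x))) \<in> bimod_hom K B' (regular_bimod B') ?D'"
    using f bij_betwE[OF d_bij] dual_carr
    by (auto simp: bimod_hom_def rmod_hom_def module_hom_def carr add smult mult regular_bimod_def
        d_add d_smult simp flip: d_ract d_lact)
  moreover have "bij_betw (\<lambda>x. d (f (g x))) (carrier B') (carrier (dual_bimod K B'))"
    using bij_betw_trans[OF bij_betw_trans[OF g_bij bij] d_bij] by (simp add: comp_def)
  ultimately show ?thesis
    using fd_image by (auto simp: symmetric_algebra_def bimod_isomorphic_def regular_bimod_def)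
qed

end

locale rmod_image = alg_image K B B' h
  for K :: "('k, 'c) ring_scheme" and B :: "('k, 'b, 'y) module_scheme"
    and B' :: "('k, 'd, 'z) module_scheme" and h :: "'b \<Rightarrow> 'd" +
  fixes M :: "('k, 'b, 'm, 'x) rmod_scheme" and M' :: "('k, 'd, 'n, 'w) rmod_scheme"
    and p :: "'m \<Rightarrow> 'n"
  assumes M: "right_module K B M"
    and pinj: "inj_on p (carrier M)"
    and pcarr: "carrier M' = p ` carrier M"
    and pzero: "\<zero>\<^bsub>M'\<^esub> = p \<zero>\<^bsub>M\<^esub>"
    and padd: "\<And>x y. \<lbrakk>x \<in> carrier M; y \<in> carrier M\<rbrakk> \<Longrightarrow> p x \<oplus>\<^bsub>M'\<^esub> p y = p (x \<oplus>\<^bsub>M\<^esub> y)"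
    and psmult: "\<And>k x. \<lbrakk>k \<in> carrier K; x \<in> carrier M\<rbrakk> \<Longrightarrow> k \<odot>\<^bsub>M'\<^esub> p x = p (k \<odot>\<^bsub>M\<^esub> x)"
    and pract: "\<And>x b. \<lbrakk>x \<in> carrier M; b \<in> carrier B\<rbrakk> \<Longrightarrow> p x \<triangleleft>\<^bsub>M'\<^esub> h b = p (x \<triangleleft>\<^bsub>M\<^esub> b)"
begin

sublocale M: right_module K B M by (rule M)

lemma vectorspace_image': "vectorspace K M'"
    "vectorspace.fin_dim K M \<Longrightarrow> vectorspace.fin_dim K M'"
  using vectorspace_image[OF M.vectorspace_axioms pcarr pzero padd psmult] by auto

lemma rmod_image: "right_module K B' M'"
  using fd_image vectorspace_image'(1)
  by (auto simp: right_module_def right_module_axioms_def pcarr carr pract padd psmult add smult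
    mult one M.ract_closed M.ract_add_left M.ract_add_right M.ract_smult_left M.ract_smult_right
    M.ract_mult M.ract_one)

definition "q = inv_into (carrier M) p"

lemma q [simp]: "x \<in> carrier M \<Longrightarrow> q (p x) = x"
  by (simp add: q_def pinj)

lemma end_image:
  assumes "alg_isomorphic K A (end_algebra K B M)"
  shows "alg_isomorphic K A (end_algebra K B' M')"
proof -
  obtain f where f: "f \<in> module_hom K A (end_algebra K B M)" "f \<in> ring_hom A (end_algebra K B M)"
    and bij: "bij_betw f (carrier A) (carrier (end_algebra K B M))"
    using assms by (auto simp: alg_isomorphic_def)
  define d where "d = (\<lambda>u. \<lambda>y\<in>carrier M'. p (u (q y)))"
  have d_bij: "bij_betw d (carrier (end_algebra K B M)) (carrier (end_algebra K B' M'))"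
  proof (rule bij_betwI[where g = "\<lambda>u. \<lambda>x\<in>carrier M. q (u (p x))"])
    show "d \<in> carrier (end_algebra K B M) \<rightarrow> carrier (end_algebra K B' M')"
      by (auto simp: d_def end_algebra_def rmod_hom_def module_hom_def pcarr carr padd psmult pract
          M.ract_closed Pi_iff dest!: inj_onD[OF pinj])
    show "(\<lambda>u. \<lambda>x\<in>carrier M. q (u (p x))) \<in> carrier (end_algebra K B' M') \<rightarrow> carrier (end_algebra K B M)"
    proof
      fix u assume "u \<in> carrier (end_algebra K B' M')"
      then have u: "u \<in> rmod_hom K B' M' M'" by (simp add: end_algebra_def)
      then have "\<exists>y. y \<in> carrier M \<and> u (p x) = p y" if "x \<in> carrier M" for x
        using that by (fastforce simp: rmod_hom_def module_hom_def pcarr)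
      then obtain v where v: "\<And>x. x \<in> carrier M \<Longrightarrow> v x \<in> carrier M \<and> u (p x) = p (v x)" by metis
      have "(\<lambda>x\<in>carrier M. q (u (p x))) = restrict v (carrier M)"
        using v by (auto simp: fun_eq_iff)
      moreover have "restrict v (carrier M) \<in> carrier (end_algebra K B M)"
      proof -
        have "v (x \<oplus>\<^bsub>M\<^esub> y) = v x \<oplus>\<^bsub>M\<^esub> v y" if "x \<in> carrier M" "y \<in> carrier M" for x y
        proof (rule inj_onD[OF pinj])
          have "u (p x \<oplus>\<^bsub>M'\<^esub> p y) = u (p x) \<oplus>\<^bsub>M'\<^esub> u (p y)"
            using u that by (auto simp: rmod_hom_def module_hom_def pcarr)
          then show "p (v (x \<oplus>\<^bsub>M\<^esub> y)) = p (v x \<oplus>\<^bsub>M\<^esub> v y)" using v that by (simp add: padd)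
        qed (use v that in auto)
        moreover have "v (k \<odot>\<^bsub>M\<^esub> x) = k \<odot>\<^bsub>M\<^esub> v x" if "x \<in> carrier M" "k \<in> carrier K" for x k
        proof (rule inj_onD[OF pinj])
          have "u (k \<odot>\<^bsub>M'\<^esub> p x) = k \<odot>\<^bsub>M'\<^esub> u (p x)"
            using u that by (auto simp: rmod_hom_def module_hom_def pcarr)
          then show "p (v (k \<odot>\<^bsub>M\<^esub> x)) = p (k \<odot>\<^bsub>M\<^esub> v x)" using v that by (simp add: psmult)
        qed (use v that in auto)
        moreover have "v (x \<triangleleft>\<^bsub>M\<^esub> b) = v x \<triangleleft>\<^bsub>M\<^esub> b" if "x \<in> carrier M" "b \<in> carrier B" for x b
        proof (rule inj_onD[OF pinj])
          have "u (p x \<triangleleft>\<^bsub>M'\<^esub> h b) = u (p x) \<triangleleft>\<^bsub>M'\<^esub> h b"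
            using u that by (auto simp: rmod_hom_def pcarr carr)
          then show "p (v (x \<triangleleft>\<^bsub>M\<^esub> b)) = p (v x \<triangleleft>\<^bsub>M\<^esub> b)"
            using v that by (simp add: pract M.ract_closed)
        qed (use v that in \<open>auto simp: M.ract_closed\<close>)
        ultimately show ?thesis
          using v by (auto simp: end_algebra_def rmod_hom_def module_hom_def M.ract_closed)
      qed
      ultimately show "(\<lambda>x\<in>carrier M. q (u (p x))) \<in> carrier (end_algebra K B M)" by simp
    qed
  next
    fix u assume "u \<in> carrier (end_algebra K B' M')"
    then have u: "u \<in> carrier M' \<rightarrow> carrier M'" "u \<in> extensional (carrier M')"
      by (auto simp: end_algebra_def rmod_hom_def module_hom_def)
    have "p (q (u y)) = u y" if "y \<in> carrier M'" for y
    proof -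
      have "u y \<in> p ` carrier M" using u(1) that pcarr by auto
      then show ?thesis by (simp add: q_def f_inv_into_f)
    qed
    moreover have "p (q y) = y" if "y \<in> carrier M'" for y
      using that by (auto simp: pcarr)
    ultimately show "d (\<lambda>x\<in>carrier M. q (u (p x))) = u"
      using u(2) by (auto simp: d_def fun_eq_iff pcarr extensional_def)
  qed (auto simp: d_def end_algebra_def rmod_hom_def module_hom_def pcarr fun_eq_iff extensional_def
      Pi_iff)
  have end_carr: "u x \<in> carrier M" if "u \<in> carrier (end_algebra K B M)" "x \<in> carrier M" for u x
    using that by (auto simp: end_algebra_def rmod_hom_def module_hom_def)
  have "d \<circ> f \<in> module_hom K A (end_algebra K B' M')"
    using f(1) bij_betwE[OF d_bij] bij_betwE[OF bij] 
    by (auto simp: module_hom_def Pi_iff, auto simp: d_def end_algebra_def pcarr padd psmult fun_eq_iff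
        rmod_hom_def module_hom_def Pi_iff)
  moreover have "d \<circ> f \<in> ring_hom A (end_algebra K B' M')"
    using f(2) bij_betwE[OF d_bij] bij_betwE[OF bij] 
    by (auto simp: ring_hom_def Pi_iff, auto simp: d_def end_algebra_def pcarr padd psmult fun_eq_iff
        rmod_hom_def module_hom_def Pi_iff compose_def)
  ultimately show ?thesis
    using bij_betw_trans[OF bij d_bij] by (auto simp: alg_isomorphic_def)
qed

lemma generator_image:
  assumes "generator_module K B M"
  shows "generator_module K B' M'"
proof -
  obtain n U V f where U: "rsubmodule K B U (rmod_power n M)" and V: "rsubmodule K B V (rmod_power n M)"
    and UV: "U \<inter> V = {\<zero>\<^bsub>rmod_power n M\<^esub>}"
    and sum: "\<And>x. x\<in>carrier (rmod_power n M) \<Longrightarrow> \<exists>u\<in>U. \<exists>v\<in>V. x = u \<oplus>\<^bsub>rmod_power n M\<^esub> v"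
    and f: "f \<in> rmod_hom K B (regular_bimod B) ((rmod_power n M)\<lparr>carrier := U\<rparr>)"
    and bij: "bij_betw f (carrier B) U"
    using assms
    by (auto simp: generator_module_def direct_summand_def rmod_isomorphic_def regular_bimod_def)
  let ?P = "rmod_power n M" and ?P' = "rmod_power n M'"
  define d where "d = (\<lambda>x. \<lambda>i\<in>{..<n}. p (x i))"
  have sub: "U \<subseteq> carrier ?P" "V \<subseteq> carrier ?P"
    using U V by (auto simp: rsubmodule_def submodule_def)
  have vP: "vectorspace K ?P"
    using U by (auto simp: rsubmodule_def submodule_def vectorspace_def B.field_axioms)
  have mem: "x i \<in> carrier M" if "x \<in> carrier ?P" "i < n" for x i
    using that by (auto simp: rmod_power_def)
  have d_inj: "inj_on d (carrier ?P)"
  proof (rule inj_onI)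
    fix x y assume xy: "x \<in> carrier ?P" "y \<in> carrier ?P" "d x = d y"
    have "x i = y i" if "i < n" for i
      using fun_cong[OF xy(3), of i] that mem xy(1,2) pinj by (auto simp: d_def inj_on_def)
    then show "x = y"
      using xy(1,2) by (auto simp: rmod_power_def intro: PiE_ext)
  qed
  have d_carr: "carrier ?P' = d ` carrier ?P"
  proof (rule equalityI)
    show "d ` carrier ?P \<subseteq> carrier ?P'"
    proof
      fix y assume "y \<in> d ` carrier ?P"
      then obtain x where x: "x \<in> carrier ?P" "y = d x" by blast
      then show "y \<in> carrier ?P'"
        using mem[OF x(1)] by (simp add: d_def rmod_power_def pcarr)
    qed
    show "carrier ?P' \<subseteq> d ` carrier ?P"
    proof
      fix x assume x: "x \<in> carrier ?P'"
      have "\<exists>m. m \<in> carrier M \<and> x i = p m" if "i < n" for i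
        using x that by (auto simp: rmod_power_def pcarr PiE_iff)
      then obtain m where m: "\<And>i. i < n \<Longrightarrow> m i \<in> carrier M \<and> x i = p (m i)" by metis
      have "restrict m {..<n} \<in> carrier ?P"
        using m by (simp add: rmod_power_def)
      moreover have "d (restrict m {..<n}) = x"
        using m x by (intro ext) (simp add: rmod_power_def d_def PiE_iff extensional_def)
      ultimately show "x \<in> d ` carrier ?P" by (metis imageI)
    qed
  qed
  have d_zero: "\<zero>\<^bsub>?P'\<^esub> = d \<zero>\<^bsub>?P\<^esub>"
    by (auto simp: rmod_power_def d_def pzero fun_eq_iff)
  have d_add: "d x \<oplus>\<^bsub>?P'\<^esub> d y = d (x \<oplus>\<^bsub>?P\<^esub> y)" if "x \<in> carrier ?P" "y \<in> carrier ?P" for x y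
    using mem[OF that(1)] mem[OF that(2)] by (intro ext) (simp add: rmod_power_def d_def padd)
  have d_smult: "k \<odot>\<^bsub>?P'\<^esub> d x = d (k \<odot>\<^bsub>?P\<^esub> x)" if "k \<in> carrier K" "x \<in> carrier ?P" for k x
    using mem[OF that(2)] that(1) by (intro ext) (simp add: rmod_power_def d_def psmult)
  have d_ract: "d x \<triangleleft>\<^bsub>?P'\<^esub> h b = d (x \<triangleleft>\<^bsub>?P\<^esub> b)" if "x \<in> carrier ?P" "b \<in> carrier B" for x b
    using mem[OF that(1)] that(2) by (intro ext) (simp add: rmod_power_def d_def pract)
  have vP': "vectorspace K ?P'"
    by (rule vectorspace_image(1)[where h = d, OF vP d_carr d_zero]) (simp_all add: d_add d_smult)
  have d_sub: "rsubmodule K B' (d ` W) ?P'" if W: "rsubmodule K B W ?P" for W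
  proof -
    have "W \<subseteq> carrier ?P" using W by (auto simp: rsubmodule_def submodule_def)
    then show ?thesis
      using W vP' d_zero
      by (auto simp: rsubmodule_def submodule_def vectorspace_def subset_iff d_carr d_add d_smult d_ract carr)
  qed
  have dU: "bij_betw d U (d ` U)"
    using d_inj sub(1) by (auto simp: bij_betw_def intro: inj_on_subset)
  have g_bij: "bij_betw g (carrier B') (carrier B)"
    by (auto simp: bij_betw_def inj_on_def carr image_image)
  have fU: "f x \<in> U" "f x \<in> carrier ?P" if "x \<in> carrier B" for x
    using that bij sub(1) by (auto simp: bij_betw_def)
  have "d \<circ> (f \<circ> g) \<in> rmod_hom K B' (regular_bimod B') (?P'\<lparr>carrier := d ` U\<rparr>)"
    using f fU by (auto simp: rmod_hom_def module_hom_def regular_bimod_def carr add smult mult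
      d_add d_smult d_ract)
  moreover have "bij_betw (d \<circ> (f \<circ> g)) (carrier B') (d ` U)"
    using bij_betw_trans[OF bij_betw_trans[OF g_bij bij] dU] by (simp add: comp_assoc)
  moreover have "d ` U \<inter> d ` V = {\<zero>\<^bsub>?P'\<^esub>}"
    using inj_on_image_Int[OF d_inj sub] UV d_zero by auto
  moreover have "\<exists>u\<in>d ` U. \<exists>v\<in>d ` V. x = u \<oplus>\<^bsub>?P'\<^esub> v" if "x \<in> carrier ?P'" for x
  proof -
    have "x \<in> d ` carrier ?P" using that by (simp only: d_carr)
    then obtain y where y: "y \<in> carrier ?P" "x = d y" by blast
    obtain u v where uv: "u \<in> U" "v \<in> V" "y = u \<oplus>\<^bsub>?P\<^esub> v" using sum[OF y(1)] by auto
    have "u \<in> carrier ?P" "v \<in> carrier ?P" using uv sub by auto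
    then have "x = d u \<oplus>\<^bsub>?P'\<^esub> d v" using y(2) uv(3) by (simp only: d_add)
    then show ?thesis using uv(1,2) by blast
  qed
  moreover have "carrier (regular_bimod B') = carrier B'" by (simp add: regular_bimod_def)
  ultimately have "rmod_isomorphic K B' (regular_bimod B') (?P'\<lparr>carrier := d ` U\<rparr>)"
      "d ` U \<inter> d ` V = {\<zero>\<^bsub>?P'\<^esub>}"
      "\<forall>x\<in>carrier ?P'. \<exists>u\<in>d ` U. \<exists>v\<in>d ` V. x = u \<oplus>\<^bsub>?P'\<^esub> v"
    unfolding rmod_isomorphic_def by auto
  then show ?thesis
    using d_sub[OF U] d_sub[OF V] unfolding generator_module_def direct_summand_def by blast
qed

end

lemma gendo_symmetricI:
  fixes B :: "('k, 'b, 'y) module_scheme" and M :: "('k, 'b, 'm, 'z) rmod_scheme"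
  assumes sym: "symmetric_algebra K B" and M: "right_module K B M" and fd: "vectorspace.fin_dim K M"
    and gen: "generator_module K B M" and iso: "alg_isomorphic K A (end_algebra K B M)"
  shows "gendo_symmetric K A"
proof -
  interpret M: right_module K B M by fact
  obtain h :: "'b \<Rightarrow> nat \<Rightarrow> 'k" where h: "inj_on h (carrier B)"
    using fin_dim_inj[OF M.A.vectorspace_axioms M.A.finite_dimensional] .
  obtain p :: "'m \<Rightarrow> nat \<Rightarrow> 'k" where p: "inj_on p (carrier M)"
    using fin_dim_inj[OF M.vectorspace_axioms fd] .
  interpret rmod_image K B "alg_copy h B" h M "rmod_copy h B p M" p
    using h p M M.A.fd_algebra_axioms
    by unfold_locales
      (auto simp: alg_copy_simps alg_copy_ops rmod_copy_simps rmod_copy_ops)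
  show ?thesis
    using symmetric_image[OF sym] rmod_image vectorspace_image'(2)[OF fd] generator_image[OF gen]
      end_image[OF iso]
    unfolding gendo_symmetric_def by blast
qed


section \<open>Tensor products over an algebra\<close>

text \<open>
  \<open>X \<otimes>\<^sub>A Y\<close> is the free abelian group on the pairs modulo biadditivity and \<open>A\<close>-balancedness.
  Bilinearity over \<open>K\<close> is a consequence, because \<open>K\<close> acts on a bimodule through \<open>A\<close>.
\<close>

definition tensor_relations ::
  "('k, 'a, 'c) module_scheme \<Rightarrow> ('k, 'a, 'x, 'y1) bimod_scheme \<Rightarrow> ('k, 'a, 'y, 'z) bimod_scheme
    \<Rightarrow> ('x \<times> 'y \<Rightarrow>\<^sub>0 int) set" where
  "tensor_relations A X Y =
    {frag_of (x \<oplus>\<^bsub>X\<^esub> x', y) - frag_of (x, y) - frag_of (x', y) |x x' y.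
      x \<in> carrier X \<and> x' \<in> carrier X \<and> y \<in> carrier Y} \<union>
    {frag_of (x, y \<oplus>\<^bsub>Y\<^esub> y') - frag_of (x, y) - frag_of (x, y') |x y y'.
      x \<in> carrier X \<and> y \<in> carrier Y \<and> y' \<in> carrier Y} \<union>
    {frag_of (x \<triangleleft>\<^bsub>X\<^esub> a, y) - frag_of (x, a \<triangleright>\<^bsub>Y\<^esub> y) |x a y.
      x \<in> carrier X \<and> a \<in> carrier A \<and> y \<in> carrier Y}"

abbreviation tensor_subgroup where
  "tensor_subgroup A X Y \<equiv>
    generate (free_Abelian_group (carrier X \<times> carrier Y)) (tensor_relations A X Y)"

definition tensor_group where
  "tensor_group A X Y = free_Abelian_group (carrier X \<times> carrier Y) Mod tensor_subgroup A X Y"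

definition pure_tensor where
  "pure_tensor A X Y x y =
    tensor_subgroup A X Y #>\<^bsub>free_Abelian_group (carrier X \<times> carrier Y)\<^esub> frag_of (x, y)"

text \<open>
  \<open>tensor_lift G f\<close> is the additive map into the abelian group \<open>G\<close> induced by a biadditive balanced
  map \<open>f\<close>, that is, \<open>x \<otimes> y \<mapsto> f x y\<close> (lemma \<open>tensor_lift_pure\<close>).  A class is evaluated at an
  arbitrary representative.
\<close>

definition frag_eval ::
  "('g, 'c) monoid_scheme \<Rightarrow> ('x \<Rightarrow> 'y \<Rightarrow> 'g) \<Rightarrow> ('x \<times> 'y \<Rightarrow>\<^sub>0 int) \<Rightarrow> 'g" where
  "frag_eval G f c =
    finprod G (\<lambda>p. f (fst p) (snd p) [^]\<^bsub>G\<^esub> Poly_Mapping.lookup c p) (Poly_Mapping.keys c)"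

definition tensor_lift ::
  "('g, 'c) monoid_scheme \<Rightarrow> ('x \<Rightarrow> 'y \<Rightarrow> 'g) \<Rightarrow> ('x \<times> 'y \<Rightarrow>\<^sub>0 int) set \<Rightarrow> 'g" where
  "tensor_lift G f t = frag_eval G f (SOME c. c \<in> t)"

context
  fixes K A X Y f and G (structure)
  assumes X: "bimodule K A X" and Y: "bimodule K A Y" and G: "comm_group G"
    and closed: "\<And>x y. \<lbrakk>x \<in> carrier X; y \<in> carrier Y\<rbrakk> \<Longrightarrow> f x y \<in> carrier G"
    and add_l: "\<And>x x' y. \<lbrakk>x \<in> carrier X; x' \<in> carrier X; y \<in> carrier Y\<rbrakk>
      \<Longrightarrow> f (x \<oplus>\<^bsub>X\<^esub> x') y = f x y \<otimes> f x' y"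
    and add_r: "\<And>x y y'. \<lbrakk>x \<in> carrier X; y \<in> carrier Y; y' \<in> carrier Y\<rbrakk>
      \<Longrightarrow> f x (y \<oplus>\<^bsub>Y\<^esub> y') = f x y \<otimes> f x y'"
    and balanced: "\<And>x a y. \<lbrakk>x \<in> carrier X; a \<in> carrier A; y \<in> carrier Y\<rbrakk>
      \<Longrightarrow> f (x \<triangleleft>\<^bsub>X\<^esub> a) y = f x (a \<triangleright>\<^bsub>Y\<^esub> y)"
begin

interpretation X: bimodule K A X by (rule X)
interpretation Y: bimodule K A Y by (rule Y)
interpretation G: comm_group G by (rule G)

private abbreviation (input) "F \<equiv> free_Abelian_group (carrier X \<times> carrier Y)"

private abbreviation (input) "ev \<equiv> frag_eval G f"

private lemma in_G: "p \<in> carrier X \<times> carrier Y \<Longrightarrow> f (fst p) (snd p) \<in> carrier G"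
  using closed by auto

private lemma ev_superset:
  assumes "finite S" "Poly_Mapping.keys c \<subseteq> S" "S \<subseteq> carrier X \<times> carrier Y"
  shows "ev c = finprod G (\<lambda>p. f (fst p) (snd p) [^] Poly_Mapping.lookup c p) S"
  unfolding frag_eval_def using assms by (intro G.finprod_mono_neutral_cong_left)
    (auto simp: in_keys_iff subset_iff closed)

private lemma ev_hom: "ev \<in> hom F G"
proof (rule homI)
  fix c assume "c \<in> carrier F"
  then show "ev c \<in> carrier G"
    unfolding frag_eval_def by (intro G.finprod_closed) (auto intro!: closed G.int_pow_closed)
next
  fix c d assume cd: "c \<in> carrier F" "d \<in> carrier F"
  let ?S = "Poly_Mapping.keys c \<union> Poly_Mapping.keys d"
  have S: "finite ?S" "?S \<subseteq> carrier X \<times> carrier Y" using cd by auto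
  have in_G: "f (fst p) (snd p) \<in> carrier G" if "p \<in> ?S" for p
    using S(2) that by (intro in_G) blast
  have "ev (c + d) = finprod G (\<lambda>p. f (fst p) (snd p) [^] Poly_Mapping.lookup (c + d) p) ?S"
    using S keys_add[of c d] by (intro ev_superset) auto
  also have "\<dots> = finprod G (\<lambda>p. f (fst p) (snd p) [^] Poly_Mapping.lookup c p \<otimes>
      f (fst p) (snd p) [^] Poly_Mapping.lookup d p) ?S"
    by (rule G.finprod_cong') (auto simp: lookup_add G.int_pow_mult in_G)
  also have "\<dots> = finprod G (\<lambda>p. f (fst p) (snd p) [^] Poly_Mapping.lookup c p) ?S \<otimes>
      finprod G (\<lambda>p. f (fst p) (snd p) [^] Poly_Mapping.lookup d p) ?S"
    by (rule G.finprod_multf) (auto simp: in_G)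
  also have "\<dots> = ev c \<otimes> ev d"
    using S ev_superset[OF S(1) _ S(2), of c] ev_superset[OF S(1) _ S(2), of d] by simp
  finally show "ev (c \<otimes>\<^bsub>F\<^esub> d) = ev c \<otimes> ev d" by simp
qed

interpretation ev: group_hom F G ev
  using ev_hom by (simp add: group_hom_def group_hom_axioms_def G.is_group)

private lemma ev_frag_of: "\<lbrakk>x \<in> carrier X; y \<in> carrier Y\<rbrakk> \<Longrightarrow> ev (frag_of (x, y)) = f x y"
  by (simp add: closed frag_eval_def)

private lemma ev_diff:
  assumes "c \<in> carrier F" "d \<in> carrier F"
  shows "c - d \<in> carrier F" "ev (c - d) = ev c \<otimes> inv ev d"
proof -
  have cd: "c - d = c \<otimes>\<^bsub>F\<^esub> inv\<^bsub>F\<^esub> d" using assms by simp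
  show "c - d \<in> carrier F"
    using assms unfolding cd by (intro ev.G.m_closed ev.G.inv_closed)
  show "ev (c - d) = ev c \<otimes> inv ev d"
    using assms unfolding cd by (simp only: ev.hom_mult ev.hom_inv ev.G.inv_closed)
qed

private lemma cancel: "\<lbrakk>a \<in> carrier G; b \<in> carrier G\<rbrakk> \<Longrightarrow> a \<otimes> b \<otimes> inv a \<otimes> inv b = \<one>"
  using G.m_comm[of a b] by (simp add: G.m_assoc)

private lemma relations_ev: "r \<in> tensor_relations A X Y \<Longrightarrow>  r \<in> carrier F \<and> ev r = \<one>"
proof -
  have gen: "frag_of (x, y) \<in> carrier F" if "x \<in> carrier X" "y \<in> carrier Y" for x y
    using that by simp
  assume "r \<in> tensor_relations A X Y"
  then show ?thesis
    unfolding tensor_relations_def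
  proof (elim UnE CollectE exE conjE)
    fix x x' y
    assume 1: "x \<in> carrier X" "x' \<in> carrier X" "y \<in> carrier Y"
      "r = frag_of (x \<oplus>\<^bsub>X\<^esub> x', y) - frag_of (x, y) - frag_of (x', y)"
    have "x \<oplus>\<^bsub>X\<^esub> x' \<in> carrier X" using 1 by (intro X.M.add.m_closed)
    then have "frag_of (x \<oplus>\<^bsub>X\<^esub> x', y) \<in> carrier F" "ev (frag_of (x \<oplus>\<^bsub>X\<^esub> x', y)) = f x y \<otimes> f x' y"
      using 1 by (simp_all add: ev_frag_of add_l)
    then show ?thesis
      unfolding 1(4) using 1(1-3) cancel[of "f x y" "f x' y"] closed gen[of x y] gen[of x' y]
      by (simp only: ev_diff ev_frag_of)
  next
    fix x y y'
    assume 2: "x \<in> carrier X" "y \<in> carrier Y" "y' \<in> carrier Y"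
      "r = frag_of (x, y \<oplus>\<^bsub>Y\<^esub> y') - frag_of (x, y) - frag_of (x, y')"
    have "y \<oplus>\<^bsub>Y\<^esub> y' \<in> carrier Y" using 2 by (intro Y.M.add.m_closed)
    then have "frag_of (x, y \<oplus>\<^bsub>Y\<^esub> y') \<in> carrier F" "ev (frag_of (x, y \<oplus>\<^bsub>Y\<^esub> y')) = f x y \<otimes> f x y'"
      using 2 by (simp_all add: ev_frag_of add_r)
    then show ?thesis
      unfolding 2(4) using 2(1-3) cancel[of "f x y" "f x y'"] closed gen[of x y] gen[of x y']
      by (simp only: ev_diff ev_frag_of)
  next
    fix x a y
    assume 3: "x \<in> carrier X" "a \<in> carrier A" "y \<in> carrier Y"
      "r = frag_of (x \<triangleleft>\<^bsub>X\<^esub> a, y) - frag_of (x, a \<triangleright>\<^bsub>Y\<^esub> y)"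
    then have "frag_of (x \<triangleleft>\<^bsub>X\<^esub> a, y) \<in> carrier F" "frag_of (x, a \<triangleright>\<^bsub>Y\<^esub> y) \<in> carrier F"
        "ev (frag_of (x \<triangleleft>\<^bsub>X\<^esub> a, y)) = f x (a \<triangleright>\<^bsub>Y\<^esub> y)" "ev (frag_of (x, a \<triangleright>\<^bsub>Y\<^esub> y)) = f x (a \<triangleright>\<^bsub>Y\<^esub> y)"
        "f x (a \<triangleright>\<^bsub>Y\<^esub> y) \<in> carrier G"
      using X.ract_closed Y.lact_closed by (simp_all add: ev_frag_of balanced closed)
    then show ?thesis
      unfolding 3(4) by (simp only: ev_diff G.r_inv)
  qed
qed

private lemma subgroup_ev: "r \<in> tensor_subgroup A X Y \<Longrightarrow> r \<in> carrier F \<and> ev r = \<one>"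
proof (induction rule: generate.induct)
  case one
  show ?case using ev.hom_one ev.G.one_closed by blast
next
  case (incl r)
  then show ?case by (rule relations_ev)
next
  case (inv r)
  then have "r \<in> carrier F" "ev r = \<one>" using relations_ev by blast+
  then show ?case using ev.hom_inv[of r] ev.G.inv_closed[of r] by simp
next
  case (eng r s)
  then show ?case using ev.hom_mult[of r s] ev.G.m_closed[of r s] by simp
qed

lemma tensor_lift_coset:
  assumes c: "c \<in> carrier F"
  shows "tensor_lift G f (tensor_subgroup A X Y #>\<^bsub>F\<^esub> c) = ev c"
proof -
  have const: "ev d = ev c" if d: "d \<in> tensor_subgroup A X Y #>\<^bsub>F\<^esub> c" for d
  proof -
    obtain r where r: "r \<in> tensor_subgroup A X Y" "d = r \<otimes>\<^bsub>F\<^esub> c"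
      using d unfolding r_coset_def by blast
    show ?thesis
      unfolding r(2) using subgroup_ev[OF r(1)] c ev.hom_mult[of r c] ev.hom_closed[OF c] by simp
  qed
  have "c \<in> tensor_subgroup A X Y #>\<^bsub>F\<^esub> c"
    using generate.one[of F "tensor_relations A X Y"] ev.G.l_one[OF c] unfolding r_coset_def by force
  then show ?thesis
    unfolding tensor_lift_def by (intro const someI)
qed

lemma tensor_lift_pure:
  "\<lbrakk>x \<in> carrier X; y \<in> carrier Y\<rbrakk> \<Longrightarrow> tensor_lift G f (pure_tensor A X Y x y) = f x y"
  unfolding pure_tensor_def using tensor_lift_coset[of "frag_of (x, y)"] by (simp add: ev_frag_of)

end

definition tensor ::
  "('k, 'a, 'c) module_scheme \<Rightarrow> ('k, 'a, 'x, 'y1) bimod_scheme \<Rightarrow> ('k, 'a, 'y, 'z) bimod_scheme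
    \<Rightarrow> ('k, 'a, ('x \<times> 'y \<Rightarrow>\<^sub>0 int) set) bimod" where
  "tensor A X Y =
    \<lparr>carrier = carrier (tensor_group A X Y), monoid.mult = undefined, one = undefined,
     zero = \<one>\<^bsub>tensor_group A X Y\<^esub>,
     add = monoid.mult (tensor_group A X Y),
     smult = (\<lambda>k. tensor_lift (tensor_group A X Y) (\<lambda>x y. pure_tensor A X Y (k \<odot>\<^bsub>X\<^esub> x) y)),
     ract = (\<lambda>t a. tensor_lift (tensor_group A X Y) (\<lambda>x y. pure_tensor A X Y x (y \<triangleleft>\<^bsub>Y\<^esub> a)) t),
     lact = (\<lambda>a. tensor_lift (tensor_group A X Y) (\<lambda>x y. pure_tensor A X Y (a \<triangleright>\<^bsub>X\<^esub> x) y))\<rparr>"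

text \<open>\<open>tensor_map A X' Y' f g\<close> is the map \<open>f \<otimes> g\<close> with target \<open>X' \<otimes>\<^sub>A Y'\<close>.\<close>

definition tensor_map where
  "tensor_map A X' Y' f g =
    tensor_lift (tensor_group A X' Y') (\<lambda>x y. pure_tensor A X' Y' (f x) (g y))"

text \<open>The canonical map \<open>(X \<otimes> Y) \<otimes> Z \<rightarrow> X \<otimes> (Y \<otimes> Z)\<close>.\<close>

definition tensor_assoc where
  "tensor_assoc A X Y Z =
    tensor_lift (tensor_group A X (tensor A Y Z))
      (\<lambda>s z. tensor_lift (tensor_group A X (tensor A Y Z))
        (\<lambda>x y. pure_tensor A X (tensor A Y Z) x (pure_tensor A Y Z y z)) s)"


section \<open>Bocses\<close>

text \<open>
  The right-hand sides of the two counit laws are the canonical isomorphisms \<open>w \<mapsto> w \<otimes> 1\<close> and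
  \<open>w \<mapsto> 1 \<otimes> w\<close>.
\<close>

locale bocs = bimodule K A W
  for K :: "('k, 'c) ring_scheme" and A :: "('k, 'a, 'y) module_scheme"
    and W :: "('k, 'a, 'w, 'z) bimod_scheme" +
  fixes \<mu> :: "'w \<Rightarrow> ('w \<times> 'w \<Rightarrow>\<^sub>0 int) set" and \<epsilon> :: "'w \<Rightarrow> 'a"
  assumes comult_hom: "\<mu> \<in> bimod_hom K A W (tensor A W W)"
    and counit_hom: "\<epsilon> \<in> bimod_hom K A W (regular_bimod A)"
    and counit_right: "w \<in> carrier W \<Longrightarrow>
      tensor_map A W (regular_bimod A) (\<lambda>x. x) \<epsilon> (\<mu> w) = pure_tensor A W (regular_bimod A) w \<one>\<^bsub>A\<^esub>"
    and counit_left: "w \<in> carrier W \<Longrightarrow>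
      tensor_map A (regular_bimod A) W \<epsilon> (\<lambda>x. x) (\<mu> w) = pure_tensor A (regular_bimod A) W \<one>\<^bsub>A\<^esub> w"
    and coassoc: "w \<in> carrier W \<Longrightarrow>
      tensor_assoc A W W W (tensor_map A (tensor A W W) W \<mu> (\<lambda>x. x) (\<mu> w)) =
      tensor_map A W (tensor A W W) (\<lambda>x. x) \<mu> (\<mu> w)"

end

theory Submission
  imports Defs "HOL-Algebra.Ideal"
begin

text \<open>
  If \<open>(A, D(A))\<close> is a bocs, then every right linear map \<open>\<theta> : D(A) \<rightarrow> A\<close> is \<open>a \<epsilon>\<close> for some
  \<open>a \<in> A\<close>, because \<open>\<theta>(w) = \<epsilon>(\<Sum> \<theta>(w\<^sub>1) w\<^sub>2)\<close> and right linear endomorphisms of \<open>D(A)\<close> are left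
  multiplications.  The image of \<open>\<epsilon>\<close> is an idempotent ideal, hence \<open>A e A\<close> for an idempotent \<open>e\<close>,
  and nothing but \<open>0\<close> annihilates it from the left.  So \<open>A = End (A e)\<close> over \<open>e A e\<close>, and \<open>\<epsilon>\<close> restricts to
  an isomorphism \<open>D(e A e) = e D(A) e \<rightarrow> e A e\<close>.

  Conversely let \<open>A = End\<^sub>B(M)\<close> with \<open>B\<close> symmetric and \<open>M\<close> a generator.  The functionals
  \<open>a \<mapsto> \<psi>(a m)\<close> span \<open>D(A)\<close>, and each \<open>\<psi> \<in> D(M)\<close> corresponds to a \<open>B\<close>-linear map \<open>M \<rightarrow> B\<close>, so that
  \<open>(a \<mapsto> \<psi>(a m)) \<mapsto> m \<psi>(-)\<close> defines a symmetric bimodule map \<open>\<epsilon> : D(A) \<rightarrow> A\<close>.  The generator property makes the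
  multiplication \<open>u \<otimes> v \<mapsto> \<epsilon>(u) v\<close> on \<open>D(A)\<close> bijective, and its inverse is the comultiplication.
\<close>

section \<open>Linear algebra in finite dimension\<close>

text \<open>Both directions turn on one statement: \<open>a\<close> \<mapsto>
  \<open>a \<epsilon>\<close> is a bijection from A to the right linear maps D(A) \<rightarrow> A.
  By reflexivity a functional F on D(A) \<otimes> D(A) amounts to a right linear \<theta> with F(u
  \<otimes> v) = v(\<theta>(u)), and a functional on D(A) is an element of A. Under these
  identifications the map above is the transpose of the multiplication u \<otimes> v \<mapsto>
  \<epsilon>(u) v. Its injectivity therefore gives surjectivity of the multiplication, and its
  surjectivity gives injectivity. This avoids computing in the tensor product, whose elements have
  no normal form. The idempotent is found without the radical: \<open>e\<close> is chosen with e A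
  maximal, Fitting's lemma makes (1 - e) x (1 - e) nilpotent for every x in the ideal, and Brauer's
  argument shows that an idempotent ideal which is nil modulo an ideal J lies in J. Equations such
  as I = I I or I = A e A are phrased through all subspaces, or all ideals, containing the
  generators, so that no spans have to be manipulated.\<close>

context vectorspace
begin

section \<open>Ranks of subspaces; minimal and maximal subspaces\<close>

lemma finsum_submodule:
  assumes "submodule K N V" "finite S" "g \<in> S \<rightarrow> N"
  shows "finsum V g S \<in> N"
proof -
  interpret N: submodule K N V by fact
  show ?thesis
    using assms(2,3) by (induction S rule: finite_induct) (use N.subset in \<open>auto simp: Pi_iff subset_iff\<close>)
qed

text \<open>The dimension of a subspace, defined on bare subsets so that it can serve as a measure
  without forming a restricted vector space. Finite dimension of \<open>V\<close> bounds the
  cardinalities and makes \<open>Max\<close> meaningful.\<close>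

definition subspace_rank :: "'c set \<Rightarrow> nat" where
  "subspace_rank U = Max {card S |S. S \<subseteq> U \<and> lin_indpt S}"

lemma subspace_rank_props:
  assumes fd: "fin_dim" and U: "U \<subseteq> carrier V"
  shows "\<exists>S. S \<subseteq> U \<and> lin_indpt S \<and> card S = subspace_rank U"
    and "\<lbrakk>S \<subseteq> U; lin_indpt S\<rbrakk> \<Longrightarrow> card S \<le> subspace_rank U"
    and "subspace_rank U \<le> dim"
proof -
  let ?X = "{card S |S. S \<subseteq> U \<and> lin_indpt S}"
  have bound: "?X \<subseteq> {..dim}"
    using li_le_dim[OF fd] U by blast
  then have fin: "finite ?X"
    using finite_subset by blast
  have "lin_indpt {}" by (auto simp: lin_dep_def)
  then have ne: "?X \<noteq> {}" by blast
  have "subspace_rank U \<in> ?X"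
    unfolding subspace_rank_def using Max_in[OF fin ne] .
  then show "\<exists>S. S \<subseteq> U \<and> lin_indpt S \<and> card S = subspace_rank U" "subspace_rank U \<le> dim"
    using bound by auto
  show "\<lbrakk>S \<subseteq> U; lin_indpt S\<rbrakk> \<Longrightarrow> card S \<le> subspace_rank U"
    unfolding subspace_rank_def using fin by (intro Max_ge) auto
qed

text \<open>A largest independent subset of \<open>U\<close> stays independent when a vector of
  \<open>W\<close> outside \<open>U\<close> is added.\<close>

lemma subspace_rank_less:
  assumes fd: "fin_dim" and U: "submodule K U V" and W: "submodule K W V" and less: "U \<subset> W"
  shows "subspace_rank U < subspace_rank W"
proof -
  have sub: "U \<subseteq> carrier V" "W \<subseteq> carrier V"
    using U W by (auto simp: submodule_def)
  obtain S where S: "S \<subseteq> U" "lin_indpt S" "card S = subspace_rank U"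
    using subspace_rank_props(1)[OF fd sub(1)] by blast
  obtain w where w: "w \<in> W" "w \<notin> U" using less by blast
  have "w \<notin> span S" "w \<notin> S"
    using span_is_subset[OF S(1) U] S(1) w by auto
  then have "lin_indpt (S \<union> {w})"
    using lin_dep_iff_in_span[of S w] S sub w by blast
  then have "card (S \<union> {w}) \<le> subspace_rank W"
    using S(1) less w by (intro subspace_rank_props(2)[OF fd sub(2)]) auto
  moreover have "finite S"
    using li_le_dim(1)[OF fd _ S(2)] S(1) sub by blast
  ultimately show ?thesis
    using \<open>w \<notin> S\<close> S(3) by simp
qed

text \<open>The descending chain condition as a choice: a subspace of least rank among those with
  \<open>P\<close> is minimal. An arbitrary \<open>P\<close> allows families indexed by powers of an
  element or by idempotents.\<close>

lemma minimal_submodule: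
  assumes "fin_dim" "submodule K U V" "P U"
  obtains H where "submodule K H V" "P H" "\<And>W. \<lbrakk>submodule K W V; P W; W \<subseteq> H\<rbrakk> \<Longrightarrow> W = H"
proof -
  obtain H where H: "submodule K H V \<and> P H"
    and least: "\<And>W. submodule K W V \<and> P W \<Longrightarrow> subspace_rank H \<le> subspace_rank W"
    using ex_has_least_nat[of "\<lambda>U. submodule K U V \<and> P U" U subspace_rank] assms by blast
  show ?thesis
  proof (rule that[of H])
    fix W assume W: "submodule K W V" "P W" "W \<subseteq> H"
    show "W = H"
      using subspace_rank_less[OF assms(1) W(1), of H] H least[of W] W by force
  qed (use H in auto)
qed

lemma maximal_submodule:
  assumes "fin_dim" "submodule K U V" "P U"
  obtains H where "submodule K H V" "P H" "\<And>W. \<lbrakk>submodule K W V; P W; H \<subseteq> W\<rbrakk> \<Longrightarrow> W = H"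
proof -
  have "subspace_rank W < Suc dim" if "submodule K W V \<and> P W" for W
    using that subspace_rank_props(3)[OF assms(1), of W] by (auto simp: submodule_def)
  then obtain H where H: "submodule K H V \<and> P H"
    and greatest: "\<And>W. submodule K W V \<and> P W \<Longrightarrow> subspace_rank W \<le> subspace_rank H"
    using ex_has_greatest_nat[of "\<lambda>U. submodule K U V \<and> P U" U subspace_rank "Suc dim"] assms by blast
  show ?thesis
  proof (rule that[of H])
    fix W assume W: "submodule K W V" "P W" "H \<subseteq> W"
    show "W = H"
      using subspace_rank_less[OF assms(1) _ W(1), of H] H greatest[of W] W by force
  qed (use H in auto)
qed

text \<open>An independent subset of \<open>U\<close> of largest size spans \<open>U\<close>, since
  any vector outside its span could be added to it.\<close>

lemma fin_dim_submodule:
  assumes fd: "fin_dim" and U: "submodule K U V"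
  shows "vectorspace K (vs U)" "vectorspace.fin_dim K (vs U)"
proof -
  have sub: "U \<subseteq> carrier V" using U by (simp add: submodule_def)
  show U': "vectorspace K (vs U)"
    using submodule_is_module[OF U] by (simp add: vectorspace_def field_axioms)
  obtain S where S: "S \<subseteq> U" "lin_indpt S" "card S = subspace_rank U"
    using subspace_rank_props(1)[OF fd sub] by blast
  have fin: "finite S" using li_le_dim(1)[OF fd _ S(2)] S(1) sub by blast
  have "span S = U"
  proof (rule ccontr)
    assume "span S \<noteq> U"
    then obtain w where w: "w \<in> U" "w \<notin> span S"
      using span_is_subset[OF S(1) U] by blast
    have "w \<notin> S" using w in_own_span[of S] S(1) sub by blast
    then have "lin_indpt (S \<union> {w})"
      using lin_dep_iff_in_span[of S w] S sub w by blast
    then have "card (S \<union> {w}) \<le> subspace_rank U"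
      using S(1) w by (intro subspace_rank_props(2)[OF fd sub]) auto
    then show False using fin \<open>w \<notin> S\<close> S(3) by simp
  qed
  then show "vectorspace.fin_dim K (vs U)"
    unfolding vectorspace.fin_dim_def[OF U'] using fin S(1) span_li_not_depend(1)[OF S(1) U]
    by auto
qed


section \<open>Dual spaces: separation, dual bases, reflexivity\<close>

abbreviation \<D> where "\<D> \<equiv> dual_bimod K V"

abbreviation "dual \<equiv> carrier \<D>"

lemma dualI:
  assumes "f \<in> extensional (carrier V)" "\<And>x. x \<in> carrier V \<Longrightarrow> f x \<in> carrier K"
      "\<And>x y. \<lbrakk>x \<in> carrier V; y \<in> carrier V\<rbrakk> \<Longrightarrow> f (x \<oplus>\<^bsub>V\<^esub> y) = f x \<oplus>\<^bsub>K\<^esub> f y"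
      "\<And>k x. \<lbrakk>k \<in> carrier K; x \<in> carrier V\<rbrakk> \<Longrightarrow> f (k \<odot>\<^bsub>V\<^esub> x) = k \<otimes>\<^bsub>K\<^esub> f x"
  shows "f \<in> dual"
  using assms by (simp add: dual_bimod_def PiE_iff)

lemma dualD:
  assumes "f \<in> dual"
  shows dual_closed: "x \<in> carrier V \<Longrightarrow> f x \<in> carrier K"
    and dual_add: "\<lbrakk>x \<in> carrier V; y \<in> carrier V\<rbrakk> \<Longrightarrow> f (x \<oplus>\<^bsub>V\<^esub> y) = f x \<oplus>\<^bsub>K\<^esub> f y"
    and dual_smult: "\<lbrakk>k \<in> carrier K; x \<in> carrier V\<rbrakk> \<Longrightarrow> f (k \<odot>\<^bsub>V\<^esub> x) = k \<otimes>\<^bsub>K\<^esub> f x"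
    and dual_arb: "x \<notin> carrier V \<Longrightarrow> f x = undefined"
    and dual_extensional: "f \<in> extensional (carrier V)"
  using assms by (auto simp: dual_bimod_def PiE_iff extensional_def)

lemma dual_eqI:
  assumes "f \<in> dual" "g \<in> dual" "\<And>x. x \<in> carrier V \<Longrightarrow> f x = g x"
  shows "f = g"
  using assms by (intro extensionalityI[where A = "carrier V"]) (auto simp: dual_extensional)

lemma dual_ops:
  shows "\<zero>\<^bsub>\<D>\<^esub> = (\<lambda>x\<in>carrier V. \<zero>\<^bsub>K\<^esub>)"
    and "f \<oplus>\<^bsub>\<D>\<^esub> g = (\<lambda>x\<in>carrier V. f x \<oplus>\<^bsub>K\<^esub> g x)"
    and "k \<odot>\<^bsub>\<D>\<^esub> f = (\<lambda>x\<in>carrier V. k \<otimes>\<^bsub>K\<^esub> f x)"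
  by (simp_all add: dual_bimod_def)

lemma dual_zero: "f \<in> dual \<Longrightarrow> f \<zero>\<^bsub>V\<^esub> = \<zero>\<^bsub>K\<^esub>"
  using dual_smult[of f "\<zero>\<^bsub>K\<^esub>" "\<zero>\<^bsub>V\<^esub>"] dual_closed[of f "\<zero>\<^bsub>V\<^esub>"] by simp

lemma dual_restrictI:
  assumes "\<And>x. x \<in> carrier V \<Longrightarrow> f x \<in> carrier K"
      "\<And>x y. \<lbrakk>x \<in> carrier V; y \<in> carrier V\<rbrakk> \<Longrightarrow> f (x \<oplus>\<^bsub>V\<^esub> y) = f x \<oplus>\<^bsub>K\<^esub> f y"
      "\<And>k x. \<lbrakk>k \<in> carrier K; x \<in> carrier V\<rbrakk> \<Longrightarrow> f (k \<odot>\<^bsub>V\<^esub> x) = k \<otimes>\<^bsub>K\<^esub> f x"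
  shows "restrict f (carrier V) \<in> dual"
  using assms by (intro dualI) auto

text \<open>Only the two actions of \<open>dual_bimod\<close> involve a multiplication, so its
  linear part is the dual of any vector space. The general case serves for modules and tensor
  products, which are not algebras.\<close>

lemma dual_vectorspace: "vectorspace K (\<D>)"
proof -
  let ?D = "\<D>"
  note ops = dual_ops and app = dual_closed
  have closed: "\<zero>\<^bsub>?D\<^esub> \<in> carrier ?D"
    "\<lbrakk>f \<in> carrier ?D; g \<in> carrier ?D\<rbrakk> \<Longrightarrow> f \<oplus>\<^bsub>?D\<^esub> g \<in> carrier ?D"
    "\<lbrakk>k \<in> carrier K; f \<in> carrier ?D\<rbrakk> \<Longrightarrow> k \<odot>\<^bsub>?D\<^esub> f \<in> carrier ?D" for f g k
    unfolding ops
    by (rule dual_restrictI; simp add: dual_add dual_smult app R.add.m_ac R.r_distr R.m_ac)+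
  have "abelian_group ?D"
  proof (rule abelian_groupI)
    fix f assume f: "f \<in> carrier ?D"
    show "\<exists>g\<in>carrier ?D. g \<oplus>\<^bsub>?D\<^esub> f = \<zero>\<^bsub>?D\<^esub>"
    proof
      show "(\<ominus>\<^bsub>K\<^esub> \<one>\<^bsub>K\<^esub>) \<odot>\<^bsub>?D\<^esub> f \<in> carrier ?D"
        using f by (intro closed) simp_all
      show "((\<ominus>\<^bsub>K\<^esub> \<one>\<^bsub>K\<^esub>) \<odot>\<^bsub>?D\<^esub> f) \<oplus>\<^bsub>?D\<^esub> f = \<zero>\<^bsub>?D\<^esub>"
        unfolding ops by (rule restrict_ext) (simp add: app[OF f] R.l_minus R.l_neg)
    qed
  next
    fix f assume f: "f \<in> carrier ?D"
    show "\<zero>\<^bsub>?D\<^esub> \<oplus>\<^bsub>?D\<^esub> f = f"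
      unfolding ops by (rule ext) (simp add: app[OF f] dual_arb[OF f])
  qed (auto simp: closed(1,2)[unfolded ops] ops app R.add.m_ac intro!: restrict_ext)
  then have "module K ?D"
    by (intro moduleI) (auto simp: closed(3)[unfolded ops] ops app R.l_distr R.r_distr
      R.m_assoc dual_arb fun_eq_iff R.is_cring)
  then show ?thesis
    by (simp add: vectorspace_def field_axioms)
qed

lemma dual_finsum:
  assumes "finite S" "g \<in> S \<rightarrow> carrier V" "f \<in> dual"
  shows "f (finsum V g S) = finsum K (\<lambda>s. f (g s)) S"
  using assms by (induction S rule: finite_induct) (auto simp: dual_zero dual_add dual_closed Pi_iff)

text \<open>A maximal subspace containing \<open>U\<close> but not \<open>v\<close> is a hyperplane complementing \<open>v\<close>.\<close>

lemma dual_separation: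
  assumes fd: "fin_dim" and U: "submodule K U V" and v: "v \<in> carrier V" "v \<notin> U"
  obtains f where "f \<in> dual" "\<And>u. u \<in> U \<Longrightarrow> f u = \<zero>\<^bsub>K\<^esub>" "f v \<noteq> \<zero>\<^bsub>K\<^esub>"
proof -
  obtain H where H: "submodule K H V" "U \<subseteq> H \<and> v \<notin> H"
    and max: "\<And>W. \<lbrakk>submodule K W V; U \<subseteq> W \<and> v \<notin> W; H \<subseteq> W\<rbrakk> \<Longrightarrow> W = H"
    using maximal_submodule[OF fd U, of "\<lambda>W. U \<subseteq> W \<and> v \<notin> W"] v by blast
  interpret H: submodule K H V by fact
  have Hc: "h \<in> carrier V" if "h \<in> H" for h using that H.subset by blast
  have Hm: "\<ominus>\<^bsub>V\<^esub> h \<in> H" if "h \<in> H" for h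
    using that H.smult_closed[of "\<ominus>\<^bsub>K\<^esub> \<one>\<^bsub>K\<^esub>" h] by (simp add: Hc smult_minus_1)
  have zero_coeff: "c = \<zero>\<^bsub>K\<^esub>" if c: "c \<in> carrier K" "c \<odot>\<^bsub>V\<^esub> v \<in> H" for c
  proof (rule ccontr)
    assume "c \<noteq> \<zero>\<^bsub>K\<^esub>"
    then have "v = inv\<^bsub>K\<^esub> c \<odot>\<^bsub>V\<^esub> (c \<odot>\<^bsub>V\<^esub> v)" "inv\<^bsub>K\<^esub> c \<in> carrier K"
      using mult_inverse[of c v] c v field.field_Units by auto
    then show False using H(2) c(2) H.smult_closed by metis
  qed
  \<comment> \<open>For \<open>x\<close> outside \<open>H\<close>, maximality puts \<open>v\<close>
    into H + K x, and the coefficient of \<open>x\<close> there is nonzero because \<open>v\<close>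
    is not in \<open>H\<close>. Solving for \<open>x\<close> gives the decomposition along H + K
    v.\<close>
  have ex: "\<exists>k. k \<in> carrier K \<and> (\<exists>h\<in>H. x = h \<oplus>\<^bsub>V\<^esub> k \<odot>\<^bsub>V\<^esub> v)" if x: "x \<in> carrier V" for x
  proof (cases "x \<in> H")
    case True
    then show ?thesis using x v by (intro exI[of _ "\<zero>\<^bsub>K\<^esub>"]) (auto intro!: bexI[of _ x])
  next
    case False
    let ?W = "{h \<oplus>\<^bsub>V\<^esub> c \<odot>\<^bsub>V\<^esub> x |h c. h \<in> H \<and> c \<in> carrier K}"
    have "submodule K ?W V"
    proof unfold_locales
      show "?W \<subseteq> carrier V" using x Hc by auto
      show "\<zero>\<^bsub>V\<^esub> \<in> ?W"
      proof -
        have "\<zero>\<^bsub>V\<^esub> = \<zero>\<^bsub>V\<^esub> \<oplus>\<^bsub>V\<^esub> \<zero>\<^bsub>K\<^esub> \<odot>\<^bsub>V\<^esub> x" using x by simp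
        then show ?thesis using H.zero_closed by blast
      qed
    next
      fix y z assume "y \<in> ?W" "z \<in> ?W"
      then obtain h c h' c' where hc: "y = h \<oplus>\<^bsub>V\<^esub> c \<odot>\<^bsub>V\<^esub> x" "z = h' \<oplus>\<^bsub>V\<^esub> c' \<odot>\<^bsub>V\<^esub> x"
        "h \<in> H" "h' \<in> H" "c \<in> carrier K" "c' \<in> carrier K" by blast
      then have "y \<oplus>\<^bsub>V\<^esub> z = h \<oplus>\<^bsub>V\<^esub> h' \<oplus>\<^bsub>V\<^esub> (c \<oplus>\<^bsub>K\<^esub> c') \<odot>\<^bsub>V\<^esub> x"
        using x Hc by (simp add: smult_l_distr M.add.m_ac)
      then show "y \<oplus>\<^bsub>V\<^esub> z \<in> ?W" using hc by blast
    next
      fix k y assume k: "k \<in> carrier K" "y \<in> ?W"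
      then obtain h c where hc: "y = h \<oplus>\<^bsub>V\<^esub> c \<odot>\<^bsub>V\<^esub> x" "h \<in> H" "c \<in> carrier K" by blast
      then have "k \<odot>\<^bsub>V\<^esub> y = k \<odot>\<^bsub>V\<^esub> h \<oplus>\<^bsub>V\<^esub> (k \<otimes>\<^bsub>K\<^esub> c) \<odot>\<^bsub>V\<^esub> x"
        using k x Hc by (simp add: smult_r_distr smult_assoc1)
      then show "k \<odot>\<^bsub>V\<^esub> y \<in> ?W" using k hc by blast
    qed
    moreover have "H \<subseteq> ?W"
    proof
      fix h assume h: "h \<in> H"
      then have "h = h \<oplus>\<^bsub>V\<^esub> \<zero>\<^bsub>K\<^esub> \<odot>\<^bsub>V\<^esub> x" using x Hc by simp
      then show "h \<in> ?W" using h by blast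
    qed
    moreover have "x \<in> ?W"
    proof -
      have "x = \<zero>\<^bsub>V\<^esub> \<oplus>\<^bsub>V\<^esub> \<one>\<^bsub>K\<^esub> \<odot>\<^bsub>V\<^esub> x" using x by simp
      then show ?thesis using H.zero_closed by blast
    qed
    ultimately have "v \<in> ?W"
      using max[of ?W] H(2) False by blast
    then obtain h c where hc: "h \<in> H" "c \<in> carrier K" "v = h \<oplus>\<^bsub>V\<^esub> c \<odot>\<^bsub>V\<^esub> x" by blast
    have c0: "c \<noteq> \<zero>\<^bsub>K\<^esub>" using hc H(2) x Hc by auto
    have d: "inv\<^bsub>K\<^esub> c \<in> carrier K" using c0 hc(2) field.field_Units by auto
    have "c \<odot>\<^bsub>V\<^esub> x = \<ominus>\<^bsub>V\<^esub> h \<oplus>\<^bsub>V\<^esub> v"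
      using hc x Hc by (simp add: M.r_neg1)
    then have "x = inv\<^bsub>K\<^esub> c \<odot>\<^bsub>V\<^esub> (\<ominus>\<^bsub>V\<^esub> h \<oplus>\<^bsub>V\<^esub> v)"
      using mult_inverse[of c x] hc(2) x c0 by metis
    also have "\<dots> = inv\<^bsub>K\<^esub> c \<odot>\<^bsub>V\<^esub> (\<ominus>\<^bsub>V\<^esub> h) \<oplus>\<^bsub>V\<^esub> inv\<^bsub>K\<^esub> c \<odot>\<^bsub>V\<^esub> v"
      using hc(1) Hc v d by (simp add: smult_r_distr)
    finally show ?thesis using d Hm[OF hc(1)] H.smult_closed by blast
  qed
  \<comment> \<open>Two decompositions differ by a multiple of \<open>v\<close> lying in
    \<open>H\<close>, and \<open>zero_coeff\<close> makes it zero. So the coefficient of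
    \<open>v\<close> is a well-defined functional with kernel \<open>H\<close>.\<close>
  have uniq: "k = k'" if "k \<in> carrier K" "k' \<in> carrier K" "h \<in> H" "h' \<in> H"
      "h \<oplus>\<^bsub>V\<^esub> k \<odot>\<^bsub>V\<^esub> v = h' \<oplus>\<^bsub>V\<^esub> k' \<odot>\<^bsub>V\<^esub> v" for k k' h h'
  proof -
    have "(k \<ominus>\<^bsub>K\<^esub> k') \<odot>\<^bsub>V\<^esub> v = \<ominus>\<^bsub>V\<^esub> h \<oplus>\<^bsub>V\<^esub> (h \<oplus>\<^bsub>V\<^esub> k \<odot>\<^bsub>V\<^esub> v) \<oplus>\<^bsub>V\<^esub> \<ominus>\<^bsub>V\<^esub> (k' \<odot>\<^bsub>V\<^esub> v)"
      using that(1-4) v Hc by (simp add: a_minus_def smult_l_distr smult_l_minus M.r_neg1)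
    also have "\<dots> = \<ominus>\<^bsub>V\<^esub> h \<oplus>\<^bsub>V\<^esub> (h' \<oplus>\<^bsub>V\<^esub> k' \<odot>\<^bsub>V\<^esub> v) \<oplus>\<^bsub>V\<^esub> \<ominus>\<^bsub>V\<^esub> (k' \<odot>\<^bsub>V\<^esub> v)"
      by (simp only: that)
    also have "\<dots> = \<ominus>\<^bsub>V\<^esub> h \<oplus>\<^bsub>V\<^esub> h'"
      using that v Hc by (simp add: M.add.m_assoc M.r_neg)
    finally have "(k \<ominus>\<^bsub>K\<^esub> k') \<odot>\<^bsub>V\<^esub> v \<in> H" using that Hm by simp
    then show ?thesis using zero_coeff[of "k \<ominus>\<^bsub>K\<^esub> k'"] that by simp
  qed
  define k where "k x = (SOME k. k \<in> carrier K \<and> (\<exists>h\<in>H. x = h \<oplus>\<^bsub>V\<^esub> k \<odot>\<^bsub>V\<^esub> v))" for x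
  have k: "k x \<in> carrier K" "\<exists>h\<in>H. x = h \<oplus>\<^bsub>V\<^esub> k x \<odot>\<^bsub>V\<^esub> v" if "x \<in> carrier V" for x
    using someI_ex[OF ex[OF that]] unfolding k_def by blast+
  have k_eq: "k (h \<oplus>\<^bsub>V\<^esub> c \<odot>\<^bsub>V\<^esub> v) = c" if "h \<in> H" "c \<in> carrier K" for h c
  proof -
    have "h \<oplus>\<^bsub>V\<^esub> c \<odot>\<^bsub>V\<^esub> v \<in> carrier V" using that v Hc by simp
    then show ?thesis using uniq[of "k (h \<oplus>\<^bsub>V\<^esub> c \<odot>\<^bsub>V\<^esub> v)" c _ h] that k by metis
  qed
  show ?thesis
  proof (rule that[of "restrict k (carrier V)"])
    show "restrict k (carrier V) \<in> dual"
    proof (rule dual_restrictI)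
      fix x y assume xy: "x \<in> carrier V" "y \<in> carrier V"
      obtain h h' where h: "h \<in> H" "x = h \<oplus>\<^bsub>V\<^esub> k x \<odot>\<^bsub>V\<^esub> v" "h' \<in> H" "y = h' \<oplus>\<^bsub>V\<^esub> k y \<odot>\<^bsub>V\<^esub> v"
        using k xy by meson
      have "x \<oplus>\<^bsub>V\<^esub> y = (h \<oplus>\<^bsub>V\<^esub> k x \<odot>\<^bsub>V\<^esub> v) \<oplus>\<^bsub>V\<^esub> (h' \<oplus>\<^bsub>V\<^esub> k y \<odot>\<^bsub>V\<^esub> v)"
        using h by simp
      also have "\<dots> = (h \<oplus>\<^bsub>V\<^esub> h') \<oplus>\<^bsub>V\<^esub> (k x \<oplus>\<^bsub>K\<^esub> k y) \<odot>\<^bsub>V\<^esub> v"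
        using h(1,3) Hc k xy v by (simp add: smult_l_distr M.add.m_ac)
      finally show "k (x \<oplus>\<^bsub>V\<^esub> y) = k x \<oplus>\<^bsub>K\<^esub> k y"
        using h k xy k_eq by simp
    next
      fix c x assume cx: "c \<in> carrier K" "x \<in> carrier V"
      obtain h where h: "h \<in> H" "x = h \<oplus>\<^bsub>V\<^esub> k x \<odot>\<^bsub>V\<^esub> v" using k cx by meson
      have "c \<odot>\<^bsub>V\<^esub> x = c \<odot>\<^bsub>V\<^esub> (h \<oplus>\<^bsub>V\<^esub> k x \<odot>\<^bsub>V\<^esub> v)"
        using h by simp
      also have "\<dots> = c \<odot>\<^bsub>V\<^esub> h \<oplus>\<^bsub>V\<^esub> (c \<otimes>\<^bsub>K\<^esub> k x) \<odot>\<^bsub>V\<^esub> v"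
        using h(1) Hc k cx v by (simp add: smult_r_distr smult_assoc1)
      finally show "k (c \<odot>\<^bsub>V\<^esub> x) = c \<otimes>\<^bsub>K\<^esub> k x"
        using h k cx k_eq by simp
    qed (use k in auto)
    show "restrict k (carrier V) u = \<zero>\<^bsub>K\<^esub>" if "u \<in> U" for u
      using k_eq[of u "\<zero>\<^bsub>K\<^esub>"] that H(2) Hc v by auto
    show "restrict k (carrier V) v \<noteq> \<zero>\<^bsub>K\<^esub>"
      using k_eq[of "\<zero>\<^bsub>V\<^esub>" "\<one>\<^bsub>K\<^esub>"] v by auto
  qed
qed

lemma dual_separates_points:
  assumes fd: "fin_dim" and v: "v \<in> carrier V" "\<And>f. f \<in> dual \<Longrightarrow> f v = \<zero>\<^bsub>K\<^esub>"
  shows "v = \<zero>\<^bsub>V\<^esub>"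
proof (rule ccontr)
  assume "v \<noteq> \<zero>\<^bsub>V\<^esub>"
  moreover have "submodule K {\<zero>\<^bsub>V\<^esub>} V" by unfold_locales auto
  ultimately show False
    using dual_separation[OF fd, of "{\<zero>\<^bsub>V\<^esub>}" v] v by blast
qed

lemma dual_eq_points:
  assumes fd: "fin_dim" and "v \<in> carrier V" "w \<in> carrier V" "\<And>f. f \<in> dual \<Longrightarrow> f v = f w"
  shows "v = w"
proof -
  have m: "\<ominus>\<^bsub>V\<^esub> w = (\<ominus>\<^bsub>K\<^esub> \<one>\<^bsub>K\<^esub>) \<odot>\<^bsub>V\<^esub> w" using assms by (simp add: smult_minus_1)
  have "v \<ominus>\<^bsub>V\<^esub> w = \<zero>\<^bsub>V\<^esub>"
  proof (rule dual_separates_points[OF fd])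
    fix f assume f: "f \<in> dual"
    then have "f (v \<ominus>\<^bsub>V\<^esub> w) = f w \<oplus>\<^bsub>K\<^esub> (\<ominus>\<^bsub>K\<^esub> \<one>\<^bsub>K\<^esub>) \<otimes>\<^bsub>K\<^esub> f w"
      using assms(2,3) assms(4)[OF f] unfolding a_minus_def m by (simp add: dual_add dual_smult)
    then show "f (v \<ominus>\<^bsub>V\<^esub> w) = \<zero>\<^bsub>K\<^esub>"
      using f assms(3) by (simp add: dual_closed R.l_minus R.r_neg)
  qed (use assms in simp)
  then show ?thesis using assms(2,3) by simp
qed

lemma dual_basis:
  assumes fd: "fin_dim"
  obtains S e where "finite S" "S \<subseteq> carrier V" "\<And>s. s \<in> S \<Longrightarrow> e s \<in> dual"
    "\<And>v. v \<in> carrier V \<Longrightarrow> v = (\<Oplus>\<^bsub>V\<^esub>s\<in>S. e s v \<odot>\<^bsub>V\<^esub> s)"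
proof -
  obtain S where S: "finite S" "basis S" using finite_basis_exists[OF fd] by blast
  have sub: "S \<subseteq> carrier V" using S(2) basis_def by blast
  have ex1: "\<exists>!a. a \<in> S \<rightarrow>\<^sub>E carrier K \<and> lincomb a S = v" if "v \<in> carrier V" for v
    using basis_criterion[OF S(1) sub] S(2) that by blast
  define c where "c v = (THE a. a \<in> S \<rightarrow>\<^sub>E carrier K \<and> lincomb a S = v)" for v
  have c: "c v \<in> S \<rightarrow>\<^sub>E carrier K" "lincomb (c v) S = v" if "v \<in> carrier V" for v
    using theI'[OF ex1[OF that]] unfolding c_def by blast+
  have c_eq: "c v s = a s" if "a \<in> S \<rightarrow> carrier K" "lincomb a S = v" "v \<in> carrier V" "s \<in> S" for a v s
  proof -
    have "lincomb (restrict a S) S = v"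
      using lincomb_cong[of S S "restrict a S" a] that sub by auto
    then have "c v = restrict a S"
      using ex1[OF that(3)] c[OF that(3)] that(1) by (metis restrict_PiE_iff Pi_iff)
    then show ?thesis using that by simp
  qed
  have cK: "c v s \<in> carrier K" if "v \<in> carrier V" "s \<in> S" for v s
    using c(1)[OF that(1)] that(2) by blast
  have cPi: "c v \<in> S \<rightarrow> carrier K" if "v \<in> carrier V" for v
    using c(1)[OF that] by blast
  show ?thesis
  proof (rule that[OF S(1) sub, of "\<lambda>s. \<lambda>v\<in>carrier V. c v s"])
    fix s assume s: "s \<in> S"
    show "(\<lambda>v\<in>carrier V. c v s) \<in> dual"
    proof (rule dual_restrictI)
      fix x y assume "x \<in> carrier V" "y \<in> carrier V"
      then show "c (x \<oplus>\<^bsub>V\<^esub> y) s = c x s \<oplus>\<^bsub>K\<^esub> c y s"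
        using s lincomb_sum[OF S(1) sub cPi cPi, of x y] by (intro c_eq) (auto simp: c cK)
    next
      fix k x assume "k \<in> carrier K" "x \<in> carrier V"
      then show "c (k \<odot>\<^bsub>V\<^esub> x) s = k \<otimes>\<^bsub>K\<^esub> c x s"
        using s lincomb_smult[OF sub cPi, of x k] by (intro c_eq) (auto simp: c cK)
    qed (use s cK in auto)
  next
    fix v assume v: "v \<in> carrier V"
    then show "v = (\<Oplus>\<^bsub>V\<^esub>s\<in>S. (\<lambda>v\<in>carrier V. c v s) v \<odot>\<^bsub>V\<^esub> s)"
      using c(2)[OF v] by (simp add: lincomb_def)
  qed
qed

lemma dual_finsum_apply:
  assumes "finite S" "g \<in> S \<rightarrow> dual" "x \<in> carrier V"
  shows "finsum (\<D>) g S x = (\<Oplus>\<^bsub>K\<^esub>s\<in>S. g s x)"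
proof -
  interpret D: vectorspace K "\<D>" by (rule dual_vectorspace)
  show ?thesis
    using assms
  proof (induction S rule: finite_induct)
    case empty
    then show ?case by (simp add: dual_ops)
  next
    case (insert s S)
    then have "finsum (\<D>) g (insert s S) = g s \<oplus>\<^bsub>\<D>\<^esub> finsum (\<D>) g S"
      by (intro D.M.finsum_insert) auto
    then show ?case
      using insert by (simp add: dual_ops dual_closed Pi_iff)
  qed
qed

text \<open>The expansion of vectors transposed: apply \<open>f\<close> to the expansion of an
  arbitrary \<open>x\<close>.\<close>

lemma dual_expand:
  assumes S: "finite S" "S \<subseteq> carrier V" "\<And>s. s \<in> S \<Longrightarrow> e s \<in> dual"
    and ex: "\<And>v. v \<in> carrier V \<Longrightarrow> v = (\<Oplus>\<^bsub>V\<^esub>s\<in>S. e s v \<odot>\<^bsub>V\<^esub> s)" and f: "f \<in> dual"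
  shows "f = (\<Oplus>\<^bsub>\<D>\<^esub>s\<in>S. f s \<odot>\<^bsub>\<D>\<^esub> e s)"
proof -
  interpret D: vectorspace K "\<D>" by (rule dual_vectorspace)
  have mem: "(\<lambda>s. f s \<odot>\<^bsub>\<D>\<^esub> e s) \<in> S \<rightarrow> dual"
    using S f dual_closed by (auto intro!: D.smult_closed)
  show ?thesis
  proof (rule dual_eqI[OF f])
    show "(\<Oplus>\<^bsub>\<D>\<^esub>s\<in>S. f s \<odot>\<^bsub>\<D>\<^esub> e s) \<in> dual"
      using mem by (rule D.M.finsum_closed)
    fix x assume x: "x \<in> carrier V"
    have "f x = f (\<Oplus>\<^bsub>V\<^esub>s\<in>S. e s x \<odot>\<^bsub>V\<^esub> s)" using ex[OF x] by simp
    also have "\<dots> = (\<Oplus>\<^bsub>K\<^esub>s\<in>S. f (e s x \<odot>\<^bsub>V\<^esub> s))"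
      using S(2,3) x f by (intro dual_finsum[OF S(1)]) (auto intro!: smult_closed simp: dual_closed)
    also have "\<dots> = (\<Oplus>\<^bsub>K\<^esub>s\<in>S. (f s \<odot>\<^bsub>\<D>\<^esub> e s) x)"
      using S(2,3) x f
      by (intro R.finsum_cong') (auto simp: dual_ops dual_closed dual_smult R.m_comm subset_iff)
    also have "\<dots> = (\<Oplus>\<^bsub>\<D>\<^esub>s\<in>S. f s \<odot>\<^bsub>\<D>\<^esub> e s) x"
      using dual_finsum_apply[OF S(1) mem x] by simp
    finally show "f x = (\<Oplus>\<^bsub>\<D>\<^esub>s\<in>S. f s \<odot>\<^bsub>\<D>\<^esub> e s) x" .
  qed
qed

lemma dual_fin_dim:
  assumes fd: "fin_dim"
  shows "vectorspace.fin_dim K (\<D>)"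
proof -
  interpret D: vectorspace K "\<D>" by (rule dual_vectorspace)
  obtain S e where S: "finite S" "S \<subseteq> carrier V" "\<And>s. s \<in> S \<Longrightarrow> e s \<in> dual"
    and ex: "\<And>v. v \<in> carrier V \<Longrightarrow> v = (\<Oplus>\<^bsub>V\<^esub>s\<in>S. e s v \<odot>\<^bsub>V\<^esub> s)"
    using dual_basis[OF fd] by blast
  have sub: "e ` S \<subseteq> dual" using S(3) by blast
  interpret T: submodule K "D.span (e ` S)" "\<D>"
    using D.span_is_submodule[OF sub] .
  have "f \<in> D.span (e ` S)" if f: "f \<in> dual" for f
  proof -
    have "(\<lambda>s. f s \<odot>\<^bsub>\<D>\<^esub> e s) \<in> S \<rightarrow> D.span (e ` S)"
      using S(2) D.in_own_span[OF sub] dual_closed[OF f] by (intro Pi_I T.smult_closed) auto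
    then have "(\<Oplus>\<^bsub>\<D>\<^esub>s\<in>S. f s \<odot>\<^bsub>\<D>\<^esub> e s) \<in> D.span (e ` S)"
      by (rule D.finsum_submodule[OF D.span_is_submodule[OF sub] S(1)])
    then show ?thesis using dual_expand[OF S ex f] by simp
  qed
  then have "D.span (e ` S) = dual" using T.subset by blast
  then show ?thesis unfolding D.fin_dim_def using S(1) sub by blast
qed

text \<open>The representing vector is the sum of the \<open>s\<close> with coefficients
  \<open>F (e s)\<close>: both sides are linear in \<open>f\<close>, and \<open>f\<close> is a
  combination of the \<open>e s\<close>.\<close>

lemma dual_reflexive:
  assumes fd: "fin_dim" and F: "\<And>f. f \<in> dual \<Longrightarrow> F f \<in> carrier K"
    "\<And>f g. \<lbrakk>f \<in> dual; g \<in> dual\<rbrakk> \<Longrightarrow> F (f \<oplus>\<^bsub>\<D>\<^esub> g) = F f \<oplus>\<^bsub>K\<^esub> F g"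
    "\<And>k f. \<lbrakk>k \<in> carrier K; f \<in> dual\<rbrakk> \<Longrightarrow> F (k \<odot>\<^bsub>\<D>\<^esub> f) = k \<otimes>\<^bsub>K\<^esub> F f"
  obtains v where "v \<in> carrier V" "\<And>f. f \<in> dual \<Longrightarrow> F f = f v"
proof -
  interpret D: vectorspace K "\<D>" by (rule dual_vectorspace)
  obtain S e where S: "finite S" "S \<subseteq> carrier V" "\<And>s. s \<in> S \<Longrightarrow> e s \<in> dual"
    and ex: "\<And>v. v \<in> carrier V \<Longrightarrow> v = (\<Oplus>\<^bsub>V\<^esub>s\<in>S. e s v \<odot>\<^bsub>V\<^esub> s)"
    using dual_basis[OF fd] by blast
  \<comment> \<open>\<open>F\<close> is controlled on the dual only. Its restriction is extensional,
    hence an element of the bidual, to which \<open>dual_finsum\<close> applies.\<close>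
  have F': "restrict F dual \<in> D.dual"
    using F by (intro D.dual_restrictI) auto
  have Fe: "(\<lambda>s. F (e s) \<odot>\<^bsub>V\<^esub> s) \<in> S \<rightarrow> carrier V"
    using S F(1) by (auto intro!: smult_closed)
  show ?thesis
  proof (rule that[of "\<Oplus>\<^bsub>V\<^esub>s\<in>S. F (e s) \<odot>\<^bsub>V\<^esub> s"])
    show "(\<Oplus>\<^bsub>V\<^esub>s\<in>S. F (e s) \<odot>\<^bsub>V\<^esub> s) \<in> carrier V"
      using Fe by (rule M.finsum_closed)
    fix f assume f: "f \<in> dual"
    have mem: "(\<lambda>s. f s \<odot>\<^bsub>\<D>\<^esub> e s) \<in> S \<rightarrow> dual"
      using S f dual_closed by (auto intro!: D.smult_closed)
    have "F f = restrict F dual (\<Oplus>\<^bsub>\<D>\<^esub>s\<in>S. f s \<odot>\<^bsub>\<D>\<^esub> e s)"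
      using f dual_expand[OF S ex f] by simp
    also have "\<dots> = (\<Oplus>\<^bsub>K\<^esub>s\<in>S. restrict F dual (f s \<odot>\<^bsub>\<D>\<^esub> e s))"
      by (rule D.dual_finsum[OF S(1) mem F'])
    also have "\<dots> = (\<Oplus>\<^bsub>K\<^esub>s\<in>S. f (F (e s) \<odot>\<^bsub>V\<^esub> s))"
    proof (rule R.finsum_cong')
      fix s assume s: "s \<in> S"
      then have "f s \<odot>\<^bsub>\<D>\<^esub> e s \<in> dual" using mem by blast
      then show "restrict F dual (f s \<odot>\<^bsub>\<D>\<^esub> e s) = f (F (e s) \<odot>\<^bsub>V\<^esub> s)"
        using s S f F dual_closed[OF f] by (auto simp: dual_smult R.m_comm subset_iff)
    qed (use Fe dual_closed[OF f] in auto)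
    also have "\<dots> = f (\<Oplus>\<^bsub>V\<^esub>s\<in>S. F (e s) \<odot>\<^bsub>V\<^esub> s)"
      using dual_finsum[OF S(1) Fe f] by simp
    finally show "F f = f (\<Oplus>\<^bsub>V\<^esub>s\<in>S. F (e s) \<odot>\<^bsub>V\<^esub> s)" .
  qed
qed

text \<open>If \<open>U\<close> were proper, some nonzero functional on the dual would vanish on
  \<open>U\<close>. By reflexivity it is evaluation at a vector, which \<open>sep\<close> forces to
  be zero. The later spanning and surjectivity claims about duals reduce to this.\<close>

lemma dual_submodule_eqI:
  assumes fd: "fin_dim" and U: "submodule K U (\<D>)"
    and sep: "\<And>v. \<lbrakk>v \<in> carrier V; \<And>u. u \<in> U \<Longrightarrow> u v = \<zero>\<^bsub>K\<^esub>\<rbrakk> \<Longrightarrow> v = \<zero>\<^bsub>V\<^esub>"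
  shows "U = dual"
proof (rule ccontr)
  interpret D: vectorspace K "\<D>" by (rule dual_vectorspace)
  interpret U: submodule K U "\<D>" by fact
  assume "U \<noteq> dual"
  then obtain f where f: "f \<in> dual" "f \<notin> U" using U.subset by blast
  obtain F where F: "F \<in> D.dual" "\<And>u. u \<in> U \<Longrightarrow> F u = \<zero>\<^bsub>K\<^esub>" "F f \<noteq> \<zero>\<^bsub>K\<^esub>"
    using D.dual_separation[OF dual_fin_dim[OF fd] U f] by blast
  obtain v where v: "v \<in> carrier V" "\<And>f. f \<in> dual \<Longrightarrow> F f = f v"
    using dual_reflexive[OF fd, of F] D.dualD[OF F(1)] by blast
  have "v = \<zero>\<^bsub>V\<^esub>"
    using sep[OF v(1)] F(2) v(2) U.subset by (simp add: subset_iff)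
  then show False using F(3) v(2) f(1) dual_zero by simp
qed

end

section \<open>Tensor products\<close>

text \<open>\<open>tensor_lift\<close> evaluates a single representative of a class, so additivity
  of the lift rests on additivity of the evaluation of formal sums.\<close>

lemma frag_eval_add:
  assumes G: "comm_group G" and f: "\<And>x y. (x, y) \<in> S \<Longrightarrow> f x y \<in> carrier G"
    and cd: "Poly_Mapping.keys c \<subseteq> S" "Poly_Mapping.keys d \<subseteq> S"
  shows "frag_eval G f (c + d) = frag_eval G f c \<otimes>\<^bsub>G\<^esub> frag_eval G f d"
proof -
  interpret G: comm_group G by fact
  have mem: "f (fst p) (snd p) \<in> carrier G" if "p \<in> S" for p
    using f that by (cases p) auto
  let ?T = "Poly_Mapping.keys c \<union> Poly_Mapping.keys d"
  have T: "finite ?T" "?T \<subseteq> S" using cd by auto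
  have ev: "frag_eval G f b = finprod G (\<lambda>p. f (fst p) (snd p) [^]\<^bsub>G\<^esub> Poly_Mapping.lookup b p) ?T"
    if "Poly_Mapping.keys b \<subseteq> ?T" for b
    unfolding frag_eval_def using that T mem
    by (intro G.finprod_mono_neutral_cong_left) (auto simp: in_keys_iff subset_iff)
  have "frag_eval G f (c + d) = finprod G (\<lambda>p. f (fst p) (snd p) [^]\<^bsub>G\<^esub> Poly_Mapping.lookup c p \<otimes>\<^bsub>G\<^esub>
      f (fst p) (snd p) [^]\<^bsub>G\<^esub> Poly_Mapping.lookup d p) ?T"
    unfolding ev[OF keys_add] using T mem
    by (intro G.finprod_cong') (auto simp: lookup_add G.int_pow_mult subset_iff)
  also have "\<dots> = frag_eval G f c \<otimes>\<^bsub>G\<^esub> frag_eval G f d"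
    using T mem ev[of c] ev[of d] by (subst G.finprod_multf) (auto simp: subset_iff)
  finally show ?thesis .
qed

locale bimodule_pair = X: bimodule K A X + Y: bimodule K A Y
  for K :: "('k, 'c) ring_scheme" and A :: "('k, 'a, 'e) module_scheme"
    and X :: "('k, 'a, 'x, 'u) bimod_scheme" and Y :: "('k, 'a, 'y, 'v) bimod_scheme"
begin

abbreviation "T \<equiv> tensor A X Y"
abbreviation "pt \<equiv> pure_tensor A X Y"

context
begin

private abbreviation (input) "F \<equiv> free_Abelian_group (carrier X \<times> carrier Y)"
private abbreviation (input) "N \<equiv> tensor_subgroup A X Y"
private abbreviation (input) "q \<equiv> (\<lambda>c. N #>\<^bsub>F\<^esub> c)"

interpretation F: comm_group F by (rule abelian_free_Abelian_group)

private lemma F_diff: "\<lbrakk>c \<in> carrier F; d \<in> carrier F\<rbrakk> \<Longrightarrow> c - d = c \<otimes>\<^bsub>F\<^esub> inv\<^bsub>F\<^esub> d"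
  by simp

private lemma F_diff_closed: "\<lbrakk>c \<in> carrier F; d \<in> carrier F\<rbrakk> \<Longrightarrow> c - d \<in> carrier F"
  using F_diff F.m_closed F.inv_closed by metis

private lemma frag_closed: "\<lbrakk>x \<in> carrier X; y \<in> carrier Y\<rbrakk> \<Longrightarrow> frag_of (x, y) \<in> carrier F"
  by simp

private lemma relations_carrier: "tensor_relations A X Y \<subseteq> carrier F"
  unfolding tensor_relations_def
  by (auto simp only: intro!: F_diff_closed frag_closed X.M.add.m_closed Y.M.add.m_closed
      X.ract_closed Y.lact_closed)

private lemma N_subgroup: "subgroup N F"
  by (rule F.generate_is_subgroup[OF relations_carrier])

interpretation N: normal N F
  by (rule F.subgroup_imp_normal[OF N_subgroup])

interpretation T: comm_group "tensor_group A X Y"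
  unfolding tensor_group_def by (rule F.abelian_FactGroup[OF N_subgroup])

interpretation q: group_hom F "tensor_group A X Y" q
  using N.r_coset_hom_Mod unfolding tensor_group_def[symmetric]
  by (simp add: group_hom_def group_hom_axioms_def T.is_group)

private lemma T_simps:
  "carrier T = carrier (tensor_group A X Y)" "\<zero>\<^bsub>T\<^esub> = \<one>\<^bsub>tensor_group A X Y\<^esub>"
  "s \<oplus>\<^bsub>T\<^esub> t = s \<otimes>\<^bsub>tensor_group A X Y\<^esub> t"
  by (simp_all add: tensor_def)

lemma tensor_abelian_group: "abelian_group T"
proof (rule abelian_groupI)
  fix x assume "x \<in> carrier T"
  then show "\<exists>y\<in>carrier T. y \<oplus>\<^bsub>T\<^esub> x = \<zero>\<^bsub>T\<^esub>"
    unfolding T_simps using T.inv_closed T.l_inv by blast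
qed (auto simp: T_simps T.m_ac)

private lemma T_elem: "t \<in> carrier T \<longleftrightarrow> (\<exists>c\<in>carrier F. t = q c)"
  by (auto simp: T_simps tensor_group_def carrier_FactGroup)

private lemma q_relation:
  assumes "c - d \<in> N" "c \<in> carrier F" "d \<in> carrier F"
  shows "q c = q d"
proof -
  have "q (c - d) = \<one>\<^bsub>tensor_group A X Y\<^esub>"
    using F.coset_join2[OF F_diff_closed[OF assms(2,3)] N_subgroup assms(1)] by (simp add: tensor_group_def)
  then have "q c \<otimes>\<^bsub>tensor_group A X Y\<^esub> inv\<^bsub>tensor_group A X Y\<^esub> q d = \<one>\<^bsub>tensor_group A X Y\<^esub>"
    using q.hom_mult[OF assms(2) F.inv_closed[OF assms(3)]] q.hom_inv[OF assms(3)] F_diff[OF assms(2,3)]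
    by simp
  then show ?thesis
    using T.inv_equality[of "q c" "inv\<^bsub>tensor_group A X Y\<^esub> q d"] q.hom_closed assms(2,3) by simp
qed

lemma pure_closed: "\<lbrakk>x \<in> carrier X; y \<in> carrier Y\<rbrakk> \<Longrightarrow> pt x y \<in> carrier T"
  unfolding T_elem pure_tensor_def using frag_closed by blast

lemma pure_add_left:
  assumes "x \<in> carrier X" "x' \<in> carrier X" "y \<in> carrier Y"
  shows "pt (x \<oplus>\<^bsub>X\<^esub> x') y = pt x y \<oplus>\<^bsub>T\<^esub> pt x' y"
proof -
  have fr: "frag_of (x \<oplus>\<^bsub>X\<^esub> x', y) \<in> carrier F" "frag_of (x, y) \<in> carrier F" "frag_of (x', y) \<in> carrier F"
    using assms by (auto intro!: frag_closed X.M.add.m_closed)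
  have "frag_of (x \<oplus>\<^bsub>X\<^esub> x', y) - frag_of (x, y) - frag_of (x', y) \<in> tensor_relations A X Y"
    unfolding tensor_relations_def using assms by blast
  then have "frag_of (x \<oplus>\<^bsub>X\<^esub> x', y) - (frag_of (x, y) + frag_of (x', y)) \<in> N"
    by (simp add: generate.incl diff_diff_eq)
  then have "pt (x \<oplus>\<^bsub>X\<^esub> x') y = q (frag_of (x, y) + frag_of (x', y))"
    unfolding pure_tensor_def
    using fr F.m_closed[OF fr(2,3)] by (intro q_relation) simp_all
  then show ?thesis
    using q.hom_mult[OF fr(2,3)] by (simp add: pure_tensor_def T_simps)
qed

lemma pure_add_right:
  assumes "x \<in> carrier X" "y \<in> carrier Y" "y' \<in> carrier Y"
  shows "pt x (y \<oplus>\<^bsub>Y\<^esub> y') = pt x y \<oplus>\<^bsub>T\<^esub> pt x y'"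
proof -
  have fr: "frag_of (x, y \<oplus>\<^bsub>Y\<^esub> y') \<in> carrier F" "frag_of (x, y) \<in> carrier F" "frag_of (x, y') \<in> carrier F"
    using assms by (auto intro!: frag_closed Y.M.add.m_closed)
  have "frag_of (x, y \<oplus>\<^bsub>Y\<^esub> y') - frag_of (x, y) - frag_of (x, y') \<in> tensor_relations A X Y"
    unfolding tensor_relations_def using assms by blast
  then have "frag_of (x, y \<oplus>\<^bsub>Y\<^esub> y') - (frag_of (x, y) + frag_of (x, y')) \<in> N"
    by (simp add: generate.incl diff_diff_eq)
  then have "pt x (y \<oplus>\<^bsub>Y\<^esub> y') = q (frag_of (x, y) + frag_of (x, y'))"
    unfolding pure_tensor_def
    using fr F.m_closed[OF fr(2,3)] by (intro q_relation) simp_all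
  then show ?thesis
    using q.hom_mult[OF fr(2,3)] by (simp add: pure_tensor_def T_simps)
qed

lemma pure_balanced:
  assumes "x \<in> carrier X" "a \<in> carrier A" "y \<in> carrier Y"
  shows "pt (x \<triangleleft>\<^bsub>X\<^esub> a) y = pt x (a \<triangleright>\<^bsub>Y\<^esub> y)"
proof -
  have "frag_of (x \<triangleleft>\<^bsub>X\<^esub> a, y) - frag_of (x, a \<triangleright>\<^bsub>Y\<^esub> y) \<in> tensor_relations A X Y"
    unfolding tensor_relations_def using assms by blast
  then show ?thesis
    unfolding pure_tensor_def using assms
    by (intro q_relation generate.incl frag_closed X.ract_closed Y.lact_closed)
qed

lemma pure_zero_left:
  assumes "y \<in> carrier Y"
  shows "pt \<zero>\<^bsub>X\<^esub> y = \<zero>\<^bsub>T\<^esub>"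
proof -
  interpret TT: abelian_group T by (rule tensor_abelian_group)
  have "pt \<zero>\<^bsub>X\<^esub> y \<oplus>\<^bsub>T\<^esub> pt \<zero>\<^bsub>X\<^esub> y = pt \<zero>\<^bsub>X\<^esub> y"
    using pure_add_left[of "\<zero>\<^bsub>X\<^esub>" "\<zero>\<^bsub>X\<^esub>" y] assms by simp
  then show ?thesis
    using pure_closed[of "\<zero>\<^bsub>X\<^esub>" y] assms by simp
qed

text \<open>Sums of pure tensors exhaust the tensor product: the negative of a pure tensor is again
  pure, so integer combinations reduce to sums.\<close>

lemma tensor_induct [consumes 1, case_names pure add]:
  assumes t: "t \<in> carrier T"
    and pure: "\<And>x y. \<lbrakk>x \<in> carrier X; y \<in> carrier Y\<rbrakk> \<Longrightarrow> P (pt x y)"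
    and add: "\<And>s t. \<lbrakk>s \<in> carrier T; t \<in> carrier T; P s; P t\<rbrakk> \<Longrightarrow> P (s \<oplus>\<^bsub>T\<^esub> t)"
  shows "P t"
proof -
  interpret TT: abelian_group T by (rule tensor_abelian_group)
  obtain c where c: "c \<in> carrier F" "t = q c" using t T_elem by blast
  have neg: "\<ominus>\<^bsub>T\<^esub> pt x y = pt (\<ominus>\<^bsub>X\<^esub> x) y" if "x \<in> carrier X" "y \<in> carrier Y" for x y
  proof -
    have "pt (\<ominus>\<^bsub>X\<^esub> x) y \<oplus>\<^bsub>T\<^esub> pt x y = \<zero>\<^bsub>T\<^esub>"
      using pure_add_left[of "\<ominus>\<^bsub>X\<^esub> x" x y] that pure_zero_left by (simp add: X.M.l_neg)
    then show ?thesis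
      using that pure_closed by (intro TT.minus_equality) auto
  qed
  have P0: "P \<zero>\<^bsub>T\<^esub>" using pure[of "\<zero>\<^bsub>X\<^esub>" "\<zero>\<^bsub>Y\<^esub>"] pure_zero_left by simp
  have inv_eq: "inv\<^bsub>tensor_group A X Y\<^esub> s = \<ominus>\<^bsub>T\<^esub> s" if "s \<in> carrier T" for s
    using that TT.l_neg[OF that] TT.a_inv_closed[OF that]
    by (intro T.inv_equality) (auto simp: T_simps)
  \<comment> \<open>\<open>frag_induction\<close> proceeds by differences, so the claim carries the
    negative of the class along with the class itself.\<close>
  have "c \<in> carrier F \<and> P (q c) \<and> P (\<ominus>\<^bsub>T\<^esub> (q c))"
    using c(1)[unfolded carrier_free_Abelian_group_iff]
  proof (induction c rule: frag_induction)
    case zero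
    have "q 0 = \<zero>\<^bsub>T\<^esub>" using q.hom_one by (simp add: T_simps)
    moreover have "\<ominus>\<^bsub>T\<^esub> \<zero>\<^bsub>T\<^esub> = \<zero>\<^bsub>T\<^esub>" by (rule TT.minus_equality) auto
    ultimately show ?case using P0 F.one_closed by (metis one_free_Abelian_group)
  next
    case (one p)
    then show ?case
      using pure[of "fst p" "snd p"] pure[of "\<ominus>\<^bsub>X\<^esub> fst p" "snd p"] neg[of "fst p" "snd p"]
      by (auto simp: pure_tensor_def[symmetric])
  next
    case (diff c d)
    have mem: "q c \<in> carrier T" "q d \<in> carrier T" using diff T_elem by blast+
    have "q (c - d) = q c \<oplus>\<^bsub>T\<^esub> \<ominus>\<^bsub>T\<^esub> (q d)"
    proof -
      have F: "c \<in> carrier F" "d \<in> carrier F" using diff by blast+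
      have "q (c - d) = q (c \<otimes>\<^bsub>F\<^esub> inv\<^bsub>F\<^esub> d)" by (simp only: F_diff[OF F])
      also have "\<dots> = q c \<otimes>\<^bsub>tensor_group A X Y\<^esub> inv\<^bsub>tensor_group A X Y\<^esub> q d"
        by (simp only: q.hom_mult[OF F(1) F.inv_closed[OF F(2)]] q.hom_inv[OF F(2)])
      finally show ?thesis by (simp only: T_simps(3) inv_eq[OF mem(2)])
    qed
    moreover from this have "\<ominus>\<^bsub>T\<^esub> (q (c - d)) = \<ominus>\<^bsub>T\<^esub> (q c) \<oplus>\<^bsub>T\<^esub> q d"
      using mem TT.minus_add[of "q c" "\<ominus>\<^bsub>T\<^esub> (q d)"] TT.minus_minus[of "q d"] TT.a_inv_closed[of "q d"]
      by metis
    ultimately show ?case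
      using diff mem F_diff_closed[of c d] add TT.a_inv_closed by metis
  qed
  then show ?thesis using c by simp
qed

end

end

section \<open>The universal property of the tensor product\<close>

locale balanced_map = bimodule_pair K A X Y + G: abelian_group G
  for K :: "('k, 'c) ring_scheme" and A :: "('k, 'a, 'e) module_scheme"
    and X :: "('k, 'a, 'x, 'u) bimod_scheme" and Y :: "('k, 'a, 'y, 'v) bimod_scheme"
    and G :: "('g, 'h) ring_scheme" (structure) +
  fixes f
  assumes map_closed: "\<lbrakk>x \<in> carrier X; y \<in> carrier Y\<rbrakk> \<Longrightarrow> f x y \<in> carrier G"
    and map_add_left: "\<lbrakk>x \<in> carrier X; x' \<in> carrier X; y \<in> carrier Y\<rbrakk>
      \<Longrightarrow> f (x \<oplus>\<^bsub>X\<^esub> x') y = f x y \<oplus> f x' y"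
    and map_add_right: "\<lbrakk>x \<in> carrier X; y \<in> carrier Y; y' \<in> carrier Y\<rbrakk>
      \<Longrightarrow> f x (y \<oplus>\<^bsub>Y\<^esub> y') = f x y \<oplus> f x y'"
    and map_balanced: "\<lbrakk>x \<in> carrier X; a \<in> carrier A; y \<in> carrier Y\<rbrakk>
      \<Longrightarrow> f (x \<triangleleft>\<^bsub>X\<^esub> a) y = f x (a \<triangleright>\<^bsub>Y\<^esub> y)"
begin

text \<open>\<open>tensor_lift\<close> takes a multiplicatively written target, so the additive
  group of \<open>G\<close> is repackaged as a monoid record.\<close>

definition lift where
  "lift = tensor_lift (\<lparr>carrier = carrier G, monoid.mult = add G, one = zero G\<rparr> :: 'g monoid) f"

context
begin

private abbreviation (input) "AG \<equiv> \<lparr>carrier = carrier G, monoid.mult = add G, one = zero G\<rparr> :: 'g monoid"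

private lemma AG: "comm_group AG"
proof (rule comm_groupI)
  fix x assume "x \<in> carrier AG"
  then show "\<exists>y\<in>carrier AG. y \<otimes>\<^bsub>AG\<^esub> x = \<one>\<^bsub>AG\<^esub>"
    using G.l_neg by auto
qed (auto simp: G.add.m_ac)

lemma lift_pure: "\<lbrakk>x \<in> carrier X; y \<in> carrier Y\<rbrakk> \<Longrightarrow> lift (pt x y) = f x y"
  unfolding lift_def
  by (rule tensor_lift_pure[OF X.bimodule_axioms Y.bimodule_axioms AG])
    (auto simp: map_closed map_add_left map_add_right map_balanced)

private lemma lift_coset:
  "Poly_Mapping.keys c \<subseteq> carrier X \<times> carrier Y \<Longrightarrow>
    lift (tensor_subgroup A X Y #>\<^bsub>free_Abelian_group (carrier X \<times> carrier Y)\<^esub> c) = frag_eval AG f c"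
  unfolding lift_def
  by (rule tensor_lift_coset[OF X.bimodule_axioms Y.bimodule_axioms AG])
    (auto simp: map_closed map_add_left map_add_right map_balanced)

lemma lift_add:
  assumes "s \<in> carrier T" "t \<in> carrier T"
  shows "lift (s \<oplus>\<^bsub>T\<^esub> t) = lift s \<oplus> lift t"
proof -
  interpret F: comm_group "free_Abelian_group (carrier X \<times> carrier Y)"
    by (rule abelian_free_Abelian_group)
  have "tensor_relations A X Y \<subseteq> carrier (free_Abelian_group (carrier X \<times> carrier Y))"
    unfolding tensor_relations_def
    by (auto intro!: X.M.add.m_closed Y.M.add.m_closed X.ract_closed Y.lact_closed
        dest!: subsetD[OF keys_diff])
  then interpret N: normal "tensor_subgroup A X Y" "free_Abelian_group (carrier X \<times> carrier Y)"
    by (intro F.subgroup_imp_normal F.generate_is_subgroup)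
  obtain c d where c: "Poly_Mapping.keys c \<subseteq> carrier X \<times> carrier Y"
      "s = tensor_subgroup A X Y #>\<^bsub>free_Abelian_group (carrier X \<times> carrier Y)\<^esub> c"
    and d: "Poly_Mapping.keys d \<subseteq> carrier X \<times> carrier Y"
      "t = tensor_subgroup A X Y #>\<^bsub>free_Abelian_group (carrier X \<times> carrier Y)\<^esub> d"
    using assms by (auto simp: tensor_def tensor_group_def carrier_FactGroup)
  have cd: "Poly_Mapping.keys (c + d) \<subseteq> carrier X \<times> carrier Y"
    using keys_add[of c d] c(1) d(1) by blast
  have "s \<oplus>\<^bsub>T\<^esub> t = tensor_subgroup A X Y #>\<^bsub>free_Abelian_group (carrier X \<times> carrier Y)\<^esub> (c + d)"
    using N.rcos_sum[of c d] c d by (simp add: tensor_def tensor_group_def)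
  then show ?thesis
    using lift_coset[OF cd] lift_coset[OF c(1)] lift_coset[OF d(1)] c d
      frag_eval_add[OF AG _ c(1) d(1), of f] map_closed
    by simp
qed

lemma lift_closed: "t \<in> carrier T \<Longrightarrow> lift t \<in> carrier G"
  by (induction t rule: tensor_induct) (auto simp: lift_pure map_closed lift_add)

lemma lift_zero: "lift \<zero>\<^bsub>T\<^esub> = \<zero>"
  using lift_pure[of "\<zero>\<^bsub>X\<^esub>" "\<zero>\<^bsub>Y\<^esub>"] map_add_left[of "\<zero>\<^bsub>X\<^esub>" "\<zero>\<^bsub>X\<^esub>" "\<zero>\<^bsub>Y\<^esub>"] map_closed[of "\<zero>\<^bsub>X\<^esub>" "\<zero>\<^bsub>Y\<^esub>"]
  by (simp add: pure_zero_left)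

end

end

text \<open>With this equation a \<open>lift\<close> into a tensor product is literally the
  \<open>tensor_lift\<close> occurring in the actions on \<open>tensor\<close>, in
  \<open>tensor_map\<close> and in \<open>tensor_assoc\<close>.\<close>

lemma tensor_group_eq: "tensor_group A X Y =
    \<lparr>carrier = carrier (tensor A X Y), monoid.mult = add (tensor A X Y), one = zero (tensor A X Y)\<rparr>"
  by (simp add: tensor_def tensor_group_def FactGroup_def)

section \<open>Bimodule structure and dimension of the tensor product\<close>

context bimodule_pair
begin

interpretation T: abelian_group T by (rule tensor_abelian_group)

lemma smult_balanced:
  "k \<in> carrier K \<Longrightarrow> balanced_map K A X Y T (\<lambda>x. pt (k \<odot>\<^bsub>X\<^esub> x))"
  by unfold_locales
    (auto simp: pure_closed pure_add_left pure_add_right X.smult_r_distr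
      pure_balanced simp flip: X.ract_smult_left)

lemma lact_balanced:
  "a \<in> carrier A \<Longrightarrow> balanced_map K A X Y T (\<lambda>x. pt (a \<triangleright>\<^bsub>X\<^esub> x))"
  by unfold_locales
    (auto simp: pure_closed pure_add_left pure_add_right X.lact_add_right X.lact_closed
      pure_balanced simp flip: X.lact_ract)

lemma ract_balanced:
  "a \<in> carrier A \<Longrightarrow> balanced_map K A X Y T (\<lambda>x y. pt x (y \<triangleleft>\<^bsub>Y\<^esub> a))"
  by unfold_locales
    (auto simp: pure_closed pure_add_left pure_add_right Y.ract_add_left Y.ract_closed
      pure_balanced Y.lact_ract)

lemma tensor_acts:
  shows smult_lift: "k \<in> carrier K \<Longrightarrow> k \<odot>\<^bsub>T\<^esub> t = balanced_map.lift T (\<lambda>x. pt (k \<odot>\<^bsub>X\<^esub> x)) t"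
    and lact_lift: "a \<in> carrier A \<Longrightarrow> a \<triangleright>\<^bsub>T\<^esub> t = balanced_map.lift T (\<lambda>x. pt (a \<triangleright>\<^bsub>X\<^esub> x)) t"
    and ract_lift: "a \<in> carrier A \<Longrightarrow> t \<triangleleft>\<^bsub>T\<^esub> a = balanced_map.lift T (\<lambda>x y. pt x (y \<triangleleft>\<^bsub>Y\<^esub> a)) t"
  using balanced_map.lift_def[OF smult_balanced, of k] balanced_map.lift_def[OF lact_balanced, of a]
    balanced_map.lift_def[OF ract_balanced, of a]
  by (simp_all flip: tensor_group_eq) (simp_all add: tensor_def)

lemma tensor_smult:
  assumes "k \<in> carrier K"
  shows tensor_smult_pure: "\<lbrakk>x \<in> carrier X; y \<in> carrier Y\<rbrakk> \<Longrightarrow> k \<odot>\<^bsub>T\<^esub> pt x y = pt (k \<odot>\<^bsub>X\<^esub> x) y"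
    and tensor_smult_closed: "t \<in> carrier T \<Longrightarrow> k \<odot>\<^bsub>T\<^esub> t \<in> carrier T"
    and tensor_smult_add: "\<lbrakk>s \<in> carrier T; t \<in> carrier T\<rbrakk> \<Longrightarrow> k \<odot>\<^bsub>T\<^esub> (s \<oplus>\<^bsub>T\<^esub> t) = k \<odot>\<^bsub>T\<^esub> s \<oplus>\<^bsub>T\<^esub> k \<odot>\<^bsub>T\<^esub> t"
  using balanced_map.lift_pure[OF smult_balanced[OF assms]] balanced_map.lift_closed[OF smult_balanced[OF assms]]
    balanced_map.lift_add[OF smult_balanced[OF assms]] smult_lift[OF assms]
  by simp_all

lemma tensor_lact:
  assumes "a \<in> carrier A"
  shows tensor_lact_pure: "\<lbrakk>x \<in> carrier X; y \<in> carrier Y\<rbrakk> \<Longrightarrow> a \<triangleright>\<^bsub>T\<^esub> pt x y = pt (a \<triangleright>\<^bsub>X\<^esub> x) y"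
    and tensor_lact_closed: "t \<in> carrier T \<Longrightarrow> a \<triangleright>\<^bsub>T\<^esub> t \<in> carrier T"
    and tensor_lact_add: "\<lbrakk>s \<in> carrier T; t \<in> carrier T\<rbrakk> \<Longrightarrow> a \<triangleright>\<^bsub>T\<^esub> (s \<oplus>\<^bsub>T\<^esub> t) = (a \<triangleright>\<^bsub>T\<^esub> s) \<oplus>\<^bsub>T\<^esub> (a \<triangleright>\<^bsub>T\<^esub> t)"
  using balanced_map.lift_pure[OF lact_balanced[OF assms]] balanced_map.lift_closed[OF lact_balanced[OF assms]]
    balanced_map.lift_add[OF lact_balanced[OF assms]] lact_lift[OF assms]
  by simp_all

lemma tensor_ract:
  assumes "a \<in> carrier A"
  shows tensor_ract_pure: "\<lbrakk>x \<in> carrier X; y \<in> carrier Y\<rbrakk> \<Longrightarrow> pt x y \<triangleleft>\<^bsub>T\<^esub> a = pt x (y \<triangleleft>\<^bsub>Y\<^esub> a)"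
    and tensor_ract_closed: "t \<in> carrier T \<Longrightarrow> t \<triangleleft>\<^bsub>T\<^esub> a \<in> carrier T"
    and tensor_ract_add: "\<lbrakk>s \<in> carrier T; t \<in> carrier T\<rbrakk> \<Longrightarrow> (s \<oplus>\<^bsub>T\<^esub> t) \<triangleleft>\<^bsub>T\<^esub> a = s \<triangleleft>\<^bsub>T\<^esub> a \<oplus>\<^bsub>T\<^esub> t \<triangleleft>\<^bsub>T\<^esub> a"
  using balanced_map.lift_pure[OF ract_balanced[OF assms]] balanced_map.lift_closed[OF ract_balanced[OF assms]]
    balanced_map.lift_add[OF ract_balanced[OF assms]] ract_lift[OF assms]
  by simp_all

lemma smult_pure_right:
  assumes "k \<in> carrier K" "x \<in> carrier X" "y \<in> carrier Y"
  shows "pt (k \<odot>\<^bsub>X\<^esub> x) y = pt x (k \<odot>\<^bsub>Y\<^esub> y)"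
proof -
  have "pt (k \<odot>\<^bsub>X\<^esub> x) y = pt (x \<triangleleft>\<^bsub>X\<^esub> (k \<odot>\<^bsub>A\<^esub> \<one>\<^bsub>A\<^esub>)) y"
    using assms by (simp add: X.ract_smult_right X.ract_one)
  also have "\<dots> = pt x ((k \<odot>\<^bsub>A\<^esub> \<one>\<^bsub>A\<^esub>) \<triangleright>\<^bsub>Y\<^esub> y)"
    using assms by (intro pure_balanced) auto
  also have "\<dots> = pt x (k \<odot>\<^bsub>Y\<^esub> y)"
    using assms by (simp add: Y.lact_smult_left Y.lact_one)
  finally show ?thesis .
qed

lemmas tensor_closed = pure_closed tensor_smult_closed tensor_lact_closed tensor_ract_closed
lemmas tensor_pures = tensor_smult_pure tensor_lact_pure tensor_ract_pure
lemmas tensor_adds = tensor_smult_add tensor_lact_add tensor_ract_add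

lemma tensor_module: "module K T"
proof (rule moduleI)
  show "cring K" by (rule X.A.is_cring)
  show "abelian_group T" by (rule tensor_abelian_group)
  fix k t assume kt: "k \<in> carrier K" "t \<in> carrier T"
  show "k \<odot>\<^bsub>T\<^esub> t \<in> carrier T" using kt by (rule tensor_smult_closed)
next
  fix k l t assume kl: "k \<in> carrier K" "l \<in> carrier K" and t: "t \<in> carrier T"
  show "(k \<oplus>\<^bsub>K\<^esub> l) \<odot>\<^bsub>T\<^esub> t = k \<odot>\<^bsub>T\<^esub> t \<oplus>\<^bsub>T\<^esub> l \<odot>\<^bsub>T\<^esub> t"
    using t kl by (induction t rule: tensor_induct)
      (auto simp: tensor_pures tensor_adds tensor_closed X.smult_l_distr pure_add_left T.add.m_ac)
  show "(k \<otimes>\<^bsub>K\<^esub> l) \<odot>\<^bsub>T\<^esub> t = k \<odot>\<^bsub>T\<^esub> (l \<odot>\<^bsub>T\<^esub> t)"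
    using t kl by (induction t rule: tensor_induct)
      (auto simp: tensor_pures tensor_adds tensor_closed X.smult_assoc1)
next
  fix t assume "t \<in> carrier T"
  then show "\<one>\<^bsub>K\<^esub> \<odot>\<^bsub>T\<^esub> t = t"
    by (induction t rule: tensor_induct) (auto simp: tensor_pures tensor_adds)
qed (rule tensor_smult_add)

lemma tensor_bimodule: "bimodule K A T"
proof -
  interpret T': module K T by (rule tensor_module)
  have "vectorspace K T"
    by (simp add: vectorspace_def tensor_module X.A.field_axioms)
  moreover have "t \<triangleleft>\<^bsub>T\<^esub> (a \<oplus>\<^bsub>A\<^esub> b) = t \<triangleleft>\<^bsub>T\<^esub> a \<oplus>\<^bsub>T\<^esub> t \<triangleleft>\<^bsub>T\<^esub> b"
    "t \<triangleleft>\<^bsub>T\<^esub> (a \<otimes>\<^bsub>A\<^esub> b) = (t \<triangleleft>\<^bsub>T\<^esub> a) \<triangleleft>\<^bsub>T\<^esub> b"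
    "(a \<oplus>\<^bsub>A\<^esub> b) \<triangleright>\<^bsub>T\<^esub> t = (a \<triangleright>\<^bsub>T\<^esub> t) \<oplus>\<^bsub>T\<^esub> (b \<triangleright>\<^bsub>T\<^esub> t)"
    "(a \<otimes>\<^bsub>A\<^esub> b) \<triangleright>\<^bsub>T\<^esub> t = a \<triangleright>\<^bsub>T\<^esub> (b \<triangleright>\<^bsub>T\<^esub> t)"
    "(a \<triangleright>\<^bsub>T\<^esub> t) \<triangleleft>\<^bsub>T\<^esub> b = a \<triangleright>\<^bsub>T\<^esub> (t \<triangleleft>\<^bsub>T\<^esub> b)"
    if "t \<in> carrier T" "a \<in> carrier A" "b \<in> carrier A" for t a b
    using that by (induction t rule: tensor_induct)
      (auto simp: tensor_pures tensor_adds tensor_closed pure_add_left pure_add_right T.add.m_ac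
        Y.ract_add_right Y.ract_mult Y.ract_closed X.lact_add_left X.lact_mult X.lact_closed)
  moreover have "(k \<odot>\<^bsub>T\<^esub> t) \<triangleleft>\<^bsub>T\<^esub> a = k \<odot>\<^bsub>T\<^esub> (t \<triangleleft>\<^bsub>T\<^esub> a)" "t \<triangleleft>\<^bsub>T\<^esub> (k \<odot>\<^bsub>A\<^esub> a) = k \<odot>\<^bsub>T\<^esub> (t \<triangleleft>\<^bsub>T\<^esub> a)"
    "a \<triangleright>\<^bsub>T\<^esub> (k \<odot>\<^bsub>T\<^esub> t) = k \<odot>\<^bsub>T\<^esub> (a \<triangleright>\<^bsub>T\<^esub> t)" "(k \<odot>\<^bsub>A\<^esub> a) \<triangleright>\<^bsub>T\<^esub> t = k \<odot>\<^bsub>T\<^esub> (a \<triangleright>\<^bsub>T\<^esub> t)"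
    if "t \<in> carrier T" "a \<in> carrier A" "k \<in> carrier K" for t a k
    using that by (induction t rule: tensor_induct)
      (auto simp: tensor_pures tensor_adds tensor_closed smult_pure_right
        Y.ract_smult_right Y.ract_smult_left Y.ract_closed X.lact_smult_left X.lact_smult_right X.lact_closed)
  moreover have "t \<triangleleft>\<^bsub>T\<^esub> \<one>\<^bsub>A\<^esub> = t" "\<one>\<^bsub>A\<^esub> \<triangleright>\<^bsub>T\<^esub> t = t" if "t \<in> carrier T" for t
    using that by (induction t rule: tensor_induct)
      (auto simp: tensor_pures tensor_adds Y.ract_one X.lact_one)
  ultimately show ?thesis
    using X.A.fd_algebra_axioms
    by (auto simp: bimodule_def bimodule_axioms_def right_module_def right_module_axioms_def
      tensor_closed tensor_adds)
qed

text \<open>With one factor fixed, the vectors whose pure tensor lies in the span form a subspace;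
  this is applied to the second factor, then to the first. Finite dimension lets functionals
  separate the points of D(A) \<otimes> D(A).\<close>

lemma tensor_fin_dim:
  assumes "X.fin_dim" "Y.fin_dim"
  shows "vectorspace.fin_dim K T"
proof -
  interpret T': bimodule K A T by (rule tensor_bimodule)
  obtain S where S: "finite S" "S \<subseteq> carrier X" "X.span S = carrier X"
    using assms(1) X.fin_dim_def by auto
  obtain R where R: "finite R" "R \<subseteq> carrier Y" "Y.span R = carrier Y"
    using assms(2) Y.fin_dim_def by auto
  let ?P = "(\<lambda>(x, y). pt x y) ` (S \<times> R)"
  have P: "?P \<subseteq> carrier T" using S(2) R(2) pure_closed by (auto simp: subset_iff)
  interpret H: submodule K "T'.span ?P" T using T'.span_is_submodule[OF P] .
  have zero: "pt x \<zero>\<^bsub>Y\<^esub> = \<zero>\<^bsub>T\<^esub>" if "x \<in> carrier X" for x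
    using pure_add_right[of x "\<zero>\<^bsub>Y\<^esub>" "\<zero>\<^bsub>Y\<^esub>"] pure_closed[of x "\<zero>\<^bsub>Y\<^esub>"] that by simp
  have 1: "pt x y \<in> T'.span ?P" if x: "x \<in> S" and y: "y \<in> carrier Y" for x y
  proof -
    have x': "x \<in> carrier X" using x S by blast
    have "submodule K {y \<in> carrier Y. pt x y \<in> T'.span ?P} Y"
      using x' by unfold_locales (auto simp: pure_add_right zero smult_pure_right[symmetric]
        tensor_smult_pure[symmetric])
    moreover have "R \<subseteq> {y \<in> carrier Y. pt x y \<in> T'.span ?P}"
      using T'.in_own_span[OF P] x R(2) by auto
    ultimately have "Y.span R \<subseteq> {y \<in> carrier Y. pt x y \<in> T'.span ?P}"
      by (intro Y.span_is_subset)
    then show ?thesis using R(3) y by blast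
  qed
  have 2: "pt x y \<in> T'.span ?P" if x: "x \<in> carrier X" and y: "y \<in> carrier Y" for x y
  proof -
    have "submodule K {x \<in> carrier X. pt x y \<in> T'.span ?P} X"
      using y by unfold_locales (auto simp: pure_add_left pure_zero_left tensor_smult_pure[symmetric])
    moreover have "S \<subseteq> {x \<in> carrier X. pt x y \<in> T'.span ?P}"
      using 1 y S(2) by auto
    ultimately have "X.span S \<subseteq> {x \<in> carrier X. pt x y \<in> T'.span ?P}"
      by (intro X.span_is_subset)
    then show ?thesis using S(3) x by blast
  qed
  have "t \<in> T'.span ?P" if "t \<in> carrier T" for t
    using that by (induction t rule: tensor_induct) (auto simp: 2)
  then have "T'.span ?P = carrier T" using H.subset by blast
  moreover have "finite ?P" using S(1) R(1) by simp
  ultimately show ?thesis unfolding T'.fin_dim_def using P by blast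
qed

end

section \<open>Idempotent ideals\<close>

locale fd_alg = K: field K + A: ring A + fd_algebra K A
  for K :: "('k, 'c) ring_scheme" and A :: "('k, 'a, 'e) module_scheme" (structure)
begin

lemma ideal_submodule:
  assumes "ideal J A"
  shows "submodule K J A"
proof -
  interpret J: ideal J A by fact
  show ?thesis
  proof unfold_locales
    fix k x assume k: "k \<in> carrier K" "x \<in> J"
    have "k \<odot> x = (k \<odot> \<one>) \<otimes> x"
      using k J.a_subset by (auto simp: smult_mult_left)
    then show "k \<odot> x \<in> J" using k J.I_l_closed by simp
  qed (use J.a_subset in \<open>auto\<close>)
qed

lemma right_mult_submodule:
  assumes "z \<in> carrier A" "submodule K U A"
  shows "submodule K ((\<otimes>) z ` U) A"
proof -
  interpret U: submodule K U A by fact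
  have U: "u \<in> carrier A" if "u \<in> U" for u using that U.subset by blast
  show ?thesis
  proof unfold_locales
    show "(\<otimes>) z ` U \<subseteq> carrier A" using assms U by auto
    show "\<zero> \<in> (\<otimes>) z ` U" using assms by (intro image_eqI[of _ _ "\<zero>"]) auto
    fix x y assume "x \<in> (\<otimes>) z ` U" "y \<in> (\<otimes>) z ` U"
    then obtain u v where uv: "x = z \<otimes> u" "y = z \<otimes> v" "u \<in> U" "v \<in> U" by blast
    then have "x \<oplus> y = z \<otimes> (u \<oplus> v)" using assms U by (simp add: A.r_distr)
    then show "x \<oplus> y \<in> (\<otimes>) z ` U" using uv by blast
  next
    fix k x assume k: "k \<in> carrier K" "x \<in> (\<otimes>) z ` U"
    then obtain u where u: "x = z \<otimes> u" "u \<in> U" by blast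
    then have "k \<odot> x = z \<otimes> (k \<odot> u)" using assms k U by (simp add: smult_mult_right)
    then show "k \<odot> x \<in> (\<otimes>) z ` U" using k u by blast
  qed
qed

lemma carrier_submodule: "submodule K (carrier A) A"
  by unfold_locales auto

lemma annihilator_submodule:
  assumes "z \<in> carrier A"
  shows "submodule K {c \<in> carrier A. z \<otimes> c = \<zero>} A"
  by unfold_locales (use assms in \<open>auto simp: A.r_distr smult_mult_right smult_r_null\<close>)

text \<open>Fitting's lemma for left multiplication by \<open>y\<close>: on the stable image \<open>z A\<close>, \<open>z = y\<^sup>k\<close>,
  it is bijective, and the idempotent is the element of \<open>z A\<close> fixed by this.\<close>

lemma non_nilpotent_idempotent:
  assumes y: "y \<in> carrier A" and nn: "\<And>n::nat. y [^] n \<noteq> \<zero>"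
  obtains f c where "f \<in> carrier A" "f \<noteq> \<zero>" "f \<otimes> f = f" "c \<in> carrier A" "f = y \<otimes> c"
    "\<And>x. \<lbrakk>x \<in> carrier A; y \<otimes> x = \<zero>\<rbrakk> \<Longrightarrow> f \<otimes> x = \<zero>"
proof -
  have pw [simp]: "y [^] n \<in> carrier A" for n :: nat using y by simp
  \<comment> \<open>Images and kernels of left multiplication by the powers of \<open>y\<close>.
    Both chains become stationary, at \<open>n\<close> and \<open>m\<close> below.\<close>
  define R where "R n = (\<otimes>) (y [^] n) ` carrier A" for n :: nat
  define N where "N n = {c \<in> carrier A. y [^] n \<otimes> c = \<zero>}" for n :: nat
  have R: "submodule K (R n) A" and N: "submodule K (N n) A" for n
    unfolding R_def N_def
    by (rule right_mult_submodule[OF pw carrier_submodule], rule annihilator_submodule[OF pw])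
  obtain H where H: "H \<in> range R" and minR: "\<And>W. \<lbrakk>submodule K W A; W \<in> range R; W \<subseteq> H\<rbrakk> \<Longrightarrow> W = H"
    by (rule minimal_submodule[OF finite_dimensional R[of 0], of "\<lambda>U. U \<in> range R"]) auto
  obtain n where n: "H = R n" using H by blast
  obtain L where L: "L \<in> range N" and maxN: "\<And>W. \<lbrakk>submodule K W A; W \<in> range N; L \<subseteq> W\<rbrakk> \<Longrightarrow> W = L"
    by (rule maximal_submodule[OF finite_dimensional N[of 0], of "\<lambda>U. U \<in> range N"]) auto
  obtain m where m: "L = N m" using L by blast
  have R_stable: "R (n + i) = R n" for i
  proof -
    have "R (n + i) \<subseteq> R n"
    proof
      fix x assume "x \<in> R (n + i)"
      then obtain c where c: "c \<in> carrier A" "x = y [^] (n + i) \<otimes> c" unfolding R_def by blast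
      then have "x = y [^] n \<otimes> (y [^] i \<otimes> c)"
        using y by (simp add: A.m_assoc A.nat_pow_mult[symmetric])
      then show "x \<in> R n" unfolding R_def using c by auto
    qed
    then show ?thesis
      using minR[OF R, of "n + i"] n by blast
  qed
  have N_stable: "N (m + i) = N m" for i
  proof -
    have "N m \<subseteq> N (m + i)"
    proof
      fix c assume "c \<in> N m"
      then have c: "c \<in> carrier A" "y [^] m \<otimes> c = \<zero>" by (auto simp: N_def)
      have "y [^] (m + i) \<otimes> c = y [^] i \<otimes> (y [^] m \<otimes> c)"
        using c(1) y by (simp add: A.m_assoc[symmetric] A.nat_pow_mult add.commute)
      then show "c \<in> N (m + i)" using c by (simp add: N_def)
    qed
    then show ?thesis
      using maxN[OF N, of "m + i"] m by blast
  qed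
  \<comment> \<open>\<open>k\<close> lies beyond both stabilisation indices, and \<open>Suc\<close>
    makes it positive, so that a factor \<open>y\<close> can be split off \<open>z\<close> on either
    side.\<close>
  define k where "k = Suc (n + m)"
  define z where "z = y [^] k"
  have z: "z \<in> carrier A" by (simp add: z_def)
  have zz: "z \<otimes> z = y [^] (k + k)" unfolding z_def using y by (simp add: A.nat_pow_mult)
  have "z = z \<otimes> \<one>" using z by simp
  then have "z \<in> R k" unfolding z_def R_def by (intro image_eqI[of _ _ \<one>]) auto
  also have "R k = R (k + k)"
    using R_stable[of "Suc m"] R_stable[of "Suc m + k"] unfolding k_def by (simp add: add.assoc)
  \<comment> \<open>Stability of the images gives \<open>z = z \<otimes> z \<otimes> c\<close>, so
    \<open>z \<otimes> c\<close> is fixed by left multiplication with \<open>z\<close>, in the sense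
    that \<open>z \<otimes> (z \<otimes> c) = z\<close>. Stability of the kernels
    (\<open>inj\<close>) then cancels one factor \<open>z\<close>, which yields idempotency.\<close>
  finally obtain c where c: "c \<in> carrier A" "z = z \<otimes> z \<otimes> c" unfolding zz R_def by blast
  have inj: "z \<otimes> u = \<zero>" if "u \<in> carrier A" "z \<otimes> z \<otimes> u = \<zero>" for u
  proof -
    have "N (k + k) = N k"
      using N_stable[of "Suc n"] N_stable[of "Suc n + k"] unfolding k_def by (simp add: ac_simps)
    then show ?thesis using that unfolding zz unfolding z_def N_def by blast
  qed
  let ?f = "z \<otimes> c"
  have f: "?f \<in> carrier A" using z c by simp
  have zf: "z \<otimes> ?f = z" using z c by (simp add: A.m_assoc)
  have y_pow: "z = y \<otimes> y [^] (n + m)"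
    unfolding z_def k_def using y by (simp add: A.nat_pow_Suc2[symmetric])
  have pow_y: "z = y [^] (n + m) \<otimes> y"
    unfolding z_def k_def by simp
  show ?thesis
  proof (rule that[of ?f "y [^] (n + m) \<otimes> c"])
    show "?f \<noteq> \<zero>"
      using zf z nn[of k] z_def by auto
    have "z \<otimes> z \<otimes> (c \<otimes> ?f \<ominus> c) = z \<otimes> (z \<otimes> c) \<otimes> ?f \<ominus> z \<otimes> (z \<otimes> c)"
      using z c(1) by (simp add: A.m_assoc a_minus_def A.r_distr A.r_minus)
    also have "\<dots> = \<zero>" unfolding zf using z f by (simp add: a_minus_def A.r_neg)
    finally have "z \<otimes> (c \<otimes> ?f \<ominus> c) = \<zero>"
      using z c(1) f by (intro inj) auto
    then have "?f \<otimes> ?f \<ominus> ?f = \<zero>"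
      using z c(1) by (simp add: A.m_assoc a_minus_def A.r_distr A.r_minus)
    then show "?f \<otimes> ?f = ?f" using f by simp
    show "?f = y \<otimes> (y [^] (n + m) \<otimes> c)"
      using y_pow y c(1) by (simp add: A.m_assoc[symmetric])
    \<comment> \<open>Here \<open>?f \<otimes> x = z \<otimes> (c \<otimes> x)\<close>, and \<open>z
      \<otimes> z \<otimes> c \<otimes> x = z \<otimes> x = \<zero>\<close>, so \<open>inj\<close>
      applies. In \<open>idempotent_ideal_generator\<close> this makes \<open>f\<close> annihilate
      \<open>e\<close>.\<close>
    fix x assume x: "x \<in> carrier A" "y \<otimes> x = \<zero>"
    have "z \<otimes> x = \<zero>" using pow_y x y by (simp add: A.m_assoc)
    moreover have "z \<otimes> z \<otimes> (c \<otimes> x) = z \<otimes> z \<otimes> c \<otimes> x" using z c(1) x(1) by (simp add: A.m_assoc)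
    ultimately have "z \<otimes> (c \<otimes> x) = \<zero>" using c x(1) by (intro inj) auto
    then show "?f \<otimes> x = \<zero>" using z c(1) x(1) by (simp add: A.m_assoc)
  qed (use z c y f in auto)
qed

lemma nat_pow_congruent:
  assumes "ideal J A" and x: "x \<in> carrier A" "y \<in> carrier A" "x \<ominus> y \<in> J"
  shows "x [^] (n::nat) \<ominus> y [^] n \<in> J"
proof -
  interpret J: ideal J A by fact
  show ?thesis
  proof (induction n)
    case 0
    then show ?case using J.zero_closed by (simp add: a_minus_def A.r_neg)
  next
    case (Suc n)
    have "x [^] Suc n \<ominus> y [^] Suc n = x [^] n \<otimes> (x \<ominus> y) \<oplus> (x [^] n \<ominus> y [^] n) \<otimes> y"
      using x(1,2) by (simp add: a_minus_def A.r_distr A.l_distr A.r_minus A.l_minus A.a_assoc A.r_neg1)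
    then show ?case
      using Suc x J.I_l_closed[of "x \<ominus> y" "x [^] n"] J.I_r_closed[of "x [^] n \<ominus> y [^] n" y] by simp
  qed
qed

text \<open>Idempotency of \<open>I\<close> is expressed by: every subspace containing all products of two elements
  of \<open>I\<close> contains \<open>I\<close>.  The proof is Brauer's: a subspace \<open>R\<close> minimal with \<open>R = R I + J\<close>
  and not inside \<open>J\<close> is of the form \<open>r I + J\<close> with \<open>r \<in> R\<close>, so \<open>r \<equiv> r x\<close> for some \<open>x \<in> I\<close>.\<close>

lemma idempotent_ideal_nil_subset:
  assumes I: "ideal I A" and J: "ideal J A"
    and idem: "\<And>T. \<lbrakk>submodule K T A; \<And>x y. \<lbrakk>x \<in> I; y \<in> I\<rbrakk> \<Longrightarrow> x \<otimes> y \<in> T\<rbrakk> \<Longrightarrow> I \<subseteq> T"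
    and nil: "\<And>x. x \<in> I \<Longrightarrow> \<exists>n::nat. x [^] n \<in> J"
  shows "I \<subseteq> J"
proof (rule ccontr)
  assume not: "\<not> I \<subseteq> J"
  interpret I: ideal I A by fact
  interpret L: ideal "J \<inter> I" A by (rule A.i_intersect[OF J I])
  \<comment> \<open>With \<open>J\<close> cut down to \<open>I\<close>, every subspace considered
    below lies between \<open>?L\<close> and \<open>I\<close>.\<close>
  let ?L = "J \<inter> I"
  have sub: "submodule K I A" "submodule K ?L A"
    using I L.ideal_axioms by (auto intro: ideal_submodule)
  interpret Is: submodule K I A by (rule sub)
  interpret Ls: submodule K ?L A by (rule sub)
  have Ic: "x \<in> carrier A" if "x \<in> I" for x using that Is.subset by blast
  \<comment> \<open>The last clause is the inclusion of R in R I + ?L, phrased through the subspaces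
    containing both summands.\<close>
  define P where "P R \<longleftrightarrow> ?L \<subseteq> R \<and> R \<subseteq> I \<and> \<not> R \<subseteq> ?L \<and> (\<forall>r\<in>R. \<forall>x\<in>I. r \<otimes> x \<in> R) \<and>
    (\<forall>T. submodule K T A \<longrightarrow> ?L \<subseteq> T \<longrightarrow> (\<forall>r\<in>R. \<forall>x\<in>I. r \<otimes> x \<in> T) \<longrightarrow> R \<subseteq> T)" for R
  have "P I"
    unfolding P_def
  proof (intro conjI ballI allI impI)
    fix T assume "submodule K T A" "\<forall>r\<in>I. \<forall>x\<in>I. r \<otimes> x \<in> T"
    then show "I \<subseteq> T" by (intro idem) auto
  qed (use not Ic I.I_l_closed in auto)
  then obtain R where R: "submodule K R A" "P R"
    and min: "\<And>W. \<lbrakk>submodule K W A; P W; W \<subseteq> R\<rbrakk> \<Longrightarrow> W = R"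
    by (rule minimal_submodule[OF finite_dimensional sub(1), of P]) blast
  interpret R: submodule K R A by (rule R(1))
  have R_sub: "?L \<subseteq> R" "R \<subseteq> I" "\<not> R \<subseteq> ?L" and R_mult: "\<And>r x. \<lbrakk>r \<in> R; x \<in> I\<rbrakk> \<Longrightarrow> r \<otimes> x \<in> R"
    and R_min: "\<And>T. \<lbrakk>submodule K T A; ?L \<subseteq> T; \<And>r x. \<lbrakk>r \<in> R; x \<in> I\<rbrakk> \<Longrightarrow> r \<otimes> x \<in> T\<rbrakk> \<Longrightarrow> R \<subseteq> T"
    using R(2)[unfolded P_def] by (elim conjE; simp)+
  \<comment> \<open>Otherwise all products of \<open>R\<close> with \<open>I\<close> lie in
    \<open>?L\<close>, and the last clause of \<open>P\<close> with \<open>?L\<close> as the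
    subspace puts \<open>R\<close> inside \<open>?L\<close>.\<close>
  obtain r x0 where r: "r \<in> R" "x0 \<in> I" "r \<otimes> x0 \<notin> ?L"
    using R_min[OF sub(2)] R_sub by blast
  have rc: "r \<in> carrier A" using r R.subset by blast
  let ?W = "{r \<otimes> x \<oplus> j |x j. x \<in> I \<and> j \<in> ?L}"
  have Lc: "j \<in> carrier A" if "j \<in> ?L" for j using that Ls.subset by blast
  have W: "submodule K ?W A"
  proof unfold_locales
    show "?W \<subseteq> carrier A" using rc Ic Lc by auto
    have "\<zero> = r \<otimes> \<zero> \<oplus> \<zero>" using rc by simp
    then show "\<zero> \<in> ?W" using Is.zero_closed Ls.zero_closed by blast
  next
    fix u v assume "u \<in> ?W" "v \<in> ?W"
    then obtain x j x' j' where uv: "u = r \<otimes> x \<oplus> j" "v = r \<otimes> x' \<oplus> j'" "x \<in> I" "x' \<in> I" "j \<in> ?L" "j' \<in> ?L"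
      by blast
    then have "u \<oplus> v = r \<otimes> (x \<oplus> x') \<oplus> (j \<oplus> j')"
      using rc Ic Lc by (simp add: A.r_distr A.a_ac)
    then show "u \<oplus> v \<in> ?W" using uv Is.m_closed Ls.m_closed by blast
  next
    fix k u assume k: "k \<in> carrier K" "u \<in> ?W"
    then obtain x j where u: "u = r \<otimes> x \<oplus> j" "x \<in> I" "j \<in> ?L" by blast
    then have "k \<odot> u = r \<otimes> (k \<odot> x) \<oplus> k \<odot> j"
      using rc Ic Lc k by (simp add: smult_r_distr smult_mult_right)
    then show "k \<odot> u \<in> ?W" using u k Is.smult_closed Ls.smult_closed by blast
  qed
  have W_mult: "r \<otimes> x \<in> ?W" if "x \<in> I" for x
  proof -
    have "r \<otimes> x = r \<otimes> x \<oplus> \<zero>" using that rc Ic by simp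
    then show ?thesis using that Ls.zero_closed by blast
  qed
  have "P ?W"
    unfolding P_def
  proof (intro conjI ballI allI impI)
    show "?L \<subseteq> ?W"
    proof
      fix j assume j: "j \<in> ?L"
      then have "j = r \<otimes> \<zero> \<oplus> j" using rc Lc by simp
      then show "j \<in> ?W" using j Is.zero_closed by blast
    qed
    show "?W \<subseteq> I" using R_mult r(1) R_sub(2) by auto
    show "\<not> ?W \<subseteq> ?L" using W_mult[OF r(2)] r(3) by blast
  next
    fix u y assume u: "u \<in> ?W" "y \<in> I"
    then obtain x j where uj: "u = r \<otimes> x \<oplus> j" "x \<in> I" "j \<in> ?L" by blast
    then have "u \<otimes> y = r \<otimes> (x \<otimes> y) \<oplus> j \<otimes> y"
      using rc Ic Lc u(2) by (simp add: A.l_distr A.m_assoc)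
    then show "u \<otimes> y \<in> ?W"
      using uj u(2) Ic I.I_r_closed L.I_r_closed by blast
  next
    fix T assume T: "submodule K T A" "?L \<subseteq> T" "\<forall>u\<in>?W. \<forall>x\<in>I. u \<otimes> x \<in> T"
    interpret T: submodule K T A by (rule T)
    \<comment> \<open>The elements \<open>x\<close> with \<open>r \<otimes> x \<in> T\<close> form a
      subspace containing all products of two elements of \<open>I\<close>; idempotency puts
      \<open>I\<close> into it.\<close>
    have "submodule K {x \<in> carrier A. r \<otimes> x \<in> T} A"
      using rc by unfold_locales (auto simp: A.r_distr smult_mult_right)
    moreover have "x \<otimes> y \<in> {x \<in> carrier A. r \<otimes> x \<in> T}" if "x \<in> I" "y \<in> I" for x y
      using T(3)[rule_format, OF W_mult[OF that(1)] that(2)] that Ic rc by (simp add: A.m_assoc)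
    ultimately have "I \<subseteq> {x \<in> carrier A. r \<otimes> x \<in> T}" by (rule idem)
    then show "?W \<subseteq> T" using T(2) by auto
  qed
  moreover have "?W \<subseteq> R" using R_mult[OF r(1)] R_sub(1) by auto
  ultimately have "r \<in> ?W" using min[OF W] r(1) by blast
  then obtain x j where x: "r = r \<otimes> x \<oplus> j" "x \<in> I" "j \<in> ?L" by auto
  have xc: "x \<in> carrier A" using x Ic by blast
  have rx: "r \<ominus> r \<otimes> x \<in> ?L"
  proof -
    have "(r \<otimes> x \<oplus> j) \<ominus> r \<otimes> x = j"
      using rc xc Lc[OF x(3)]
      by (simp add: a_minus_def A.a_assoc A.a_comm[of j "\<ominus> (r \<otimes> x)"] A.r_neg2)
    then have "r \<ominus> r \<otimes> x = j" using x(1) by simp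
    then show ?thesis using x by simp
  qed
  \<comment> \<open>Iterating r = r x modulo \<open>?L\<close>. When a power of \<open>x\<close>
    lies in \<open>J\<close>, the product of \<open>r\<close> with it lies in \<open>?L\<close>;
    hence \<open>r\<close> does, contradicting the choice of \<open>r\<close> and
    \<open>x0\<close>.\<close>
  have step: "r \<ominus> r \<otimes> x [^] n \<in> ?L" for n :: nat
  proof (induction n)
    case 0
    then show ?case using rc Ls.zero_closed by (simp add: a_minus_def A.r_neg)
  next
    case (Suc n)
    have "r \<ominus> r \<otimes> x [^] Suc n = (r \<ominus> r \<otimes> x [^] n) \<otimes> x \<oplus> (r \<ominus> r \<otimes> x)"
      using rc xc by (simp add: a_minus_def A.l_distr A.l_minus A.m_assoc A.a_ac A.r_neg1 A.r_neg2)
    then show ?case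
      using L.I_r_closed[OF Suc xc] rx Ls.m_closed by simp
  qed
  obtain n :: nat where n: "x [^] n \<in> J" using nil x(2) by blast
  interpret J: ideal J A by (rule J)
  have "r \<otimes> x [^] n \<in> J" using J.I_l_closed[OF n rc] .
  moreover have "r \<otimes> x [^] n \<in> I" using I.I_r_closed[of r "x [^] n"] r(1) R_sub(2) xc by blast
  ultimately have "(r \<ominus> r \<otimes> x [^] n) \<oplus> r \<otimes> x [^] n \<in> ?L" using step[of n] Ls.m_closed by blast
  then have "r \<in> ?L" using rc xc by (simp add: a_minus_def A.a_assoc A.l_neg)
  then show False using L.I_r_closed[of r x0] r Ic by blast
qed

text \<open>Among the idempotents of \<open>I\<close> one with e A maximal is taken. If some (1 - e)
  x (1 - e) with x in \<open>I\<close> were not nilpotent, Fitting's lemma would supply an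
  idempotent to enlarge \<open>e\<close>. So \<open>I\<close> is nil modulo every ideal containing
  \<open>e\<close>, and \<open>idempotent_ideal_nil_subset\<close> applies. The last conclusion
  stands for I = A e A.\<close>

lemma idempotent_ideal_generator:
  assumes I: "ideal I A"
    and idem: "\<And>T. \<lbrakk>submodule K T A; \<And>x y. \<lbrakk>x \<in> I; y \<in> I\<rbrakk> \<Longrightarrow> x \<otimes> y \<in> T\<rbrakk> \<Longrightarrow> I \<subseteq> T"
  obtains e where "e \<in> I" "e \<otimes> e = e" "\<And>J. \<lbrakk>ideal J A; e \<in> J\<rbrakk> \<Longrightarrow> I \<subseteq> J"
proof -
  interpret I: ideal I A by fact
  interpret Is: submodule K I A by (rule ideal_submodule[OF I])
  have Ic: "x \<in> carrier A" if "x \<in> I" for x using that Is.subset by blast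
  define R where "R e = (\<otimes>) e ` carrier A" for e
  define E where "E = {R e |e. e \<in> I \<and> e \<otimes> e = e}"
  have R: "submodule K (R e) A" if "e \<in> carrier A" for e
    unfolding R_def by (rule right_mult_submodule[OF that carrier_submodule])
  have "R \<zero> \<in> E" unfolding E_def by (intro CollectI exI[of _ \<zero>]) simp
  then obtain H where H: "H \<in> E" and max: "\<And>W. \<lbrakk>submodule K W A; W \<in> E; H \<subseteq> W\<rbrakk> \<Longrightarrow> W = H"
    by (rule maximal_submodule[OF finite_dimensional R[OF A.zero_closed], of "\<lambda>U. U \<in> E"]) auto
  obtain e where e: "e \<in> I" "e \<otimes> e = e" "H = R e" using H unfolding E_def by blast
  have ec [simp]: "e \<in> carrier A" using e Ic by blast
  have ee: "e \<otimes> (e \<otimes> x) = e \<otimes> x" if "x \<in> carrier A" for x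
    using that e(2) by (simp add: A.m_assoc[symmetric])
  \<comment> \<open>The Peirce component (1 - e) x (1 - e), expanded; it is annihilated by
    \<open>e\<close> on both sides.\<close>
  define y where "y x = x \<ominus> e \<otimes> x \<ominus> (x \<otimes> e \<ominus> e \<otimes> x \<otimes> e)" for x
  have yc: "y x \<in> carrier A" if "x \<in> carrier A" for x using that by (simp add: y_def)
  have ey: "e \<otimes> y x = \<zero>" if "x \<in> carrier A" for x
    using that by (simp add: y_def a_minus_def A.r_distr A.r_minus A.m_assoc ee A.r_neg)
  have ye: "y x \<otimes> e = \<zero>" if "x \<in> carrier A" for x
    using that by (simp add: y_def a_minus_def A.l_distr A.l_minus A.m_assoc e(2) A.r_neg)
  have yI: "y x \<in> I" if "x \<in> I" for x
    unfolding y_def a_minus_def using that Ic e(1)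
    by (auto intro!: I.a_closed I.a_inv_closed I.I_l_closed I.I_r_closed)
  have nil: "\<exists>n::nat. y x [^] n = \<zero>" if x: "x \<in> I" for x
  proof (rule ccontr)
    assume "\<not> ?thesis"
    then have nn: "\<And>n::nat. y x [^] n \<noteq> \<zero>" by blast
    have xc: "x \<in> carrier A" using x Ic by blast
    obtain f c where f: "f \<in> carrier A" "f \<noteq> \<zero>" "f \<otimes> f = f" "c \<in> carrier A" "f = y x \<otimes> c"
      "\<And>u. \<lbrakk>u \<in> carrier A; y x \<otimes> u = \<zero>\<rbrakk> \<Longrightarrow> f \<otimes> u = \<zero>"
      using non_nilpotent_idempotent[OF yc[OF xc] nn] by blast
    have fe: "f \<otimes> e = \<zero>" using f(6) ye[OF xc] by simp
    have ef: "e \<otimes> f = \<zero>" using f(4,5) yc[OF xc] ey[OF xc] by (simp add: A.m_assoc[symmetric])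
    have fI: "f \<in> I" using f(4,5) yI[OF x] I.I_r_closed by blast
    \<comment> \<open>\<open>f\<close> is orthogonal to \<open>e\<close> on both sides, so
      \<open>?g\<close> is an idempotent of \<open>I\<close> whose right ideal contains e A.
      Maximality puts \<open>f\<close> into e A, so \<open>e \<otimes> f = f\<close>, against
      \<open>e \<otimes> f = \<zero>\<close>.\<close>
    let ?g = "e \<oplus> f"
    have g: "?g \<in> I" "?g \<otimes> ?g = ?g"
      using e fI f ef fe by (auto simp: A.l_distr A.r_distr)
    have gc: "?g \<in> carrier A" using f(1) by simp
    have "H \<subseteq> R ?g"
    proof
      fix u assume "u \<in> H"
      then obtain c where c: "c \<in> carrier A" "u = e \<otimes> c" using e(3) unfolding R_def by blast
      have "?g \<otimes> (e \<otimes> c) = e \<otimes> c"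
        using c(1) f(1) A.m_assoc[of f e c] fe by (simp add: A.l_distr ee)
      then have "u = ?g \<otimes> (e \<otimes> c)" using c by simp
      then show "u \<in> R ?g" unfolding R_def by (rule image_eqI) (use c in simp)
    qed
    then have "R ?g = H"
      using max[OF R[OF gc]] g unfolding E_def by blast
    moreover have "f = ?g \<otimes> f" using f(1,3) ef by (simp add: A.l_distr)
    ultimately have "f \<in> R e" using f(1) e(3) unfolding R_def by blast
    then obtain c' where c': "c' \<in> carrier A" "f = e \<otimes> c'" unfolding R_def by blast
    then have "e \<otimes> f = f" using ee by simp
    then show False using ef f(2) by simp
  qed
  show ?thesis
  proof (rule that[OF e(1,2)])
    fix J assume J: "ideal J A" "e \<in> J"
    interpret J: ideal J A by fact
    have "\<exists>n::nat. x [^] n \<in> J" if x: "x \<in> I" for x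
    proof -
      have xc: "x \<in> carrier A" using x Ic by blast
      \<comment> \<open>Modulo \<open>J\<close> the element \<open>x\<close> equals its nilpotent
        Peirce component, because every other term has a factor \<open>e\<close>.\<close>
      have "x \<ominus> y x = e \<otimes> x \<oplus> (x \<otimes> e \<ominus> e \<otimes> x \<otimes> e)"
        using xc by (simp add: y_def a_minus_def A.minus_add A.a_assoc[symmetric] A.r_neg)
      also have "\<dots> \<in> J"
        unfolding a_minus_def using xc J(2)
        by (intro J.a_closed J.a_inv_closed J.I_r_closed[of e] J.I_l_closed[of e] J.I_r_closed[of "e \<otimes> x"]) auto
      finally have "x [^] n \<ominus> y x [^] n \<in> J" for n :: nat
        using nat_pow_congruent[OF J(1) xc yc[OF xc]] by blast
      moreover obtain n :: nat where "y x [^] n = \<zero>" using nil[OF x] by blast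
      ultimately have "x [^] n \<ominus> \<zero> \<in> J" by metis
      then show ?thesis using xc by (auto simp: a_minus_def)
    qed
    then show "I \<subseteq> J"
      using idempotent_ideal_nil_subset[OF I J(1) idem] by blast
  qed
qed

end

section \<open>Homomorphisms of bimodules\<close>

lemma bimod_homI:
  assumes "\<And>x. x \<in> carrier M \<Longrightarrow> f x \<in> carrier N"
    "\<And>x y. \<lbrakk>x \<in> carrier M; y \<in> carrier M\<rbrakk> \<Longrightarrow> f (x \<oplus>\<^bsub>M\<^esub> y) = f x \<oplus>\<^bsub>N\<^esub> f y"
    "\<And>k x. \<lbrakk>k \<in> carrier K; x \<in> carrier M\<rbrakk> \<Longrightarrow> f (k \<odot>\<^bsub>M\<^esub> x) = k \<odot>\<^bsub>N\<^esub> f x"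
    "\<And>x a. \<lbrakk>x \<in> carrier M; a \<in> carrier A\<rbrakk> \<Longrightarrow> f (x \<triangleleft>\<^bsub>M\<^esub> a) = f x \<triangleleft>\<^bsub>N\<^esub> a"
    "\<And>x a. \<lbrakk>x \<in> carrier M; a \<in> carrier A\<rbrakk> \<Longrightarrow> f (a \<triangleright>\<^bsub>M\<^esub> x) = a \<triangleright>\<^bsub>N\<^esub> f x"
  shows "f \<in> bimod_hom K A M N"
  using assms by (auto simp: bimod_hom_def rmod_hom_def module_hom_def)

lemma bimod_homD:
  assumes "f \<in> bimod_hom K A M N"
  shows "x \<in> carrier M \<Longrightarrow> f x \<in> carrier N"
    and "\<lbrakk>x \<in> carrier M; y \<in> carrier M\<rbrakk> \<Longrightarrow> f (x \<oplus>\<^bsub>M\<^esub> y) = f x \<oplus>\<^bsub>N\<^esub> f y"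
    and "\<lbrakk>k \<in> carrier K; x \<in> carrier M\<rbrakk> \<Longrightarrow> f (k \<odot>\<^bsub>M\<^esub> x) = k \<odot>\<^bsub>N\<^esub> f x"
    and "\<lbrakk>x \<in> carrier M; a \<in> carrier A\<rbrakk> \<Longrightarrow> f (x \<triangleleft>\<^bsub>M\<^esub> a) = f x \<triangleleft>\<^bsub>N\<^esub> a"
    and "\<lbrakk>x \<in> carrier M; a \<in> carrier A\<rbrakk> \<Longrightarrow> f (a \<triangleright>\<^bsub>M\<^esub> x) = a \<triangleright>\<^bsub>N\<^esub> f x"
  using assms by (auto simp: bimod_hom_def rmod_hom_def module_hom_def)

lemma bimod_hom_id: "(\<lambda>x. x) \<in> bimod_hom K A M M"
  by (rule bimod_homI) auto

locale tensor_hom = X: bimodule_pair K A X Y + X': bimodule_pair K A X' Y'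
  for K :: "('k, 'c) ring_scheme" and A :: "('k, 'a, 'e) module_scheme"
    and X :: "('k, 'a, 'x, 'u) bimod_scheme" and Y :: "('k, 'a, 'y, 'v) bimod_scheme"
    and X' :: "('k, 'a, 'x1, 'u1) bimod_scheme" and Y' :: "('k, 'a, 'y1, 'v1) bimod_scheme" +
  fixes f g
  assumes f: "f \<in> bimod_hom K A X X'" and g: "g \<in> bimod_hom K A Y Y'"
begin

sublocale balanced_map K A X Y X'.T "\<lambda>x y. X'.pt (f x) (g y)"
proof -
  interpret T': abelian_group X'.T by (rule X'.tensor_abelian_group)
  show "balanced_map K A X Y X'.T (\<lambda>x y. X'.pt (f x) (g y))"
    by unfold_locales (simp_all add: X'.pure_closed bimod_homD[OF f] bimod_homD[OF g]
        X'.pure_add_left X'.pure_add_right X'.pure_balanced)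
qed

lemma tensor_map_eq: "tensor_map A X' Y' f g = lift"
  unfolding lift_def tensor_map_def tensor_group_eq ..

lemma tensor_map_pure:
  "\<lbrakk>x \<in> carrier X; y \<in> carrier Y\<rbrakk> \<Longrightarrow> tensor_map A X' Y' f g (X.pt x y) = X'.pt (f x) (g y)"
  unfolding tensor_map_eq by (rule lift_pure)

lemma tensor_map_add:
  "\<lbrakk>s \<in> carrier X.T; t \<in> carrier X.T\<rbrakk> \<Longrightarrow>
    tensor_map A X' Y' f g (s \<oplus>\<^bsub>X.T\<^esub> t) = tensor_map A X' Y' f g s \<oplus>\<^bsub>X'.T\<^esub> tensor_map A X' Y' f g t"
  unfolding tensor_map_eq by (rule lift_add)

lemma tensor_map_closed: "t \<in> carrier X.T \<Longrightarrow> tensor_map A X' Y' f g t \<in> carrier X'.T"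
  unfolding tensor_map_eq by (rule lift_closed)

end

context fd_alg
begin

lemma regular_simps:
  "carrier (regular_bimod A) = carrier A" "\<zero>\<^bsub>regular_bimod A\<^esub> = \<zero>"
  "x \<oplus>\<^bsub>regular_bimod A\<^esub> y = x \<oplus> y" "k \<odot>\<^bsub>regular_bimod A\<^esub> x = k \<odot> x"
  "x \<triangleleft>\<^bsub>regular_bimod A\<^esub> a = x \<otimes> a" "a \<triangleright>\<^bsub>regular_bimod A\<^esub> x = a \<otimes> x"
  by (simp_all add: regular_bimod_def)

lemma regular_bimodule: "bimodule K A (regular_bimod A)"
proof -
  have "vectorspace K (regular_bimod A)"
    by (rule vectorspace_image(1)[where h = "\<lambda>x. x", OF vectorspace_axioms]) (simp_all add: regular_simps)
  then show ?thesis
    using fd_algebra_axioms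
    by (auto simp: bimodule_def bimodule_axioms_def right_module_def right_module_axioms_def
        regular_simps A.l_distr A.r_distr A.m_assoc smult_mult_left smult_mult_right)
qed

sublocale W: bimodule K A "dual_bimod K A"
  by (rule dual_bimodule[OF fd_algebra_axioms])

sublocale R: bimodule K A "regular_bimod A"
  by (rule regular_bimodule)

sublocale WW: bimodule_pair K A "dual_bimod K A" "dual_bimod K A" ..

sublocale WR: bimodule_pair K A "dual_bimod K A" "regular_bimod A" ..

sublocale RW: bimodule_pair K A "regular_bimod A" "dual_bimod K A" ..

lemma dual_act_apply:
  "x \<in> carrier A \<Longrightarrow> (f \<triangleleft>\<^bsub>\<D>\<^esub> a) x = f (a \<otimes> x)"
  "x \<in> carrier A \<Longrightarrow> (a \<triangleright>\<^bsub>\<D>\<^esub> f) x = f (x \<otimes> a)"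
  "x \<in> carrier A \<Longrightarrow> (f \<oplus>\<^bsub>\<D>\<^esub> g) x = f x \<oplus>\<^bsub>K\<^esub> g x"
  "x \<in> carrier A \<Longrightarrow> (k \<odot>\<^bsub>\<D>\<^esub> f) x = k \<otimes>\<^bsub>K\<^esub> f x"
  by (simp_all add: dual_bimod_def)

end

section \<open>From bocses to gendo-symmetric algebras\<close>

locale dual_bocs = fd_alg K A + bocs: bocs K A "dual_bimod K A" \<mu> \<epsilon>
  for K :: "('k, 'c) ring_scheme" and A :: "('k, 'a, 'e) module_scheme" (structure) and \<mu> \<epsilon>
begin

lemma counit_closed: "w \<in> dual \<Longrightarrow> \<epsilon> w \<in> carrier A"
  and counit_add: "\<lbrakk>v \<in> dual; w \<in> dual\<rbrakk> \<Longrightarrow> \<epsilon> (v \<oplus>\<^bsub>\<D>\<^esub> w) = \<epsilon> v \<oplus> \<epsilon> w"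
  and counit_smult: "\<lbrakk>k \<in> carrier K; w \<in> dual\<rbrakk> \<Longrightarrow> \<epsilon> (k \<odot>\<^bsub>\<D>\<^esub> w) = k \<odot> \<epsilon> w"
  and counit_ract: "\<lbrakk>w \<in> dual; a \<in> carrier A\<rbrakk> \<Longrightarrow> \<epsilon> (w \<triangleleft>\<^bsub>\<D>\<^esub> a) = \<epsilon> w \<otimes> a"
  and counit_lact: "\<lbrakk>w \<in> dual; a \<in> carrier A\<rbrakk> \<Longrightarrow> \<epsilon> (a \<triangleright>\<^bsub>\<D>\<^esub> w) = a \<otimes> \<epsilon> w"
  using bimod_homD[OF bocs.counit_hom] by (simp_all add: regular_simps)

lemma counit_zero: "\<epsilon> \<zero>\<^bsub>\<D>\<^esub> = \<zero>"
  using counit_add[of "\<zero>\<^bsub>\<D>\<^esub>" "\<zero>\<^bsub>\<D>\<^esub>"] counit_closed[of "\<zero>\<^bsub>\<D>\<^esub>"]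
  by simp

lemmas counit_simps = counit_closed counit_add counit_smult counit_ract counit_lact

lemmas comult_closed = bimod_homD(1)[OF bocs.comult_hom]
  and comult_add = bimod_homD(2)[OF bocs.comult_hom]
  and comult_smult = bimod_homD(3)[OF bocs.comult_hom]
  and comult_ract = bimod_homD(4)[OF bocs.comult_hom]

sublocale mr: balanced_map K A \<D> \<D> \<D>
  "\<lambda>u v. u \<triangleleft>\<^bsub>\<D>\<^esub> \<epsilon> v"
  by unfold_locales (simp_all add: counit_simps W.ract_closed W.ract_add_left W.ract_add_right W.ract_mult)

sublocale ml: balanced_map K A \<D> \<D> \<D>
  "\<lambda>u v. \<epsilon> u \<triangleright>\<^bsub>\<D>\<^esub> v"
  by unfold_locales (simp_all add: counit_simps W.lact_closed W.lact_add_left W.lact_add_right W.lact_mult)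

text \<open>The right counit law after the identification of D(A) \<otimes> A with D(A) by the right
  action, under which w \<otimes> 1 becomes w. The left law is read in the same way in
  \<open>ml_comult\<close>.\<close>

lemma mr_comult:
  assumes w: "w \<in> dual"
  shows "mr.lift (\<mu> w) = w"
proof -
  interpret m: tensor_hom K A \<D> \<D> \<D> "regular_bimod A" "\<lambda>x. x" \<epsilon>
    by unfold_locales (auto intro: bimod_hom_id bocs.counit_hom)
  interpret c: balanced_map K A \<D> "regular_bimod A" \<D>
    "\<lambda>u a. u \<triangleleft>\<^bsub>\<D>\<^esub> a"
    by unfold_locales (simp_all add: regular_simps W.ract_closed W.ract_add_left W.ract_add_right W.ract_mult)
  have "c.lift (tensor_map A \<D> (regular_bimod A) (\<lambda>x. x) \<epsilon> t) = mr.lift t"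
    if "t \<in> carrier WW.T" for t
    using that by (induction t rule: WW.tensor_induct)
      (simp_all add: m.tensor_map_pure m.tensor_map_add m.tensor_map_closed c.lift_pure c.lift_add
        mr.lift_pure mr.lift_add regular_simps counit_closed)
  from this[OF comult_closed[OF w]] show ?thesis
    using w by (simp add: bocs.counit_right c.lift_pure regular_simps W.ract_one)
qed

lemma ml_comult:
  assumes w: "w \<in> dual"
  shows "ml.lift (\<mu> w) = w"
proof -
  interpret m: tensor_hom K A \<D> \<D> "regular_bimod A" \<D> \<epsilon> "\<lambda>x. x"
    by unfold_locales (auto intro: bimod_hom_id bocs.counit_hom)
  interpret c: balanced_map K A "regular_bimod A" \<D> \<D>
    "\<lambda>a u. a \<triangleright>\<^bsub>\<D>\<^esub> u"
    by unfold_locales (simp_all add: regular_simps W.lact_closed W.lact_add_left W.lact_add_right W.lact_mult)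
  have "c.lift (tensor_map A (regular_bimod A) (dual_bimod K A) \<epsilon> (\<lambda>x. x) t) = ml.lift t"
    if "t \<in> carrier WW.T" for t
    using that by (induction t rule: WW.tensor_induct)
      (simp_all add: m.tensor_map_pure m.tensor_map_add m.tensor_map_closed c.lift_pure c.lift_add
        ml.lift_pure ml.lift_add regular_simps counit_closed)
  from this[OF comult_closed[OF w]] show ?thesis
    using w by (simp add: bocs.counit_left c.lift_pure regular_simps W.lact_one)
qed

text \<open>Every right linear \<open>\<theta> : D(A) \<rightarrow> A\<close> is \<open>\<epsilon>\<close> composed with a right linear endomorphism of
  \<open>D(A)\<close>, namely \<open>w \<mapsto> \<Sum> \<theta>(w\<^sub>1) w\<^sub>2\<close>, and these endomorphisms are the left multiplications.\<close>

lemma right_linear_into_regular: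
  assumes \<theta>: "\<And>w. w \<in> dual \<Longrightarrow> \<theta> w \<in> carrier A"
    "\<And>v w. \<lbrakk>v \<in> dual; w \<in> dual\<rbrakk> \<Longrightarrow> \<theta> (v \<oplus>\<^bsub>\<D>\<^esub> w) = \<theta> v \<oplus> \<theta> w"
    "\<And>w a. \<lbrakk>w \<in> dual; a \<in> carrier A\<rbrakk> \<Longrightarrow> \<theta> (w \<triangleleft>\<^bsub>\<D>\<^esub> a) = \<theta> w \<otimes> a"
  obtains a where "a \<in> carrier A" "\<And>w. w \<in> dual \<Longrightarrow> \<theta> w = a \<otimes> \<epsilon> w"
proof -
  interpret L: balanced_map K A \<D> \<D> \<D>
    "\<lambda>u v. \<theta> u \<triangleright>\<^bsub>\<D>\<^esub> v"
    by unfold_locales (simp_all add: \<theta> W.lact_closed W.lact_add_left W.lact_add_right W.lact_mult)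
  \<comment> \<open>On a pure tensor \<open>u\<close>, \<open>v\<close> both sides are
    \<open>\<theta> u \<otimes> \<epsilon> v\<close>: one by left linearity of
    \<open>\<epsilon>\<close>, the other by right linearity of \<open>\<theta>\<close>.\<close>
  have \<epsilon>L: "\<epsilon> (L.lift t) = \<theta> (mr.lift t)" if "t \<in> carrier WW.T" for t
    using that by (induction t rule: WW.tensor_induct)
      (simp_all add: L.lift_pure L.lift_add L.lift_closed mr.lift_pure mr.lift_add mr.lift_closed
        counit_simps \<theta>)
  have ract: "L.lift (t \<triangleleft>\<^bsub>WW.T\<^esub> a) = L.lift t \<triangleleft>\<^bsub>\<D>\<^esub> a"
    if "t \<in> carrier WW.T" "a \<in> carrier A" for t a
    using that by (induction t rule: WW.tensor_induct)
      (simp_all add: L.lift_pure L.lift_add L.lift_closed WW.tensor_pures WW.tensor_adds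
        WW.tensor_closed \<theta> W.ract_closed W.lact_closed W.ract_add_left W.lact_ract)
  have smult: "L.lift (k \<odot>\<^bsub>WW.T\<^esub> t) = k \<odot>\<^bsub>\<D>\<^esub> L.lift t"
    if "t \<in> carrier WW.T" "k \<in> carrier K" for t k
    using that by (induction t rule: WW.tensor_induct)
      (simp_all add: L.lift_pure L.lift_add L.lift_closed WW.tensor_pures WW.tensor_adds
        WW.tensor_closed \<theta> WW.smult_pure_right W.lact_smult_right W.smult_r_distr)
  define S where "S w = L.lift (\<mu> w)" for w
  have S: "S w \<in> dual" if "w \<in> dual" for w
    unfolding S_def using that by (intro L.lift_closed comult_closed)
  have S_add: "S (v \<oplus>\<^bsub>\<D>\<^esub> w) = S v \<oplus>\<^bsub>\<D>\<^esub> S w" if "v \<in> dual" "w \<in> dual" for v w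
    unfolding S_def using that by (simp add: comult_add comult_closed L.lift_add)
  have S_smult: "S (k \<odot>\<^bsub>\<D>\<^esub> w) = k \<odot>\<^bsub>\<D>\<^esub> S w"
    if "k \<in> carrier K" "w \<in> dual" for k w
    unfolding S_def using that by (simp add: comult_smult comult_closed smult)
  have S_ract: "S (w \<triangleleft>\<^bsub>\<D>\<^esub> a) = S w \<triangleleft>\<^bsub>\<D>\<^esub> a" if "w \<in> dual" "a \<in> carrier A" for w a
    unfolding S_def using that by (simp add: comult_ract comult_closed ract)
  \<comment> \<open>\<open>S\<close> is recovered from its values at \<open>\<one>\<close> by right
    linearity, and these values form a functional on D(A), hence an evaluation at some
    \<open>a\<close>.\<close>
  obtain a where a: "a \<in> carrier A" "\<And>w. w \<in> dual \<Longrightarrow> S w \<one> = w a"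
  proof (rule dual_reflexive[OF finite_dimensional, of "\<lambda>w. S w \<one>"])
    show "\<And>f. f \<in> dual \<Longrightarrow> S f \<one> \<in> carrier K" using S dual_closed by blast
    show "\<And>f g. \<lbrakk>f \<in> dual; g \<in> dual\<rbrakk> \<Longrightarrow> S (f \<oplus>\<^bsub>\<D>\<^esub> g) \<one> = S f \<one> \<oplus>\<^bsub>K\<^esub> S g \<one>"
      by (simp add: S_add dual_act_apply)
    show "\<And>k f. \<lbrakk>k \<in> carrier K; f \<in> dual\<rbrakk> \<Longrightarrow> S (k \<odot>\<^bsub>\<D>\<^esub> f) \<one> = k \<otimes>\<^bsub>K\<^esub> S f \<one>"
      by (simp add: S_smult dual_act_apply)
  qed blast
  have S_eq: "S w = a \<triangleright>\<^bsub>\<D>\<^esub> w" if w: "w \<in> dual" for w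
  proof (rule dual_eqI)
    fix x assume x: "x \<in> carrier A"
    have "S w x = (S w \<triangleleft>\<^bsub>\<D>\<^esub> x) \<one>" using x by (simp add: dual_act_apply)
    also have "\<dots> = S (w \<triangleleft>\<^bsub>\<D>\<^esub> x) \<one>" using w x by (simp add: S_ract)
    also have "\<dots> = (w \<triangleleft>\<^bsub>\<D>\<^esub> x) a" using w x by (intro a W.ract_closed)
    also have "\<dots> = (a \<triangleright>\<^bsub>\<D>\<^esub> w) x" using x a by (simp add: dual_act_apply)
    finally show "S w x = (a \<triangleright>\<^bsub>\<D>\<^esub> w) x" .
  qed (use w S a in \<open>auto intro: W.lact_closed\<close>)
  show ?thesis
  proof (rule that[OF a(1)])
    fix w assume w: "w \<in> dual"
    have "\<theta> w = \<theta> (mr.lift (\<mu> w))" using w by (simp add: mr_comult)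
    also have "\<dots> = \<epsilon> (S w)" unfolding S_def using w by (simp add: \<epsilon>L comult_closed)
    finally show "\<theta> w = a \<otimes> \<epsilon> w" using w a by (simp add: S_eq counit_lact)
  qed
qed

lemma counit_faithful:
  assumes a: "a \<in> carrier A" and zero: "\<And>w. w \<in> dual \<Longrightarrow> a \<otimes> \<epsilon> w = \<zero>"
  shows "a = \<zero>"
proof (rule dual_separates_points[OF finite_dimensional a])
  fix w assume w: "w \<in> dual"
  have "ml.lift t a = \<zero>\<^bsub>K\<^esub>" if "t \<in> carrier WW.T" for t
    using that a by (induction t rule: WW.tensor_induct)
      (simp_all add: ml.lift_pure ml.lift_add dual_act_apply zero dual_zero)
  then show "w a = \<zero>\<^bsub>K\<^esub>"
    using ml_comult[OF w] comult_closed[OF w] by metis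
qed

lemma counit_ideal: "ideal (\<epsilon> ` dual) A"
proof (rule idealI)
  show "subgroup (\<epsilon> ` dual) (add_monoid A)"
  proof (rule A.add.subgroupI)
    show "\<epsilon> ` dual \<noteq> {}" using W.M.zero_closed by blast
    fix x assume "x \<in> \<epsilon> ` dual"
    then obtain w where w: "w \<in> dual" "x = \<epsilon> w" by blast
    have "\<ominus> x = \<epsilon> ((\<ominus>\<^bsub>K\<^esub> \<one>\<^bsub>K\<^esub>) \<odot>\<^bsub>\<D>\<^esub> w)"
      using w by (simp add: counit_smult counit_closed smult_minus_1)
    then show "\<ominus> x \<in> \<epsilon> ` dual"
      using w W.smult_closed by auto
  next
    fix x y assume "x \<in> \<epsilon> ` dual" "y \<in> \<epsilon> ` dual"
    then obtain v w where vw: "v \<in> dual" "x = \<epsilon> v" "w \<in> dual" "y = \<epsilon> w" by blast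
    then have "x \<oplus> y = \<epsilon> (v \<oplus>\<^bsub>\<D>\<^esub> w)" by (simp add: counit_add)
    then show "x \<oplus> y \<in> \<epsilon> ` dual"
      using vw W.M.a_closed by auto
  qed (auto simp: counit_closed)
next
  fix x a assume "x \<in> \<epsilon> ` dual" and a: "a \<in> carrier A"
  then obtain w where w: "w \<in> dual" "x = \<epsilon> w" by blast
  show "a \<otimes> x \<in> \<epsilon> ` dual"
    using w a counit_lact[OF w(1) a] W.lact_closed[OF a w(1)] by (metis imageI)
  show "x \<otimes> a \<in> \<epsilon> ` dual"
    using w a counit_ract[OF w(1) a] W.ract_closed[OF w(1) a] by (metis imageI)
qed (rule A.ring_axioms)

text \<open>Applying \<open>\<epsilon>\<close> to \<open>mr_comult\<close> turns \<epsilon>(w) into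
  a sum of products \<epsilon>(u) \<epsilon>(v).\<close>

lemma counit_idempotent:
  assumes "submodule K T A" "\<And>x y. \<lbrakk>x \<in> \<epsilon> ` dual; y \<in> \<epsilon> ` dual\<rbrakk> \<Longrightarrow> x \<otimes> y \<in> T"
  shows "\<epsilon> ` dual \<subseteq> T"
proof -
  interpret T: submodule K T A by fact
  have "\<epsilon> (mr.lift t) \<in> T" if "t \<in> carrier WW.T" for t
    using that by (induction t rule: WW.tensor_induct)
      (simp_all add: mr.lift_pure mr.lift_add mr.lift_closed counit_simps assms(2))
  then show ?thesis using mr_comult comult_closed by (metis image_subsetI)
qed

end

section \<open>The corner algebra e A e and its module A e\<close>

locale corner = fd_alg K A
  for K :: "('k, 'c) ring_scheme" and A :: "('k, 'a, 'e) module_scheme" (structure) +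
  fixes e :: 'a
  assumes e_closed [simp]: "e \<in> carrier A" and e_idem [simp]: "e \<otimes> e = e"
begin

definition B where "B = A\<lparr>carrier := {x \<in> carrier A. e \<otimes> x = x \<and> x \<otimes> e = x}, one := e\<rparr>"

definition M :: "('k, 'a, 'a) rmod" where
  "M = \<lparr>carrier = {x \<in> carrier A. x \<otimes> e = x}, monoid.mult = monoid.mult A, one = \<one>, zero = \<zero>,
    add = add A, smult = smult A, ract = monoid.mult A\<rparr>"

lemma e_e [simp]: "x \<in> carrier A \<Longrightarrow> e \<otimes> (e \<otimes> x) = e \<otimes> x"
  by (simp flip: A.m_assoc)

lemma B_simps:
  "x \<in> carrier B \<longleftrightarrow> x \<in> carrier A \<and> e \<otimes> x = x \<and> x \<otimes> e = x"
  "x \<otimes>\<^bsub>B\<^esub> y = x \<otimes> y" "x \<oplus>\<^bsub>B\<^esub> y = x \<oplus> y" "k \<odot>\<^bsub>B\<^esub> x = k \<odot> x" "\<one>\<^bsub>B\<^esub> = e" "\<zero>\<^bsub>B\<^esub> = \<zero>"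
  by (simp_all add: B_def)

lemma M_simps:
  "x \<in> carrier M \<longleftrightarrow> x \<in> carrier A \<and> x \<otimes> e = x"
  "x \<oplus>\<^bsub>M\<^esub> y = x \<oplus> y" "k \<odot>\<^bsub>M\<^esub> x = k \<odot> x" "\<zero>\<^bsub>M\<^esub> = \<zero>" "x \<triangleleft>\<^bsub>M\<^esub> b = x \<otimes> b"
  by (simp_all add: M_def)

lemma corner_submodules:
  shows "submodule K (carrier B) A" "submodule K (carrier M) A"
  by (unfold_locales; auto simp: B_simps M_simps A.l_distr A.r_distr smult_mult_left smult_mult_right)+

lemma B_mult: "\<lbrakk>x \<in> carrier B; y \<in> carrier B\<rbrakk> \<Longrightarrow> x \<otimes> y \<in> carrier B"
  using A.m_assoc[of e x y] by (auto simp: B_simps A.m_assoc)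

lemma eAe_closed: "x \<in> carrier A \<Longrightarrow> e \<otimes> x \<otimes> e \<in> carrier B"
  by (simp add: B_simps A.m_assoc)

lemma B_fd_algebra: "fd_algebra K B"
proof -
  have V: "vectorspace K B" "vectorspace.fin_dim K B"
    using vectorspace_image[where h = "\<lambda>x. x" and N = B,
        OF fin_dim_submodule(1)[OF finite_dimensional corner_submodules(1)]]
      fin_dim_submodule(2)[OF finite_dimensional corner_submodules(1)]
    by (simp_all add: B_simps)
  interpret V: vectorspace K B by (rule V)
  have "ring B"
    by (intro ringI V.M.abelian_group_axioms Group.monoidI)
      (auto simp: B_simps A.m_assoc A.l_distr A.r_distr, auto simp flip: A.m_assoc)
  then show ?thesis
    using V by (auto simp: fd_algebra_def fd_algebra_axioms_def B_simps smult_mult_left smult_mult_right)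
qed

sublocale B: fd_algebra K B by (rule B_fd_algebra)

lemma M_module: "right_module K B M" "vectorspace.fin_dim K M"
proof -
  have V: "vectorspace K M" "vectorspace.fin_dim K M"
    using vectorspace_image[where h = "\<lambda>x. x" and N = M,
        OF fin_dim_submodule(1)[OF finite_dimensional corner_submodules(2)]]
      fin_dim_submodule(2)[OF finite_dimensional corner_submodules(2)]
    by (simp_all add: M_simps)
  then show "right_module K B M" "vectorspace.fin_dim K M"
    using B_fd_algebra
    by (auto simp: right_module_def right_module_axioms_def M_simps B_simps A.m_assoc A.l_distr A.r_distr
      smult_mult_left smult_mult_right)
qed

text \<open>One copy of A e suffices, since A e is the direct sum of e A e and (1 - e) A e as a
  right module over e A e. The map \<open>\<sigma>\<close> only translates into functions on a
  one-element index set.\<close>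

lemma M_generator: "generator_module K B M"
proof -
  interpret M: right_module K B M by (rule M_module)
  let ?P = "rmod_power (Suc 0) M"
  define \<sigma> where "\<sigma> x = (\<lambda>i\<in>{..<Suc 0}. x)" for x :: 'a
  have \<sigma>0: "\<sigma> x 0 = x" for x by (simp add: \<sigma>_def)
  have \<sigma>_ops: "\<sigma> x \<oplus>\<^bsub>?P\<^esub> \<sigma> y = \<sigma> (x \<oplus> y)" "k \<odot>\<^bsub>?P\<^esub> \<sigma> x = \<sigma> (k \<odot> x)" "\<sigma> x \<triangleleft>\<^bsub>?P\<^esub> b = \<sigma> (x \<otimes> b)"
    "\<zero>\<^bsub>?P\<^esub> = \<sigma> \<zero>" for x y k b
    by (auto simp: \<sigma>_def rmod_power_def M_simps)
  have \<sigma>_surj: "f = \<sigma> (f 0)" "f 0 \<in> carrier M" if "f \<in> carrier ?P" for f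
    using that by (auto simp: \<sigma>_def rmod_power_def PiE_iff extensional_def fun_eq_iff)
  have carr: "carrier ?P = \<sigma> ` carrier M"
  proof
    show "carrier ?P \<subseteq> \<sigma> ` carrier M" using \<sigma>_surj by blast
    show "\<sigma> ` carrier M \<subseteq> carrier ?P" by (simp add: \<sigma>_def rmod_power_def image_subset_iff)
  qed
  have vP: "vectorspace K ?P"
    by (rule vectorspace_image(1)[OF M.vectorspace_axioms carr]) (simp_all add: \<sigma>_ops M_simps)
  then have modP: "module K ?P" by (simp add: vectorspace_def)
  define U where "U = \<sigma> ` carrier B"
  \<comment> \<open>This is (1 - e) A e, described as the kernel of left multiplication by
    \<open>e\<close> on A e.\<close>
  define V where "V = \<sigma> ` {x \<in> carrier M. e \<otimes> x = \<zero>}"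
  have sub: "rsubmodule K B U ?P" "rsubmodule K B V ?P"
  proof -
    have "submodule K U ?P"
      by (rule submodule.intro[OF modP])
        (auto simp: U_def carr \<sigma>_ops B_simps M_simps A.l_distr A.r_distr smult_mult_left
          smult_mult_right intro!: imageI)
    then show "rsubmodule K B U ?P"
      by (auto simp: rsubmodule_def U_def \<sigma>_ops intro!: imageI B_mult)
    have "submodule K V ?P"
      by (rule submodule.intro[OF modP])
        (auto simp: V_def carr \<sigma>_ops B_simps M_simps A.l_distr A.r_distr smult_mult_left
          smult_mult_right smult_r_null intro!: imageI)
    moreover have "\<sigma> x \<triangleleft>\<^bsub>?P\<^esub> b \<in> V" if "x \<in> carrier M" "e \<otimes> x = \<zero>" "b \<in> carrier B" for x b
      unfolding \<sigma>_ops V_def using that A.m_assoc[of e x b]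
      by (intro imageI) (auto simp: M_simps B_simps A.m_assoc)
    ultimately show "rsubmodule K B V ?P"
      unfolding rsubmodule_def by (auto simp: V_def)
  qed
  have "U \<inter> V = {\<zero>\<^bsub>?P\<^esub>}"
  proof -
    have "f = \<zero>\<^bsub>?P\<^esub>" if "f \<in> U" "f \<in> V" for f
    proof -
      obtain x y where "x \<in> carrier B" "f = \<sigma> x" "e \<otimes> y = \<zero>" "f = \<sigma> y"
        using \<open>f \<in> U\<close> \<open>f \<in> V\<close> unfolding U_def V_def by blast
      moreover from this have "x = y" using \<sigma>0 by metis
      ultimately show ?thesis by (auto simp: \<sigma>_ops B_simps)
    qed
    moreover have "\<zero>\<^bsub>?P\<^esub> \<in> U" "\<zero>\<^bsub>?P\<^esub> \<in> V"
      by (auto simp: U_def V_def \<sigma>_ops B_simps M_simps)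
    ultimately show ?thesis by blast
  qed
  moreover have "\<exists>u\<in>U. \<exists>v\<in>V. f = u \<oplus>\<^bsub>?P\<^esub> v" if f: "f \<in> carrier ?P" for f
  proof -
    obtain m where m: "m \<in> carrier M" "f = \<sigma> m" using \<sigma>_surj[OF f] by blast
    have mA: "m \<in> carrier A" "m \<otimes> e = m" using m by (auto simp: M_simps)
    have "e \<otimes> m \<in> carrier B" using mA by (simp add: B_simps A.m_assoc)
    moreover have "m \<ominus> e \<otimes> m \<in> carrier M" "e \<otimes> (m \<ominus> e \<otimes> m) = \<zero>"
      using mA by (auto simp: M_simps a_minus_def A.l_distr A.r_distr A.l_minus A.r_minus A.m_assoc A.r_neg)
    moreover have "m = e \<otimes> m \<oplus> (m \<ominus> e \<otimes> m)"
      using mA by (simp add: a_minus_def A.a_comm[of m] A.r_neg2)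
    then have "f = \<sigma> (e \<otimes> m) \<oplus>\<^bsub>?P\<^esub> \<sigma> (m \<ominus> e \<otimes> m)"
      using m(2) by (simp only: \<sigma>_ops)
    ultimately show ?thesis unfolding U_def V_def by blast
  qed
  moreover have "rmod_isomorphic K B (regular_bimod B) (?P\<lparr>carrier := U\<rparr>)"
    unfolding rmod_isomorphic_def
  proof (intro bexI[of _ \<sigma>])
    show "bij_betw \<sigma> (carrier (regular_bimod B)) (carrier (?P\<lparr>carrier := U\<rparr>))"
      using \<sigma>0 by (auto simp: bij_betw_def U_def regular_bimod_def intro!: inj_on_inverseI[of _ "\<lambda>f. f 0"])
    show "\<sigma> \<in> rmod_hom K B (regular_bimod B) (?P\<lparr>carrier := U\<rparr>)"
      by (auto simp: rmod_hom_def module_hom_def regular_bimod_def U_def \<sigma>_ops B_simps(2-))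
  qed
  ultimately show ?thesis
    using sub unfolding generator_module_def direct_summand_def by blast
qed

end

section \<open>The corner at an idempotent generating the image of the counit\<close>

locale dual_bocs_corner = dual_bocs K A \<mu> \<epsilon> + corner K A e
  for K :: "('k, 'c) ring_scheme" and A :: "('k, 'a, 'e) module_scheme" (structure) and \<mu> \<epsilon> e +
  assumes e_image: "e \<in> \<epsilon> ` dual"
    and e_generates: "\<lbrakk>ideal J A; e \<in> J\<rbrakk> \<Longrightarrow> \<epsilon> ` dual \<subseteq> J"
begin

lemma ideal_carrierI:
  assumes J: "J \<subseteq> carrier A" "\<zero> \<in> J" "\<And>x y. \<lbrakk>x \<in> J; y \<in> J\<rbrakk> \<Longrightarrow> x \<oplus> y \<in> J"
    "\<And>x a. \<lbrakk>x \<in> J; a \<in> carrier A\<rbrakk> \<Longrightarrow> a \<otimes> x \<in> J" "\<And>x a. \<lbrakk>x \<in> J; a \<in> carrier A\<rbrakk> \<Longrightarrow> x \<otimes> a \<in> J"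
  shows "ideal J A"
proof (rule idealI[OF A.ring_axioms])
  show "subgroup J (add_monoid A)"
  proof (rule A.add.subgroupI)
    fix x assume "x \<in> J"
    then have "(\<ominus> \<one>) \<otimes> x \<in> J" "x \<in> carrier A" using J(1,4) by auto
    then show "\<ominus> x \<in> J" by (simp add: A.l_minus)
  qed (use J in auto)
qed (use J in auto)

text \<open>The elements i with a A i = 0 form a two-sided ideal. It contains \<open>e\<close>,
  hence the whole image of \<open>\<epsilon>\<close>, and \<open>counit_faithful\<close>
  applies.\<close>

lemma corner_faithful:
  assumes a: "a \<in> carrier A" and zero: "\<And>x. x \<in> carrier A \<Longrightarrow> a \<otimes> (x \<otimes> e) = \<zero>"
  shows "a = \<zero>"
proof -
  let ?J = "{i \<in> carrier A. \<forall>x\<in>carrier A. a \<otimes> (x \<otimes> i) = \<zero>}"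
  have "ideal ?J A"
  proof (rule ideal_carrierI)
    fix i b assume i: "i \<in> ?J" and b: "b \<in> carrier A"
    have "a \<otimes> (x \<otimes> (b \<otimes> i)) = \<zero>" if "x \<in> carrier A" for x
      using i b that by (simp flip: A.m_assoc[of x b i])
    then show "b \<otimes> i \<in> ?J" using i b by simp
    have ic: "i \<in> carrier A" using i by simp
    have "a \<otimes> (x \<otimes> (i \<otimes> b)) = (a \<otimes> (x \<otimes> i)) \<otimes> b" if "x \<in> carrier A" for x
      using ic b a that by (simp add: A.m_assoc)
    then show "i \<otimes> b \<in> ?J" using i b by simp
  qed (use a in \<open>auto simp: A.r_distr\<close>)
  then have "\<epsilon> ` dual \<subseteq> ?J" using zero by (intro e_generates) simp_all
  then have "a \<otimes> (\<one> \<otimes> \<epsilon> w) = \<zero>" if "w \<in> dual" for w using that by blast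
  then show ?thesis using a by (intro counit_faithful[OF a]) (simp add: counit_closed)
qed

lemma corner_faithful_eq:
  assumes "a \<in> carrier A" "b \<in> carrier A" and eq: "\<And>x. x \<in> carrier A \<Longrightarrow> a \<otimes> (x \<otimes> e) = b \<otimes> (x \<otimes> e)"
  shows "a = b"
proof -
  have "a \<ominus> b = \<zero>"
  proof (rule corner_faithful)
    fix x assume x: "x \<in> carrier A"
    then have "b \<otimes> (x \<otimes> e) \<in> carrier A" using assms(2) by simp
    then show "(a \<ominus> b) \<otimes> (x \<otimes> e) = \<zero>"
      using assms(1,2) x eq[OF x] by (simp add: a_minus_def A.l_distr A.l_minus A.r_neg)
  qed (use assms in simp)
  then show ?thesis using assms by simp
qed

text \<open>Restricting \<open>\<epsilon>\<close> gives a surjection \<open>D(B) = e D(A) e \<rightarrow> e A e = B\<close> of bimodules, and a preimage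
  \<open>w\<close> of \<open>e\<close> yields the inverse \<open>b \<mapsto> b w\<close>.\<close>

lemma B_symmetric: "symmetric_algebra K B"
proof -
  obtain w0 where w0: "w0 \<in> dual" "\<epsilon> w0 = e" using e_image by blast
  \<comment> \<open>Replacing \<open>w0\<close> by e w0 e keeps the counit value e e e = e, and
    makes \<open>w\<close> depend only on the corner component of its argument.\<close>
  define w where "w = e \<triangleright>\<^bsub>\<D>\<^esub> (w0 \<triangleleft>\<^bsub>\<D>\<^esub> e)"
  have w: "w \<in> dual" "\<epsilon> w = e"
    using w0 by (auto simp: w_def counit_simps W.ract_closed W.lact_closed)
  have we: "w (e \<otimes> x \<otimes> e) = w x" if "x \<in> carrier A" for x
    using that by (simp add: w_def dual_act_apply A.m_assoc)
  have Bc: "b \<in> carrier A" "e \<otimes> b = b" "b \<otimes> e = b" if "b \<in> carrier B" for b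
    using that by (auto simp: B_simps)
  define \<Phi> where "\<Phi> b = (\<lambda>x\<in>carrier B. w (x \<otimes> b))" for b
  have \<Phi>: "\<Phi> b \<in> B.dual" if "b \<in> carrier B" for b
    unfolding \<Phi>_def by (rule B.dual_restrictI)
      (use that w(1) in \<open>auto simp: B_simps dual_closed A.l_distr dual_add smult_mult_left dual_smult\<close>)
  have right: "w (x \<otimes> b) = w ((e \<otimes> x \<otimes> e) \<otimes> b)" "w (b \<otimes> x) = w (b \<otimes> (e \<otimes> x \<otimes> e))"
    if "x \<in> carrier A" "b \<in> carrier B" for x b
  proof -
    have "w (x \<otimes> b) = w (e \<otimes> (x \<otimes> b) \<otimes> e)" using that Bc by (intro we[symmetric]) auto
    also have "e \<otimes> (x \<otimes> b) \<otimes> e = (e \<otimes> x \<otimes> e) \<otimes> b" using that Bc by (simp add: A.m_assoc)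
    finally show "w (x \<otimes> b) = w ((e \<otimes> x \<otimes> e) \<otimes> b)" .
    have "w (b \<otimes> x) = w (e \<otimes> (b \<otimes> x) \<otimes> e)" using that Bc by (intro we[symmetric]) auto
    also have "e \<otimes> (b \<otimes> x) \<otimes> e = b \<otimes> (e \<otimes> x \<otimes> e)" using that Bc by (simp flip: A.m_assoc)
    finally show "w (b \<otimes> x) = w (b \<otimes> (e \<otimes> x \<otimes> e))" .
  qed
  \<comment> \<open>The functionals b w and w b both have counit \<open>b\<close>, as \<epsilon>(w)
    = e. So \<open>\<epsilon>\<close> recovers \<open>b\<close> from either one, even if it is known
    on the corner only. The first case yields injectivity of \<open>\<Phi>\<close>, the second the
    trace property.\<close>
  have recover: "c = b"
    if "b \<in> carrier B" "c \<in> carrier B" and u: "u \<in> {b \<triangleright>\<^bsub>\<D>\<^esub> w, w \<triangleleft>\<^bsub>\<D>\<^esub> b}"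
      and eq: "\<And>x. x \<in> carrier B \<Longrightarrow> w (x \<otimes> c) = u x" for b c u
  proof -
    have mem: "b \<triangleright>\<^bsub>\<D>\<^esub> w \<in> dual" "w \<triangleleft>\<^bsub>\<D>\<^esub> b \<in> dual" "c \<triangleright>\<^bsub>\<D>\<^esub> w \<in> dual"
      using that Bc w by (auto intro: W.lact_closed W.ract_closed)
    have "c \<triangleright>\<^bsub>\<D>\<^esub> w = u"
    proof (rule dual_eqI[OF mem(3)])
      show "u \<in> dual" using u mem by blast
      fix x assume x: "x \<in> carrier A"
      have "(c \<triangleright>\<^bsub>\<D>\<^esub> w) x = u (e \<otimes> x \<otimes> e)"
        using x that(2) right(1)[of x c] eq[OF eAe_closed[OF x]] by (simp add: dual_act_apply)
      also have "\<dots> = u x"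
        using u x that(1) right[of x b] eAe_closed[OF x] by (auto simp: dual_act_apply)
      finally show "(c \<triangleright>\<^bsub>\<D>\<^esub> w) x = u x" .
    qed
    moreover have "\<epsilon> u = b" using u w that(1) Bc by (auto simp: counit_simps)
    moreover have "\<epsilon> (c \<triangleright>\<^bsub>\<D>\<^esub> w) = c" using w that(2) Bc by (simp add: counit_simps)
    ultimately show ?thesis by simp
  qed
  interpret D: vectorspace K "dual_bimod K B" by (rule B.dual_vectorspace)
  have \<Phi>_add: "\<Phi> (b \<oplus>\<^bsub>B\<^esub> c) = \<Phi> b \<oplus>\<^bsub>dual_bimod K B\<^esub> \<Phi> c" if "b \<in> carrier B" "c \<in> carrier B" for b c
    using that Bc w(1) by (auto simp: \<Phi>_def B.dual_ops B_simps(2-) A.r_distr dual_add fun_eq_iff)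
  have \<Phi>_smult: "\<Phi> (k \<odot>\<^bsub>B\<^esub> b) = k \<odot>\<^bsub>dual_bimod K B\<^esub> \<Phi> b" if "k \<in> carrier K" "b \<in> carrier B" for k b
    using that Bc w(1) by (auto simp: \<Phi>_def B.dual_ops B_simps(2-) smult_mult_right dual_smult fun_eq_iff)
  have "submodule K (\<Phi> ` carrier B) (dual_bimod K B)"
  proof unfold_locales
    show "\<Phi> ` carrier B \<subseteq> B.dual" using \<Phi> by blast
    have "\<Phi> \<zero>\<^bsub>B\<^esub> = \<zero>\<^bsub>dual_bimod K B\<^esub>"
      using \<Phi>_smult[of "\<zero>\<^bsub>K\<^esub>" "\<zero>\<^bsub>B\<^esub>"] \<Phi>[of "\<zero>\<^bsub>B\<^esub>"] by simp
    then show "\<zero>\<^bsub>dual_bimod K B\<^esub> \<in> \<Phi> ` carrier B" by (metis B.M.zero_closed imageI)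
  qed (auto simp flip: \<Phi>_add \<Phi>_smult)
  \<comment> \<open>If \<open>w\<close> vanishes on x e A e, it vanishes on x A, so w x = 0 in D(A),
    and applying \<open>\<epsilon>\<close> gives x = e x = 0.\<close>
  moreover have "x = \<zero>\<^bsub>B\<^esub>" if x: "x \<in> carrier B" and zero: "\<And>u. u \<in> \<Phi> ` carrier B \<Longrightarrow> u x = \<zero>\<^bsub>K\<^esub>" for x
  proof -
    have "w (x \<otimes> b) = \<zero>\<^bsub>K\<^esub>" if "b \<in> carrier B" for b
      using zero[of "\<Phi> b"] that x by (simp add: \<Phi>_def)
    then have "w (x \<otimes> y) = \<zero>\<^bsub>K\<^esub>" if "y \<in> carrier A" for y
      using right(2)[OF that x] eAe_closed[OF that] by metis
    then have "w \<triangleleft>\<^bsub>\<D>\<^esub> x = \<zero>\<^bsub>\<D>\<^esub>"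
      by (auto simp: dual_bimod_def fun_eq_iff)
    then have "\<epsilon> (w \<triangleleft>\<^bsub>\<D>\<^esub> x) = \<zero>" by (simp add: counit_zero)
    then show ?thesis using w x Bc by (simp add: counit_ract B_simps(6))
  qed
  ultimately have surj: "\<Phi> ` carrier B = B.dual"
    by (rule B.dual_submodule_eqI[OF B.finite_dimensional])
  have inj: "inj_on \<Phi> (carrier B)"
  proof (rule inj_onI)
    fix b c assume bc: "b \<in> carrier B" "c \<in> carrier B" "\<Phi> b = \<Phi> c"
    show "b = c"
    proof (rule recover[OF bc(2,1) insertI1])
      fix x assume "x \<in> carrier B"
      then show "w (x \<otimes> b) = (c \<triangleright>\<^bsub>\<D>\<^esub> w) x"
        using fun_cong[OF bc(3), of x] Bc by (simp add: \<Phi>_def dual_act_apply)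
    qed
  qed
  \<comment> \<open>By surjectivity the restriction of w b is c w for some \<open>c\<close>, and
    \<open>recover\<close> identifies \<open>c\<close> with \<open>b\<close>. This is what makes
    \<open>\<Phi>\<close> right linear.\<close>
  have trace: "w (x \<otimes> b) = w (b \<otimes> x)" if "x \<in> carrier B" "b \<in> carrier B" for x b
  proof -
    have "(\<lambda>x\<in>carrier B. w (b \<otimes> x)) \<in> B.dual"
      by (rule B.dual_restrictI)
        (use that w(1) in \<open>auto simp: B_simps dual_closed A.r_distr dual_add smult_mult_right dual_smult\<close>)
    then obtain c where c: "c \<in> carrier B" "(\<lambda>x\<in>carrier B. w (b \<otimes> x)) = \<Phi> c"
      using surj by blast
    have *: "w (x \<otimes> c) = w (b \<otimes> x)" if "x \<in> carrier B" for x
      using fun_cong[OF c(2), of x] that by (simp add: \<Phi>_def)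
    have "c = b"
      by (rule recover[OF that(2) c(1), of "w \<triangleleft>\<^bsub>\<D>\<^esub> b"]) (use * Bc in \<open>auto simp: dual_act_apply\<close>)
    then show ?thesis using * that by simp
  qed
  have "\<Phi> \<in> bimod_hom K B (regular_bimod B) (dual_bimod K B)"
  proof (rule bimod_homI)
    fix b c assume "b \<in> carrier (regular_bimod B)" "c \<in> carrier B"
    then have bc: "b \<in> carrier B" "c \<in> carrier B" by (simp_all add: regular_bimod_def)
    have "w (x \<otimes> (b \<otimes> c)) = w (c \<otimes> x \<otimes> b)" if "x \<in> carrier B" for x
    proof -
      have "x \<otimes> b \<in> carrier B" using that bc by (intro B_mult)
      from trace[OF this bc(2)] show ?thesis using that bc Bc by (simp add: A.m_assoc)
    qed
    moreover have "c \<otimes> x \<in> carrier B" if "x \<in> carrier B" for x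
      using that bc by (intro B_mult)
    ultimately show "\<Phi> (b \<triangleleft>\<^bsub>regular_bimod B\<^esub> c) = \<Phi> b \<triangleleft>\<^bsub>dual_bimod K B\<^esub> c"
      by (auto simp: regular_bimod_def dual_bimod_def B_simps(2-) \<Phi>_def fun_eq_iff)
    have "x \<otimes> c \<in> carrier B" if "x \<in> carrier B" for x
      using that bc by (intro B_mult)
    then show "\<Phi> (c \<triangleright>\<^bsub>regular_bimod B\<^esub> b) = c \<triangleright>\<^bsub>dual_bimod K B\<^esub> \<Phi> b"
      using bc Bc by (auto simp: regular_bimod_def dual_bimod_def B_simps(2-) \<Phi>_def fun_eq_iff A.m_assoc)
  next
    fix b c assume "b \<in> carrier (regular_bimod B)" "c \<in> carrier (regular_bimod B)"
    then show "\<Phi> (b \<oplus>\<^bsub>regular_bimod B\<^esub> c) = \<Phi> b \<oplus>\<^bsub>dual_bimod K B\<^esub> \<Phi> c"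
      using \<Phi>_add[of b c] by (simp add: regular_bimod_def)
  next
    fix k b assume "k \<in> carrier K" "b \<in> carrier (regular_bimod B)"
    then show "\<Phi> (k \<odot>\<^bsub>regular_bimod B\<^esub> b) = k \<odot>\<^bsub>dual_bimod K B\<^esub> \<Phi> b"
      using \<Phi>_smult[of k b] by (simp add: regular_bimod_def)
  qed (use \<Phi> in \<open>auto simp: regular_bimod_def\<close>)
  moreover have "bij_betw \<Phi> (carrier (regular_bimod B)) B.dual"
    using inj surj by (simp add: bij_betw_def regular_bimod_def)
  ultimately show ?thesis
    using B_fd_algebra unfolding symmetric_algebra_def bimod_isomorphic_def by blast
qed

text \<open>An endomorphism \<open>\<theta>\<close> of \<open>A e\<close> extends to the ideal generated by \<open>e\<close>; composed with \<open>\<epsilon>\<close> it is right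
  linear on \<open>D(A)\<close> and therefore given by a left multiplication.\<close>

lemma endomorphism_is_multiplication:
  assumes \<theta>: "\<theta> \<in> rmod_hom K B M M"
  obtains a where "a \<in> carrier A" "\<And>m. m \<in> carrier M \<Longrightarrow> \<theta> m = a \<otimes> m"
proof -
  have \<theta>c: "\<theta> m \<in> carrier A" "\<theta> m \<otimes> e = \<theta> m" if "m \<in> carrier M" for m
    using that \<theta> by (auto simp: rmod_hom_def module_hom_def M_simps Pi_iff)
  have \<theta>_add: "\<theta> (m \<oplus> n) = \<theta> m \<oplus> \<theta> n" if "m \<in> carrier M" "n \<in> carrier M" for m n
    using that \<theta> by (auto simp: rmod_hom_def module_hom_def M_simps)
  have \<theta>_mult: "\<theta> (m \<otimes> b) = \<theta> m \<otimes> b" if "m \<in> carrier M" "b \<in> carrier B" for m b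
    using that \<theta> by (auto simp: rmod_hom_def M_simps)
  have Me: "x \<otimes> e \<in> carrier M" if "x \<in> carrier A" for x using that by (simp add: M_simps A.m_assoc)
  have Me': "x \<otimes> (y \<otimes> e) \<in> carrier M" if "x \<in> carrier A" "y \<in> carrier A" for x y
    using that by (simp add: M_simps A.m_assoc)
  \<comment> \<open>\<open>?ext i z\<close> says that \<open>z\<close> can serve as the value at
    \<open>i\<close> of an extension of \<open>\<theta>\<close>; \<open>corner_faithful_eq\<close>
    makes such a \<open>z\<close> unique.\<close>
  let ?ext = "\<lambda>i z. z \<in> carrier A \<and> (\<forall>y\<in>carrier A. z \<otimes> (y \<otimes> e) = \<theta> (i \<otimes> (y \<otimes> e)))"
  \<comment> \<open>Quantifying over left multiples of \<open>i\<close> builds closure under left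
    multiplication into the definition.\<close>
  let ?J = "{i \<in> carrier A. \<forall>x\<in>carrier A. \<exists>z. ?ext (x \<otimes> i) z}"
  have "ideal ?J A"
  proof (rule ideal_carrierI)
    show "\<zero> \<in> ?J"
    proof -
      have "\<theta> \<zero> = \<zero>" using \<theta>_mult[of \<zero> \<zero>] \<theta>c(1)[of \<zero>] by (simp add: M_simps B_simps)
      then have "?ext (x \<otimes> \<zero>) \<zero>" if "x \<in> carrier A" for x using that by simp
      then show ?thesis by blast
    qed
  next
    fix i j assume i: "i \<in> ?J" and j: "j \<in> ?J"
    have "\<exists>z. ?ext (x \<otimes> (i \<oplus> j)) z" if x: "x \<in> carrier A" for x
    proof -
      obtain z z' where "?ext (x \<otimes> i) z" "?ext (x \<otimes> j) z'" using i j x by blast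
      then have "?ext (x \<otimes> (i \<oplus> j)) (z \<oplus> z')"
        using i j x by (auto simp: A.l_distr A.r_distr \<theta>_add Me')
      then show ?thesis by blast
    qed
    then show "i \<oplus> j \<in> ?J" using i j by simp
  next
    fix i b assume i: "i \<in> ?J" and b: "b \<in> carrier A"
    have "\<exists>z. ?ext (x \<otimes> (b \<otimes> i)) z" if x: "x \<in> carrier A" for x
    proof -
      have "x \<otimes> b \<in> carrier A" using x b by simp
      then obtain z where "?ext (x \<otimes> b \<otimes> i) z" using i by blast
      then show ?thesis using x b i by (auto simp: A.m_assoc)
    qed
    then show "b \<otimes> i \<in> ?J" using i b by simp
    have "\<exists>z. ?ext (x \<otimes> (i \<otimes> b)) z" if x: "x \<in> carrier A" for x
    proof -
      obtain z where z: "?ext (x \<otimes> i) z" using i x by blast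
      have "z \<otimes> b \<otimes> (y \<otimes> e) = \<theta> (x \<otimes> (i \<otimes> b) \<otimes> (y \<otimes> e))" if y: "y \<in> carrier A" for y
      proof -
        have "z \<otimes> (b \<otimes> y \<otimes> e) = \<theta> (x \<otimes> i \<otimes> (b \<otimes> y \<otimes> e))" using z b y by simp
        then show ?thesis using z b y x i by (simp add: A.m_assoc)
      qed
      then show ?thesis using z b by (intro exI[of _ "z \<otimes> b"]) simp
    qed
    then show "i \<otimes> b \<in> ?J" using i b by simp
  qed auto
  moreover have "e \<in> ?J"
  proof -
    \<comment> \<open>As \<theta>(x e) = \<theta>(x e) e, a factor \<open>e\<close> can be inserted
      before y e; the product e y e lies in the corner and moves inside
      \<open>\<theta>\<close>.\<close>
    have "?ext (x \<otimes> e) (\<theta> (x \<otimes> e))" if x: "x \<in> carrier A" for x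
    proof -
      have "\<theta> (x \<otimes> e) \<otimes> (y \<otimes> e) = \<theta> (x \<otimes> e \<otimes> (y \<otimes> e))" if y: "y \<in> carrier A" for y
      proof -
        have "\<theta> (x \<otimes> e) \<otimes> (y \<otimes> e) = \<theta> (x \<otimes> e) \<otimes> e \<otimes> (y \<otimes> e)"
          using x \<theta>c(2)[OF Me] by simp
        also have "\<dots> = \<theta> (x \<otimes> e) \<otimes> (e \<otimes> y \<otimes> e)"
          using x y \<theta>c(1)[OF Me] by (simp add: A.m_assoc)
        also have "\<dots> = \<theta> (x \<otimes> e \<otimes> (e \<otimes> y \<otimes> e))"
          using x y by (intro \<theta>_mult[symmetric] Me eAe_closed)
        also have "x \<otimes> e \<otimes> (e \<otimes> y \<otimes> e) = x \<otimes> e \<otimes> (y \<otimes> e)"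
          using x y by (simp add: A.m_assoc)
        finally show ?thesis .
      qed
      then show ?thesis using \<theta>c(1)[OF Me] x by blast
    qed
    then show ?thesis by auto
  qed
  ultimately have "\<epsilon> ` dual \<subseteq> ?J" by (rule e_generates)
  then have "\<exists>z. ?ext (\<one> \<otimes> \<epsilon> w) z" if "w \<in> dual" for w using that by blast
  then have ex: "\<exists>z. ?ext (\<epsilon> w) z" if "w \<in> dual" for w using that counit_closed by simp
  define \<tau> where "\<tau> w = (SOME z. ?ext (\<epsilon> w) z)" for w
  have \<tau>: "?ext (\<epsilon> w) (\<tau> w)" if "w \<in> dual" for w
    unfolding \<tau>_def by (rule someI_ex) (rule ex[OF that])
  have \<tau>_eq: "\<tau> w = z" if "w \<in> dual" "?ext (\<epsilon> w) z" for w z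
    by (rule corner_faithful_eq) (use \<tau>[OF that(1)] that(2) in auto)
  obtain a where a: "a \<in> carrier A" "\<And>w. w \<in> dual \<Longrightarrow> \<tau> w = a \<otimes> \<epsilon> w"
  proof (rule right_linear_into_regular[of \<tau>])
    fix v w assume vw: "v \<in> dual" "w \<in> dual"
    show "\<tau> (v \<oplus>\<^bsub>\<D>\<^esub> w) = \<tau> v \<oplus> \<tau> w"
      using vw \<tau>[OF vw(1)] \<tau>[OF vw(2)]
      by (intro \<tau>_eq) (auto simp: counit_add counit_closed A.l_distr \<theta>_add Me')
  next
    fix w b assume wb: "w \<in> dual" "b \<in> carrier A"
    have "\<tau> w \<otimes> b \<otimes> (y \<otimes> e) = \<theta> (\<epsilon> w \<otimes> b \<otimes> (y \<otimes> e))" if y: "y \<in> carrier A" for y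
    proof -
      have "\<tau> w \<otimes> (b \<otimes> y \<otimes> e) = \<theta> (\<epsilon> w \<otimes> (b \<otimes> y \<otimes> e))" using \<tau>[OF wb(1)] wb y by simp
      then show ?thesis using \<tau>[OF wb(1)] wb y counit_closed[OF wb(1)] by (simp add: A.m_assoc)
    qed
    then show "\<tau> (w \<triangleleft>\<^bsub>\<D>\<^esub> b) = \<tau> w \<otimes> b"
      using wb \<tau>[OF wb(1)] by (intro \<tau>_eq) (auto simp: counit_ract W.ract_closed)
  qed (use \<tau> in blast)+
  show ?thesis
  proof (rule that[OF a(1)])
    fix m assume m: "m \<in> carrier M"
    then have m': "m \<in> carrier A" "m \<otimes> e = m" by (auto simp: M_simps)
    interpret I: ideal "\<epsilon> ` dual" A by (rule counit_ideal)
    \<comment> \<open>Since m = m e lies in the ideal, \<open>m\<close> is a counit value, and the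
      extension property at \<open>\<one>\<close> recovers \<open>\<theta> m\<close> itself.\<close>
    have "m \<in> \<epsilon> ` dual" using I.I_l_closed[OF e_image m'(1)] m'(2) by simp
    then obtain w where w: "w \<in> dual" "m = \<epsilon> w" by blast
    have "\<tau> w \<otimes> (\<one> \<otimes> e) = \<theta> (\<epsilon> w \<otimes> (\<one> \<otimes> e))" using \<tau>[OF w(1)] by blast
    then show "\<theta> m = a \<otimes> m" using a w m' by (simp add: A.m_assoc)
  qed
qed

text \<open>Left multiplication is injective by faithfulness of A e and surjective by
  \<open>endomorphism_is_multiplication\<close>.\<close>

lemma corner_end_isomorphic: "alg_isomorphic K A (end_algebra K B M)"
proof -
  define f where "f a = (\<lambda>m\<in>carrier M. a \<otimes> m)" for a
  have mult: "a \<otimes> m \<in> carrier M" if "a \<in> carrier A" "m \<in> carrier M" for a m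
    using that by (simp add: M_simps A.m_assoc)
  have Mc: "m \<in> carrier A" if "m \<in> carrier M" for m using that by (simp add: M_simps)
  have closed: "f a \<in> carrier (end_algebra K B M)" if "a \<in> carrier A" for a
    using that
    by (auto simp: f_def end_algebra_def rmod_hom_def module_hom_def M_simps B_simps
      A.r_distr A.m_assoc smult_mult_right A.l_distr smult_mult_left)
  have "bij_betw f (carrier A) (carrier (end_algebra K B M))"
  proof (rule bij_betw_imageI)
    show "inj_on f (carrier A)"
    proof (rule inj_onI)
      fix a b assume ab: "a \<in> carrier A" "b \<in> carrier A" "f a = f b"
      show "a = b"
      proof (rule corner_faithful_eq[OF ab(1,2)])
        fix x assume "x \<in> carrier A"
        then have "x \<otimes> e \<in> carrier M" by (simp add: M_simps A.m_assoc)
        then show "a \<otimes> (x \<otimes> e) = b \<otimes> (x \<otimes> e)"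
          using fun_cong[OF ab(3), of "x \<otimes> e"] by (simp add: f_def)
      qed
    qed
    show "f ` carrier A = carrier (end_algebra K B M)"
    proof
      show "carrier (end_algebra K B M) \<subseteq> f ` carrier A"
      proof
        fix \<theta> assume \<theta>: "\<theta> \<in> carrier (end_algebra K B M)"
        then have \<theta>': "\<theta> \<in> rmod_hom K B M M" "\<theta> \<in> extensional (carrier M)"
          by (auto simp: end_algebra_def)
        obtain a where a: "a \<in> carrier A" "\<And>m. m \<in> carrier M \<Longrightarrow> \<theta> m = a \<otimes> m"
          using endomorphism_is_multiplication[OF \<theta>'(1)] by blast
        then have "\<theta> = f a"
          using \<theta>'(2) by (intro extensionalityI[of _ "carrier M"]) (auto simp: f_def)
        then show "\<theta> \<in> f ` carrier A" using a by blast
      qed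
    qed (use closed in blast)
  qed
  moreover have "f \<in> module_hom K A (end_algebra K B M)" "f \<in> ring_hom A (end_algebra K B M)"
    using closed mult Mc
    by (auto simp: module_hom_def ring_hom_def, auto simp: f_def end_algebra_def M_simps(2-) A.l_distr
      smult_mult_left compose_def fun_eq_iff A.m_assoc)
  ultimately show ?thesis unfolding alg_isomorphic_def by blast
qed

lemma corner_gendo_symmetric: "gendo_symmetric K A"
  using gendo_symmetricI[OF B_symmetric M_module M_generator corner_end_isomorphic] .

end

lemma (in dual_bocs) gendo_symmetric: "gendo_symmetric K A"
proof -
  obtain e where e: "e \<in> \<epsilon> ` dual" "e \<otimes> e = e" "\<And>J. \<lbrakk>ideal J A; e \<in> J\<rbrakk> \<Longrightarrow> \<epsilon> ` dual \<subseteq> J"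
    using idempotent_ideal_generator[OF counit_ideal counit_idempotent] by blast
  interpret dual_bocs_corner K A \<mu> \<epsilon> e
    using e counit_closed by unfold_locales auto
  show ?thesis by (rule corner_gendo_symmetric)
qed

section \<open>From gendo-symmetric algebras to bocses\<close>

locale counit_data = fd_alg K A
  for K :: "('k, 'c) ring_scheme" and A :: "('k, 'a, 'e) module_scheme" (structure) +
  fixes \<epsilon> :: "('a \<Rightarrow> 'k) \<Rightarrow> 'a"
  assumes \<epsilon>_hom: "\<epsilon> \<in> bimod_hom K A \<D> (regular_bimod A)"
    and \<epsilon>_symmetric: "\<lbrakk>u \<in> dual; v \<in> dual\<rbrakk> \<Longrightarrow>
      \<epsilon> u \<triangleright>\<^bsub>\<D>\<^esub> v = u \<triangleleft>\<^bsub>\<D>\<^esub> \<epsilon> v"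
begin

lemma \<epsilon>_closed: "w \<in> dual \<Longrightarrow> \<epsilon> w \<in> carrier A"
  and \<epsilon>_add: "\<lbrakk>v \<in> dual; w \<in> dual\<rbrakk> \<Longrightarrow> \<epsilon> (v \<oplus>\<^bsub>\<D>\<^esub> w) = \<epsilon> v \<oplus> \<epsilon> w"
  and \<epsilon>_smult: "\<lbrakk>k \<in> carrier K; w \<in> dual\<rbrakk> \<Longrightarrow> \<epsilon> (k \<odot>\<^bsub>\<D>\<^esub> w) = k \<odot> \<epsilon> w"
  and \<epsilon>_ract: "\<lbrakk>w \<in> dual; a \<in> carrier A\<rbrakk> \<Longrightarrow> \<epsilon> (w \<triangleleft>\<^bsub>\<D>\<^esub> a) = \<epsilon> w \<otimes> a"
  and \<epsilon>_lact: "\<lbrakk>w \<in> dual; a \<in> carrier A\<rbrakk> \<Longrightarrow> \<epsilon> (a \<triangleright>\<^bsub>\<D>\<^esub> w) = a \<otimes> \<epsilon> w"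
  using bimod_homD[OF \<epsilon>_hom] by (simp_all add: regular_simps)

lemmas \<epsilon>_simps = \<epsilon>_closed \<epsilon>_add \<epsilon>_smult \<epsilon>_ract \<epsilon>_lact

text \<open>The product on D(A) whose inverse is to become the comultiplication. By
  \<open>\<epsilon>_symmetric\<close> it is also given by u \<epsilon>(v), and the proof of the
  right counit law uses this second form.\<close>

sublocale \<nu>: balanced_map K A \<D> \<D> \<D>
  "\<lambda>u v. \<epsilon> u \<triangleright>\<^bsub>\<D>\<^esub> v"
  by unfold_locales (simp_all add: \<epsilon>_simps W.lact_closed W.lact_add_left W.lact_add_right W.lact_mult)

lemma \<nu>_hom: "\<nu>.lift \<in> bimod_hom K A WW.T \<D>"
proof (rule bimod_homI)
  fix t k assume k: "k \<in> carrier K" and t: "t \<in> carrier WW.T"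
  show "\<nu>.lift (k \<odot>\<^bsub>WW.T\<^esub> t) = k \<odot>\<^bsub>\<D>\<^esub> \<nu>.lift t"
    using t k by (induction t rule: WW.tensor_induct)
      (simp_all add: \<nu>.lift_pure \<nu>.lift_add \<nu>.lift_closed WW.tensor_pures WW.tensor_adds
        WW.tensor_closed \<epsilon>_simps WW.smult_pure_right W.lact_smult_right W.smult_r_distr)
next
  fix t a assume ta: "t \<in> carrier WW.T" "a \<in> carrier A"
  show "\<nu>.lift (t \<triangleleft>\<^bsub>WW.T\<^esub> a) = \<nu>.lift t \<triangleleft>\<^bsub>\<D>\<^esub> a"
    using ta by (induction t rule: WW.tensor_induct)
      (simp_all add: \<nu>.lift_pure \<nu>.lift_add \<nu>.lift_closed WW.tensor_pures WW.tensor_adds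
        WW.tensor_closed \<epsilon>_simps W.ract_closed W.lact_closed W.ract_add_left W.lact_ract)
  show "\<nu>.lift (a \<triangleright>\<^bsub>WW.T\<^esub> t) = a \<triangleright>\<^bsub>\<D>\<^esub> \<nu>.lift t"
    using ta by (induction t rule: WW.tensor_induct)
      (simp_all add: \<nu>.lift_pure \<nu>.lift_add \<nu>.lift_closed WW.tensor_pures WW.tensor_adds
        WW.tensor_closed \<epsilon>_simps W.lact_closed W.lact_add_right W.lact_mult)
qed (auto intro: \<nu>.lift_closed \<nu>.lift_add)

text \<open>The counit laws hold because u \<otimes> \<epsilon>(v) = u \<epsilon>(v) \<otimes> 1 and
  \<epsilon>(u) \<otimes> v = 1 \<otimes> \<epsilon>(u) v. Coassociativity evaluated on u \<otimes>
  v says that both sides are u \<otimes> \<mu>(v).\<close>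

lemma bocs_of_bijective:
  assumes bij: "bij_betw \<nu>.lift (carrier WW.T) dual"
  shows "\<exists>\<mu>. bocs K A (dual_bimod K A) \<mu> \<epsilon>"
proof -
  let ?W = "dual_bimod K A" and ?A = "regular_bimod A"
  define \<mu> where "\<mu> = inv_into (carrier WW.T) \<nu>.lift"
  have \<mu>\<nu>: "\<mu> (\<nu>.lift t) = t" if "t \<in> carrier WW.T" for t
    unfolding \<mu>_def using bij that by (simp add: bij_betw_def)
  have \<mu>: "\<mu> w \<in> carrier WW.T" "\<nu>.lift (\<mu> w) = w" if "w \<in> dual" for w
    unfolding \<mu>_def using bij that by (auto simp: bij_betw_def inv_into_into f_inv_into_f)
  note \<nu>D = bimod_homD[OF \<nu>_hom]
  have \<mu>_hom: "\<mu> \<in> bimod_hom K A ?W WW.T"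
  proof (rule bimod_homI)
    fix v w assume vw: "v \<in> dual" "w \<in> dual"
    interpret T: bimodule K A WW.T by (rule WW.tensor_bimodule)
    have "\<mu> (\<nu>.lift (\<mu> v \<oplus>\<^bsub>WW.T\<^esub> \<mu> w)) = \<mu> v \<oplus>\<^bsub>WW.T\<^esub> \<mu> w" using vw by (simp add: \<mu> \<mu>\<nu>)
    then show "\<mu> (v \<oplus>\<^bsub>?W\<^esub> w) = \<mu> v \<oplus>\<^bsub>WW.T\<^esub> \<mu> w" using vw by (simp add: \<nu>D \<mu>)
  next
    fix k w assume kw: "k \<in> carrier K" "w \<in> dual"
    have "\<mu> (\<nu>.lift (k \<odot>\<^bsub>WW.T\<^esub> \<mu> w)) = k \<odot>\<^bsub>WW.T\<^esub> \<mu> w" using kw by (simp add: \<mu> \<mu>\<nu> WW.tensor_closed)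
    then show "\<mu> (k \<odot>\<^bsub>?W\<^esub> w) = k \<odot>\<^bsub>WW.T\<^esub> \<mu> w" using kw by (simp add: \<nu>D \<mu>)
  next
    fix w a assume wa: "w \<in> dual" "a \<in> carrier A"
    have "\<mu> (\<nu>.lift (\<mu> w \<triangleleft>\<^bsub>WW.T\<^esub> a)) = \<mu> w \<triangleleft>\<^bsub>WW.T\<^esub> a" using wa by (simp add: \<mu> \<mu>\<nu> WW.tensor_closed)
    then show "\<mu> (w \<triangleleft>\<^bsub>?W\<^esub> a) = \<mu> w \<triangleleft>\<^bsub>WW.T\<^esub> a" using wa by (simp add: \<nu>D \<mu>)
    have "\<mu> (\<nu>.lift (a \<triangleright>\<^bsub>WW.T\<^esub> \<mu> w)) = a \<triangleright>\<^bsub>WW.T\<^esub> \<mu> w" using wa by (simp add: \<mu> \<mu>\<nu> WW.tensor_closed)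
    then show "\<mu> (a \<triangleright>\<^bsub>?W\<^esub> w) = a \<triangleright>\<^bsub>WW.T\<^esub> \<mu> w" using wa by (simp add: \<nu>D \<mu>)
  qed (rule \<mu>)
  note \<mu>D = bimod_homD[OF \<mu>_hom]
  have "bocs K A ?W \<mu> \<epsilon>"
  proof
    show "\<mu> \<in> bimod_hom K A ?W (tensor A ?W ?W)" by (rule \<mu>_hom)
    show "\<epsilon> \<in> bimod_hom K A ?W ?A" by (rule \<epsilon>_hom)
  next
    fix w assume w: "w \<in> dual"
    interpret m: tensor_hom K A ?W ?W ?W ?A "\<lambda>x. x" \<epsilon>
      by unfold_locales (auto intro: bimod_hom_id \<epsilon>_hom)
    have "tensor_map A ?W ?A (\<lambda>x. x) \<epsilon> t = WR.pt (\<nu>.lift t) \<one>" if "t \<in> carrier WW.T" for t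
      using that
    proof (induction t rule: WW.tensor_induct)
      case (pure u v)
      have "WR.pt u (\<epsilon> v) = WR.pt (u \<triangleleft>\<^bsub>?W\<^esub> \<epsilon> v) \<one>"
        using pure by (subst WR.pure_balanced) (auto simp: \<epsilon>_closed regular_simps)
      then show ?case
        using pure by (simp add: m.tensor_map_pure \<nu>.lift_pure \<epsilon>_symmetric)
    qed (simp add: m.tensor_map_add \<nu>.lift_add \<nu>.lift_closed WR.pure_add_left regular_simps)
    from this[OF \<mu>(1)[OF w]] show "tensor_map A ?W ?A (\<lambda>x. x) \<epsilon> (\<mu> w) = pure_tensor A ?W ?A w \<one>"
      using \<mu>(2)[OF w] by simp
  next
    fix w assume w: "w \<in> dual"
    interpret m: tensor_hom K A ?W ?W ?A ?W \<epsilon> "\<lambda>x. x"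
      by unfold_locales (auto intro: bimod_hom_id \<epsilon>_hom)
    have "tensor_map A ?A ?W \<epsilon> (\<lambda>x. x) t = RW.pt \<one> (\<nu>.lift t)" if "t \<in> carrier WW.T" for t
      using that
    proof (induction t rule: WW.tensor_induct)
      case (pure u v)
      have "RW.pt (\<one> \<triangleleft>\<^bsub>?A\<^esub> \<epsilon> u) v = RW.pt \<one> (\<epsilon> u \<triangleright>\<^bsub>?W\<^esub> v)"
        using pure by (intro RW.pure_balanced) (auto simp: \<epsilon>_closed regular_simps)
      then show ?case
        using pure by (simp add: m.tensor_map_pure \<nu>.lift_pure regular_simps \<epsilon>_closed)
    qed (simp add: m.tensor_map_add \<nu>.lift_add \<nu>.lift_closed RW.pure_add_right regular_simps)
    from this[OF \<mu>(1)[OF w]] show "tensor_map A ?A ?W \<epsilon> (\<lambda>x. x) (\<mu> w) = pure_tensor A ?A ?W \<one> w"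
      using \<mu>(2)[OF w] by simp
  next
    fix w assume w: "w \<in> dual"
    let ?T = "tensor A ?W ?W"
    interpret T: bimodule K A ?T by (rule WW.tensor_bimodule)
    interpret TW: bimodule_pair K A ?T ?W ..
    interpret WT: bimodule_pair K A ?W ?T ..
    interpret m1: tensor_hom K A ?W ?W ?T ?W \<mu> "\<lambda>x. x"
      by unfold_locales (auto intro: bimod_hom_id \<mu>_hom)
    interpret m2: tensor_hom K A ?W ?W ?W ?T "\<lambda>x. x" \<mu>
      by unfold_locales (auto intro: bimod_hom_id \<mu>_hom)
    have i: "balanced_map K A ?W ?W WT.T (\<lambda>x y. WT.pt x (WW.pt y z))" if z: "z \<in> dual" for z
      by unfold_locales (use z in \<open>simp_all add: WT.pure_closed WW.pure_closed WT.pure_add_left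
        WW.pure_add_left WT.pure_add_right WT.pure_balanced WW.tensor_lact_pure\<close>)
    have i_eq: "tensor_lift (tensor_group A ?W ?T) (\<lambda>x y. WT.pt x (WW.pt y z)) =
        balanced_map.lift WT.T (\<lambda>x y. WT.pt x (WW.pt y z))" if "z \<in> dual" for z
      unfolding balanced_map.lift_def[OF i[OF that]] tensor_group_eq ..
    \<comment> \<open>The associator with its last argument fixed; fixing \<open>z\<close> turns the
      nested \<open>tensor_lift\<close> of \<open>tensor_assoc\<close> into a lift on D(A) \<otimes>
      D(A).\<close>
    let ?g = "\<lambda>s z. balanced_map.lift WT.T (\<lambda>x y. WT.pt x (WW.pt y z)) s"
    note gi = balanced_map.lift_pure[OF i] balanced_map.lift_add[OF i] balanced_map.lift_closed[OF i]
    have g_ract: "?g (s \<triangleleft>\<^bsub>?T\<^esub> a) z = ?g s (a \<triangleright>\<^bsub>?W\<^esub> z)"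
      if "s \<in> carrier ?T" "a \<in> carrier A" "z \<in> dual" for s a z
      using that by (induction s rule: WW.tensor_induct)
        (simp_all add: gi WW.tensor_pures WW.tensor_adds WW.tensor_closed W.ract_closed W.lact_closed
          WW.pure_balanced)
    have g_add: "?g s (z \<oplus>\<^bsub>?W\<^esub> z') = ?g s z \<oplus>\<^bsub>WT.T\<^esub> ?g s z'"
      if "s \<in> carrier ?T" "z \<in> dual" "z' \<in> dual" for s z z'
      using that by (induction s rule: WW.tensor_induct)
        (simp_all add: gi WW.pure_closed WT.pure_closed WW.pure_add_right WT.pure_add_right m2.G.add.m_ac)
    interpret f: balanced_map K A ?T ?W WT.T
      "\<lambda>s z. tensor_lift (tensor_group A ?W ?T) (\<lambda>x y. WT.pt x (WW.pt y z)) s"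
      by unfold_locales (simp_all add: i_eq gi g_ract g_add W.lact_closed)
    have assoc_eq: "tensor_assoc A ?W ?W ?W = f.lift"
      unfolding tensor_assoc_def f.lift_def unfolding tensor_group_eq ..
    have assoc_pure: "tensor_assoc A ?W ?W ?W (TW.pt s z) = ?g s z" if "s \<in> carrier ?T" "z \<in> dual" for s z
      using that by (simp add: assoc_eq f.lift_pure i_eq)
    have assoc_add: "tensor_assoc A ?W ?W ?W (s \<oplus>\<^bsub>TW.T\<^esub> t) =
        tensor_assoc A ?W ?W ?W s \<oplus>\<^bsub>WT.T\<^esub> tensor_assoc A ?W ?W ?W t"
      if "s \<in> carrier TW.T" "t \<in> carrier TW.T" for s t
      using that by (simp add: assoc_eq f.lift_add)
    \<comment> \<open>By left linearity of \<open>\<mu>\<close>, y \<otimes> z = \<mu>(\<epsilon>(y)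
      z) = \<epsilon>(y) \<mu>(z), and \<epsilon>(y) moves across the outer tensor sign: x \<otimes>
      (y \<otimes> z) = x \<epsilon>(y) \<otimes> \<mu>(z).\<close>
    have g_\<mu>: "?g s z = WT.pt (\<nu>.lift s) (\<mu> z)" if "s \<in> carrier ?T" "z \<in> dual" for s z
      using that
    proof (induction s rule: WW.tensor_induct)
      case (pure x y)
      have "WT.pt (x \<triangleleft>\<^bsub>?W\<^esub> \<epsilon> y) (\<mu> z) = WT.pt x (\<epsilon> y \<triangleright>\<^bsub>?T\<^esub> \<mu> z)"
        using pure by (intro WT.pure_balanced) (auto simp: \<epsilon>_closed \<mu>)
      also have "\<epsilon> y \<triangleright>\<^bsub>?T\<^esub> \<mu> z = \<mu> (\<nu>.lift (WW.pt y z))"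
        using pure by (simp add: \<mu>D \<epsilon>_closed \<nu>.lift_pure)
      also have "\<dots> = WW.pt y z" using pure by (intro \<mu>\<nu> WW.pure_closed)
      finally show ?case
        using pure by (simp add: gi \<nu>.lift_pure \<epsilon>_symmetric)
    qed (simp add: gi \<nu>.lift_add \<nu>.lift_closed WT.pure_add_left \<mu>)
    have "tensor_assoc A ?W ?W ?W (tensor_map A ?T ?W \<mu> (\<lambda>x. x) t) = tensor_map A ?W ?T (\<lambda>x. x) \<mu> t"
      if "t \<in> carrier WW.T" for t
      using that
    proof (induction t rule: WW.tensor_induct)
      case (pure u v)
      then show ?case
        by (simp add: m1.tensor_map_pure m2.tensor_map_pure assoc_pure g_\<mu> \<mu>)
    qed (simp add: m1.tensor_map_add m2.tensor_map_add m1.tensor_map_closed assoc_add)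
    from this[OF \<mu>(1)[OF w]]
    show "tensor_assoc A ?W ?W ?W (tensor_map A (tensor A ?W ?W) ?W \<mu> (\<lambda>x. x) (\<mu> w)) =
        tensor_map A ?W (tensor A ?W ?W) (\<lambda>x. x) \<mu> (\<mu> w)" .
  qed
  then show ?thesis by blast
qed

end

lemma finsum_additive:
  assumes G: "abelian_group G" and H: "abelian_group H" and I: "finite I" "g \<in> I \<rightarrow> carrier G"
    and h: "\<And>x. x \<in> carrier G \<Longrightarrow> h x \<in> carrier H"
      "\<And>x y. \<lbrakk>x \<in> carrier G; y \<in> carrier G\<rbrakk> \<Longrightarrow> h (x \<oplus>\<^bsub>G\<^esub> y) = h x \<oplus>\<^bsub>H\<^esub> h y"
  shows "h (finsum G g I) = finsum H (\<lambda>i. h (g i)) I"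
proof -
  interpret G: abelian_group G by fact
  interpret H: abelian_group H by fact
  have "h \<zero>\<^bsub>G\<^esub> = \<zero>\<^bsub>H\<^esub>"
    using h(2)[of "\<zero>\<^bsub>G\<^esub>" "\<zero>\<^bsub>G\<^esub>"] h(1)[of "\<zero>\<^bsub>G\<^esub>"] by simp
  note zero = this
  show ?thesis
    using I by (induction I rule: finite_induct) (auto simp: h zero Pi_iff)
qed

lemma rmod_homI:
  assumes "\<And>x. x \<in> carrier M \<Longrightarrow> f x \<in> carrier N"
    "\<And>x y. \<lbrakk>x \<in> carrier M; y \<in> carrier M\<rbrakk> \<Longrightarrow> f (x \<oplus>\<^bsub>M\<^esub> y) = f x \<oplus>\<^bsub>N\<^esub> f y"
    "\<And>k x. \<lbrakk>k \<in> carrier K; x \<in> carrier M\<rbrakk> \<Longrightarrow> f (k \<odot>\<^bsub>M\<^esub> x) = k \<odot>\<^bsub>N\<^esub> f x"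
    "\<And>x a. \<lbrakk>x \<in> carrier M; a \<in> carrier A\<rbrakk> \<Longrightarrow> f (x \<triangleleft>\<^bsub>M\<^esub> a) = f x \<triangleleft>\<^bsub>N\<^esub> a"
  shows "f \<in> rmod_hom K A M N"
  using assms by (auto simp: rmod_hom_def module_hom_def)

lemma rmod_homD:
  assumes "f \<in> rmod_hom K A M N"
  shows "x \<in> carrier M \<Longrightarrow> f x \<in> carrier N"
    and "\<lbrakk>x \<in> carrier M; y \<in> carrier M\<rbrakk> \<Longrightarrow> f (x \<oplus>\<^bsub>M\<^esub> y) = f x \<oplus>\<^bsub>N\<^esub> f y"
    and "\<lbrakk>k \<in> carrier K; x \<in> carrier M\<rbrakk> \<Longrightarrow> f (k \<odot>\<^bsub>M\<^esub> x) = k \<odot>\<^bsub>N\<^esub> f x"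
    and "\<lbrakk>x \<in> carrier M; a \<in> carrier A\<rbrakk> \<Longrightarrow> f (x \<triangleleft>\<^bsub>M\<^esub> a) = f x \<triangleleft>\<^bsub>N\<^esub> a"
  using assms by (auto simp: rmod_hom_def module_hom_def)

section \<open>Symmetric algebras through their trace forms\<close>

locale trace_form = B: fd_alg K B
  for K :: "('k, 'c) ring_scheme" and B :: "('k, 'b, 'f) module_scheme" and \<tau> :: "'b \<Rightarrow> 'k" +
  assumes \<tau>_dual: "\<tau> \<in> B.dual"
    and \<tau>_sym: "\<lbrakk>b \<in> carrier B; c \<in> carrier B\<rbrakk> \<Longrightarrow> \<tau> (b \<otimes>\<^bsub>B\<^esub> c) = \<tau> (c \<otimes>\<^bsub>B\<^esub> b)"
    and \<tau>_rep: "g \<in> B.dual \<Longrightarrow> \<exists>b\<in>carrier B. \<forall>c\<in>carrier B. g c = \<tau> (b \<otimes>\<^bsub>B\<^esub> c)"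
    and \<tau>_inj: "\<lbrakk>b \<in> carrier B; \<And>c. c \<in> carrier B \<Longrightarrow> \<tau> (b \<otimes>\<^bsub>B\<^esub> c) = \<zero>\<^bsub>K\<^esub>\<rbrakk> \<Longrightarrow> b = \<zero>\<^bsub>B\<^esub>"

text \<open>The form is the image of the unit under a bimodule isomorphism \<open>f\<close>. Left
  and right linearity express \<open>f b c\<close> as the form at c b and at b c, whence symmetry;
  bijectivity of \<open>f\<close> gives representability and nondegeneracy.\<close>

lemma symmetric_algebra_trace_form:
  assumes "symmetric_algebra K B"
  obtains \<tau> where "trace_form K B \<tau>"
proof -
  obtain f where B: "fd_algebra K B" and f: "f \<in> bimod_hom K B (regular_bimod B) (dual_bimod K B)"
    and bij: "bij_betw f (carrier (regular_bimod B)) (carrier (dual_bimod K B))"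
    using assms by (auto simp: symmetric_algebra_def bimod_isomorphic_def)
  interpret B: fd_alg K B
    using B by (simp add: fd_alg_def fd_algebra_def vectorspace_def)
  note fD = bimod_homD[OF f, unfolded B.regular_simps]
  let ?\<tau> = "f \<one>\<^bsub>B\<^esub>"
  have \<tau>: "?\<tau> \<in> B.dual" by (rule fD) simp
  have left: "f b c = ?\<tau> (c \<otimes>\<^bsub>B\<^esub> b)" if "b \<in> carrier B" "c \<in> carrier B" for b c
    using fun_cong[OF fD(5)[of "\<one>\<^bsub>B\<^esub>" b], of c] that by (simp add: B.dual_act_apply)
  have right: "f b c = ?\<tau> (b \<otimes>\<^bsub>B\<^esub> c)" if "b \<in> carrier B" "c \<in> carrier B" for b c
    using fun_cong[OF fD(4)[of "\<one>\<^bsub>B\<^esub>" b], of c] that by (simp add: B.dual_act_apply)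
  show ?thesis
  proof (rule that[of ?\<tau>], unfold_locales)
    show "?\<tau> \<in> B.dual" by (rule \<tau>)
    show "\<And>b c. \<lbrakk>b \<in> carrier B; c \<in> carrier B\<rbrakk> \<Longrightarrow> ?\<tau> (b \<otimes>\<^bsub>B\<^esub> c) = ?\<tau> (c \<otimes>\<^bsub>B\<^esub> b)"
      using left right by metis
    show "\<exists>b\<in>carrier B. \<forall>c\<in>carrier B. g c = ?\<tau> (b \<otimes>\<^bsub>B\<^esub> c)" if "g \<in> B.dual" for g
    proof -
      obtain b where "b \<in> carrier B" "g = f b"
        using bij \<open>g \<in> B.dual\<close> by (auto simp: bij_betw_def B.regular_simps)
      then show ?thesis using right by blast
    qed
    show "b = \<zero>\<^bsub>B\<^esub>" if b: "b \<in> carrier B" "\<And>c. c \<in> carrier B \<Longrightarrow> ?\<tau> (b \<otimes>\<^bsub>B\<^esub> c) = \<zero>\<^bsub>K\<^esub>" for b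
    proof -
      have "f b = f \<zero>\<^bsub>B\<^esub>"
        using b right[OF b(1)] right[of "\<zero>\<^bsub>B\<^esub>"] B.dual_zero[OF \<tau>] fD(1)
        by (intro B.dual_eqI) auto
      then show ?thesis
        using bij b(1) by (auto simp: bij_betw_def B.regular_simps inj_on_def)
    qed
  qed
qed

text \<open>\<open>sharp \<phi>\<close> is the \<open>B\<close>-linear map \<open>M \<rightarrow> B\<close> with \<open>\<phi> = \<tau> \<circ> sharp \<phi>\<close>.\<close>

locale trace_form_module = trace_form K B \<tau> + M: right_module K B M
  for K :: "('k, 'c) ring_scheme" and B :: "('k, 'b, 'f) module_scheme" and \<tau> :: "'b \<Rightarrow> 'k"
    and M :: "('k, 'b, 'm, 'z) rmod_scheme"
begin

definition sharp where
  "sharp \<phi> m = (SOME b. b \<in> carrier B \<and> (\<forall>c\<in>carrier B. \<phi> (m \<triangleleft>\<^bsub>M\<^esub> c) = \<tau> (b \<otimes>\<^bsub>B\<^esub> c)))"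

lemma sharp:
  assumes "\<phi> \<in> M.dual" "m \<in> carrier M"
  shows sharp_closed: "sharp \<phi> m \<in> carrier B"
    and sharp_trace: "c \<in> carrier B \<Longrightarrow> \<tau> (sharp \<phi> m \<otimes>\<^bsub>B\<^esub> c) = \<phi> (m \<triangleleft>\<^bsub>M\<^esub> c)"
proof -
  have "(\<lambda>c\<in>carrier B. \<phi> (m \<triangleleft>\<^bsub>M\<^esub> c)) \<in> B.dual"
    using assms by (intro B.dual_restrictI)
      (auto simp: M.dual_closed M.dual_add M.dual_smult M.ract_closed M.ract_add_right M.ract_smult_right)
  from \<tau>_rep[OF this] have "\<exists>b. b \<in> carrier B \<and> (\<forall>c\<in>carrier B. \<phi> (m \<triangleleft>\<^bsub>M\<^esub> c) = \<tau> (b \<otimes>\<^bsub>B\<^esub> c))"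
    by auto
  from someI_ex[OF this, folded sharp_def]
  show "sharp \<phi> m \<in> carrier B" "c \<in> carrier B \<Longrightarrow> \<tau> (sharp \<phi> m \<otimes>\<^bsub>B\<^esub> c) = \<phi> (m \<triangleleft>\<^bsub>M\<^esub> c)"
    by auto
qed

lemma trace_eqI:
  assumes b: "b \<in> carrier B" "b' \<in> carrier B"
    and eq: "\<And>c. c \<in> carrier B \<Longrightarrow> \<tau> (b \<otimes>\<^bsub>B\<^esub> c) = \<tau> (b' \<otimes>\<^bsub>B\<^esub> c)"
  shows "b = b'"
proof -
  have "b \<ominus>\<^bsub>B\<^esub> b' = \<zero>\<^bsub>B\<^esub>"
  proof (rule \<tau>_inj)
    fix c assume c: "c \<in> carrier B"
    have "\<tau> (b \<otimes>\<^bsub>B\<^esub> c) = \<tau> ((b \<ominus>\<^bsub>B\<^esub> b') \<otimes>\<^bsub>B\<^esub> c \<oplus>\<^bsub>B\<^esub> b' \<otimes>\<^bsub>B\<^esub> c)"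
      using b c by (simp add: a_minus_def B.A.l_distr B.A.l_minus B.A.a_assoc B.A.l_neg)
    also have "\<dots> = \<tau> ((b \<ominus>\<^bsub>B\<^esub> b') \<otimes>\<^bsub>B\<^esub> c) \<oplus>\<^bsub>K\<^esub> \<tau> (b \<otimes>\<^bsub>B\<^esub> c)"
      using b c by (simp add: B.dual_add[OF \<tau>_dual] eq)
    finally show "\<tau> ((b \<ominus>\<^bsub>B\<^esub> b') \<otimes>\<^bsub>B\<^esub> c) = \<zero>\<^bsub>K\<^esub>"
      using b c B.dual_closed[OF \<tau>_dual] by (simp add: B.K.add.l_cancel_one')
  qed (use b in simp)
  then show ?thesis using b by simp
qed

lemma sharp_eqI:
  assumes "\<phi> \<in> M.dual" "m \<in> carrier M" "b \<in> carrier B"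
    "\<And>c. c \<in> carrier B \<Longrightarrow> \<phi> (m \<triangleleft>\<^bsub>M\<^esub> c) = \<tau> (b \<otimes>\<^bsub>B\<^esub> c)"
  shows "sharp \<phi> m = b"
  using assms by (intro trace_eqI) (auto simp: sharp)

lemma sharp_add:
  "\<lbrakk>\<phi> \<in> M.dual; m \<in> carrier M; n \<in> carrier M\<rbrakk> \<Longrightarrow> sharp \<phi> (m \<oplus>\<^bsub>M\<^esub> n) = sharp \<phi> m \<oplus>\<^bsub>B\<^esub> sharp \<phi> n"
  by (rule sharp_eqI) (auto simp: sharp M.ract_add_left M.dual_add M.ract_closed B.A.l_distr
      B.dual_add[OF \<tau>_dual])

lemma sharp_smult:
  "\<lbrakk>\<phi> \<in> M.dual; m \<in> carrier M; k \<in> carrier K\<rbrakk> \<Longrightarrow> sharp \<phi> (k \<odot>\<^bsub>M\<^esub> m) = k \<odot>\<^bsub>B\<^esub> sharp \<phi> m"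
  by (rule sharp_eqI) (auto simp: sharp M.ract_smult_left M.dual_smult M.ract_closed B.smult_mult_left
      B.dual_smult[OF \<tau>_dual])

lemma sharp_ract:
  "\<lbrakk>\<phi> \<in> M.dual; m \<in> carrier M; b \<in> carrier B\<rbrakk> \<Longrightarrow> sharp \<phi> (m \<triangleleft>\<^bsub>M\<^esub> b) = sharp \<phi> m \<otimes>\<^bsub>B\<^esub> b"
  by (rule sharp_eqI) (auto simp: sharp M.ract_closed B.A.m_assoc simp flip: M.ract_mult)

lemma sharp_dual_add:
  "\<lbrakk>\<phi> \<in> M.dual; \<psi> \<in> M.dual; m \<in> carrier M\<rbrakk> \<Longrightarrow>
    sharp (\<phi> \<oplus>\<^bsub>dual_bimod K M\<^esub> \<psi>) m = sharp \<phi> m \<oplus>\<^bsub>B\<^esub> sharp \<psi> m"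
proof (rule sharp_eqI)
  interpret D: vectorspace K "dual_bimod K M" by (rule M.dual_vectorspace)
  show "\<lbrakk>\<phi> \<in> M.dual; \<psi> \<in> M.dual\<rbrakk> \<Longrightarrow> \<phi> \<oplus>\<^bsub>dual_bimod K M\<^esub> \<psi> \<in> M.dual" by simp
qed (auto simp: sharp M.dual_ops M.ract_closed B.A.l_distr B.dual_add[OF \<tau>_dual])

lemma sharp_dual_smult:
  "\<lbrakk>\<phi> \<in> M.dual; k \<in> carrier K; m \<in> carrier M\<rbrakk> \<Longrightarrow>
    sharp (k \<odot>\<^bsub>dual_bimod K M\<^esub> \<phi>) m = k \<odot>\<^bsub>B\<^esub> sharp \<phi> m"
proof (rule sharp_eqI)
  interpret D: vectorspace K "dual_bimod K M" by (rule M.dual_vectorspace)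
  show "\<lbrakk>\<phi> \<in> M.dual; k \<in> carrier K\<rbrakk> \<Longrightarrow> k \<odot>\<^bsub>dual_bimod K M\<^esub> \<phi> \<in> M.dual" by simp
qed (auto simp: sharp M.dual_ops M.ract_closed B.smult_mult_left B.dual_smult[OF \<tau>_dual])

text \<open>The left action of B on the dual of M. \<open>sharp\<close> is left linear for it, and
  this is where symmetry of \<open>\<tau>\<close> enters.\<close>

definition twist where "twist b \<phi> = (\<lambda>m\<in>carrier M. \<phi> (m \<triangleleft>\<^bsub>M\<^esub> b))"

lemma twist_dual: "\<lbrakk>b \<in> carrier B; \<phi> \<in> M.dual\<rbrakk> \<Longrightarrow> twist b \<phi> \<in> M.dual"
  unfolding twist_def by (rule M.dual_restrictI)
    (auto simp: M.dual_closed M.dual_add M.dual_smult M.ract_closed M.ract_add_left M.ract_smult_left)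

lemma sharp_twist:
  assumes "b \<in> carrier B" "\<phi> \<in> M.dual" "m \<in> carrier M"
  shows "sharp (twist b \<phi>) m = b \<otimes>\<^bsub>B\<^esub> sharp \<phi> m"
proof (rule sharp_eqI[OF twist_dual])
  fix c assume c: "c \<in> carrier B"
  have "twist b \<phi> (m \<triangleleft>\<^bsub>M\<^esub> c) = \<phi> (m \<triangleleft>\<^bsub>M\<^esub> (c \<otimes>\<^bsub>B\<^esub> b))"
    using assms c by (simp add: twist_def M.ract_closed M.ract_mult)
  also have "\<dots> = \<tau> ((sharp \<phi> m \<otimes>\<^bsub>B\<^esub> c) \<otimes>\<^bsub>B\<^esub> b)"
    using assms c sharp_trace[of \<phi> m "c \<otimes>\<^bsub>B\<^esub> b"] by (simp add: sharp_closed B.A.m_assoc)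
  also have "\<dots> = \<tau> (b \<otimes>\<^bsub>B\<^esub> sharp \<phi> m \<otimes>\<^bsub>B\<^esub> c)"
    using assms c \<tau>_sym[of "sharp \<phi> m \<otimes>\<^bsub>B\<^esub> c" b] by (simp add: sharp_closed B.A.m_assoc)
  finally show "twist b \<phi> (m \<triangleleft>\<^bsub>M\<^esub> c) = \<tau> (b \<otimes>\<^bsub>B\<^esub> sharp \<phi> m \<otimes>\<^bsub>B\<^esub> c)" .
qed (use assms sharp_closed in auto)

end

section \<open>The counit attached to a generator and its endomorphism algebra\<close>

text \<open>\<open>M\<close> being a generator is expressed by finitely many \<open>B\<close>-linear maps \<open>sharp (\<phi> i) : M \<rightarrow> B\<close> and
  elements \<open>s i\<close> of \<open>M\<close> with \<open>\<Sum> sharp (\<phi> i) (s i) = 1\<close>.\<close>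

locale endomorphism_action = fd_alg K A + trace_form_module K B \<tau> M
  for K :: "('k, 'c) ring_scheme" and A :: "('k, 'a, 'e) module_scheme" (structure)
    and B :: "('k, 'b, 'f) module_scheme" and \<tau> :: "'b \<Rightarrow> 'k"
    and M :: "('k, 'b, 'm, 'z) rmod_scheme" +
  fixes act :: "'a \<Rightarrow> 'm \<Rightarrow> 'm" (infixr \<open>\<cdot>\<close> 75)
    and I :: "'i set" and \<phi> :: "'i \<Rightarrow> 'm \<Rightarrow> 'k" and s :: "'i \<Rightarrow> 'm"
  assumes M_fin: "M.fin_dim"
    and act_hom: "a \<in> carrier A \<Longrightarrow> act a \<in> rmod_hom K B M M"
    and act_add: "\<lbrakk>a \<in> carrier A; b \<in> carrier A; m \<in> carrier M\<rbrakk> \<Longrightarrow> (a \<oplus> b) \<cdot> m = a \<cdot> m \<oplus>\<^bsub>M\<^esub> b \<cdot> m"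
    and act_smult: "\<lbrakk>k \<in> carrier K; a \<in> carrier A; m \<in> carrier M\<rbrakk> \<Longrightarrow> (k \<odot> a) \<cdot> m = k \<odot>\<^bsub>M\<^esub> (a \<cdot> m)"
    and act_mult: "\<lbrakk>a \<in> carrier A; b \<in> carrier A; m \<in> carrier M\<rbrakk> \<Longrightarrow> (a \<otimes> b) \<cdot> m = a \<cdot> (b \<cdot> m)"
    and act_inj: "\<lbrakk>a \<in> carrier A; b \<in> carrier A; \<And>m. m \<in> carrier M \<Longrightarrow> a \<cdot> m = b \<cdot> m\<rbrakk> \<Longrightarrow> a = b"
    and act_surj: "f \<in> rmod_hom K B M M \<Longrightarrow> \<exists>a\<in>carrier A. \<forall>m\<in>carrier M. a \<cdot> m = f m"
    and I: "finite I" and \<phi>: "i \<in> I \<Longrightarrow> \<phi> i \<in> M.dual" and s: "i \<in> I \<Longrightarrow> s i \<in> carrier M"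
    and generates: "(\<Oplus>\<^bsub>B\<^esub>i\<in>I. sharp (\<phi> i) (s i)) = \<one>\<^bsub>B\<^esub>"
begin

lemmas act_closed = rmod_homD(1)[OF act_hom]
  and act_add_right = rmod_homD(2)[OF act_hom]
  and act_smult_right = rmod_homD(3)[OF act_hom]
  and act_ract = rmod_homD(4)[OF act_hom]

lemma module_expand:
  assumes m: "m \<in> carrier M"
  shows "m = (\<Oplus>\<^bsub>M\<^esub>i\<in>I. m \<triangleleft>\<^bsub>M\<^esub> sharp (\<phi> i) (s i))"
proof -
  have "m = m \<triangleleft>\<^bsub>M\<^esub> (\<Oplus>\<^bsub>B\<^esub>i\<in>I. sharp (\<phi> i) (s i))" using m by (simp add: generates M.ract_one)
  also have "\<dots> = (\<Oplus>\<^bsub>M\<^esub>i\<in>I. m \<triangleleft>\<^bsub>M\<^esub> sharp (\<phi> i) (s i))"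
    using m sharp_closed \<phi> s
    by (intro finsum_additive B.A.abelian_group_axioms M.M.abelian_group_axioms I)
      (auto simp: M.ract_closed M.ract_add_right)
  finally show ?thesis .
qed

text \<open>The rank-one operator of \<open>m\<close> and \<open>\<psi>\<close>, as an element of A.
  With D(M) identified with the B-linear maps from M to B, this is the standard map from M \<otimes>
  D(M), taken over B, to the endomorphisms of M.\<close>

definition rk where
  "rk m \<psi> = (SOME a. a \<in> carrier A \<and> (\<forall>n\<in>carrier M. a \<cdot> n = m \<triangleleft>\<^bsub>M\<^esub> sharp \<psi> n))"

lemma rk:
  assumes "m \<in> carrier M" "\<psi> \<in> M.dual"
  shows rk_closed: "rk m \<psi> \<in> carrier A" and rk_act: "n \<in> carrier M \<Longrightarrow> rk m \<psi> \<cdot> n = m \<triangleleft>\<^bsub>M\<^esub> sharp \<psi> n"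
proof -
  have "(\<lambda>n. m \<triangleleft>\<^bsub>M\<^esub> sharp \<psi> n) \<in> rmod_hom K B M M"
    using assms by (intro rmod_homI) (auto simp: M.ract_closed sharp_closed sharp_add sharp_smult
        sharp_ract M.ract_add_right M.ract_smult_right M.ract_mult)
  from act_surj[OF this] have "\<exists>a. a \<in> carrier A \<and> (\<forall>n\<in>carrier M. a \<cdot> n = m \<triangleleft>\<^bsub>M\<^esub> sharp \<psi> n)"
    by blast
  from someI_ex[OF this, folded rk_def]
  show "rk m \<psi> \<in> carrier A" "n \<in> carrier M \<Longrightarrow> rk m \<psi> \<cdot> n = m \<triangleleft>\<^bsub>M\<^esub> sharp \<psi> n" by auto
qed

lemma rk_eqI:
  assumes "m \<in> carrier M" "\<psi> \<in> M.dual" "a \<in> carrier A"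
    "\<And>n. n \<in> carrier M \<Longrightarrow> a \<cdot> n = m \<triangleleft>\<^bsub>M\<^esub> sharp \<psi> n"
  shows "rk m \<psi> = a"
  using assms by (intro act_inj) (auto simp: rk)

text \<open>The right action of A on D(M) dual to its left action on M.\<close>

definition pull where "pull a \<psi> = (\<lambda>m\<in>carrier M. \<psi> (a \<cdot> m))"

lemma pull_dual: "\<lbrakk>a \<in> carrier A; \<psi> \<in> M.dual\<rbrakk> \<Longrightarrow> pull a \<psi> \<in> M.dual"
  unfolding pull_def by (rule M.dual_restrictI)
    (auto simp: M.dual_closed M.dual_add M.dual_smult act_closed act_add_right act_smult_right)

lemma sharp_pull:
  "\<lbrakk>a \<in> carrier A; \<psi> \<in> M.dual; m \<in> carrier M\<rbrakk> \<Longrightarrow> sharp (pull a \<psi>) m = sharp \<psi> (a \<cdot> m)"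
  by (rule sharp_eqI[OF pull_dual])
    (auto simp: pull_def sharp act_closed act_ract M.ract_closed)

text \<open>Together these say that \<open>rk\<close> is balanced over B and induces an A-bimodule
  map from M \<otimes> D(M) to A.\<close>

lemma rk_simps:
  assumes m: "m \<in> carrier M" and \<psi>: "\<psi> \<in> M.dual"
  shows rk_add_left: "n \<in> carrier M \<Longrightarrow> rk (m \<oplus>\<^bsub>M\<^esub> n) \<psi> = rk m \<psi> \<oplus> rk n \<psi>"
    and rk_smult_left: "k \<in> carrier K \<Longrightarrow> rk (k \<odot>\<^bsub>M\<^esub> m) \<psi> = k \<odot> rk m \<psi>"
    and rk_add_right: "\<chi> \<in> M.dual \<Longrightarrow> rk m (\<psi> \<oplus>\<^bsub>dual_bimod K M\<^esub> \<chi>) = rk m \<psi> \<oplus> rk m \<chi>"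
    and rk_smult_right: "k \<in> carrier K \<Longrightarrow> rk m (k \<odot>\<^bsub>dual_bimod K M\<^esub> \<psi>) = k \<odot> rk m \<psi>"
    and rk_ract: "b \<in> carrier B \<Longrightarrow> rk (m \<triangleleft>\<^bsub>M\<^esub> b) \<psi> = rk m (twist b \<psi>)"
    and rk_lmult: "a \<in> carrier A \<Longrightarrow> rk (a \<cdot> m) \<psi> = a \<otimes> rk m \<psi>"
    and rk_rmult: "a \<in> carrier A \<Longrightarrow> rk m (pull a \<psi>) = rk m \<psi> \<otimes> a"
proof -
  interpret D: vectorspace K "dual_bimod K M" by (rule M.dual_vectorspace)
  show "n \<in> carrier M \<Longrightarrow> rk (m \<oplus>\<^bsub>M\<^esub> n) \<psi> = rk m \<psi> \<oplus> rk n \<psi>"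
    "k \<in> carrier K \<Longrightarrow> rk (k \<odot>\<^bsub>M\<^esub> m) \<psi> = k \<odot> rk m \<psi>"
    "\<chi> \<in> M.dual \<Longrightarrow> rk m (\<psi> \<oplus>\<^bsub>dual_bimod K M\<^esub> \<chi>) = rk m \<psi> \<oplus> rk m \<chi>"
    "k \<in> carrier K \<Longrightarrow> rk m (k \<odot>\<^bsub>dual_bimod K M\<^esub> \<psi>) = k \<odot> rk m \<psi>"
    "b \<in> carrier B \<Longrightarrow> rk (m \<triangleleft>\<^bsub>M\<^esub> b) \<psi> = rk m (twist b \<psi>)"
    "a \<in> carrier A \<Longrightarrow> rk (a \<cdot> m) \<psi> = a \<otimes> rk m \<psi>"
    "a \<in> carrier A \<Longrightarrow> rk m (pull a \<psi>) = rk m \<psi> \<otimes> a"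
    by (rule rk_eqI; use m \<psi> in \<open>simp add: rk sharp_closed act_add act_smult act_mult act_closed
      act_ract M.ract_closed M.ract_add_left M.ract_add_right M.ract_smult_left M.ract_smult_right
      M.ract_mult sharp_dual_add sharp_dual_smult sharp_twist twist_dual sharp_pull pull_dual\<close>)+
qed

definition matrix_coeff where "matrix_coeff m \<psi> = (\<lambda>a\<in>carrier A. \<psi> (a \<cdot> m))"

lemma matrix_coeff_dual: "\<lbrakk>m \<in> carrier M; \<psi> \<in> M.dual\<rbrakk> \<Longrightarrow> matrix_coeff m \<psi> \<in> dual"
  unfolding matrix_coeff_def by (rule dual_restrictI)
    (auto simp: M.dual_closed M.dual_add M.dual_smult act_closed act_add act_smult)

lemma act_zero: "m \<in> carrier M \<Longrightarrow> \<zero> \<cdot> m = \<zero>\<^bsub>M\<^esub>"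
  using act_add[of \<zero> \<zero> m] act_closed[of \<zero> m] by simp

text \<open>An element of A killed by all coefficient functionals acts as zero on M, and the action
  is faithful.\<close>

lemma matrix_coeff_span:
  assumes U: "submodule K U \<D>"
    and matrix_coeff: "\<And>m \<psi>. \<lbrakk>m \<in> carrier M; \<psi> \<in> M.dual\<rbrakk> \<Longrightarrow> matrix_coeff m \<psi> \<in> U"
  shows "U = dual"
proof (rule dual_submodule_eqI[OF finite_dimensional U])
  fix a assume a: "a \<in> carrier A" and zero: "\<And>u. u \<in> U \<Longrightarrow> u a = \<zero>\<^bsub>K\<^esub>"
  show "a = \<zero>"
  proof (rule act_inj[OF a A.zero_closed])
    fix m assume m: "m \<in> carrier M"
    have "a \<cdot> m = \<zero>\<^bsub>M\<^esub>"
    proof (rule M.dual_separates_points[OF M_fin])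
      fix \<psi> assume "\<psi> \<in> M.dual"
      then show "\<psi> (a \<cdot> m) = \<zero>\<^bsub>K\<^esub>"
        using zero[OF matrix_coeff[OF m]] a by (simp add: matrix_coeff_def)
    qed (use a m act_closed in blast)
    then show "a \<cdot> m = \<zero> \<cdot> m" using m by (simp add: act_zero)
  qed
qed

text \<open>The counit is the transpose of \<open>rk\<close>: \<psi>(\<epsilon>(w) m) = w(rk m
  \<psi>). Defining it by duality gives a value at every \<open>w\<close> at once, with no
  well-definedness to check on sums of coefficient functionals; \<open>eps_matrix_coeff\<close>
  recovers the formula on those.\<close>

definition \<epsilon>_fun where
  "\<epsilon>_fun w m = (SOME n. n \<in> carrier M \<and> (\<forall>\<psi>\<in>M.dual. \<psi> n = w (rk m \<psi>)))"

lemma \<epsilon>_fun: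
  assumes w: "w \<in> dual" and m: "m \<in> carrier M"
  shows "\<epsilon>_fun w m \<in> carrier M" "\<psi> \<in> M.dual \<Longrightarrow> \<psi> (\<epsilon>_fun w m) = w (rk m \<psi>)"
proof -
  obtain n where "n \<in> carrier M" "\<And>\<psi>. \<psi> \<in> M.dual \<Longrightarrow> w (rk m \<psi>) = \<psi> n"
    by (rule M.dual_reflexive[OF M_fin, of "\<lambda>\<psi>. w (rk m \<psi>)"])
      (use w m in \<open>auto simp: dual_closed rk_closed rk_add_right rk_smult_right dual_add dual_smult\<close>)
  then have "\<exists>n. n \<in> carrier M \<and> (\<forall>\<psi>\<in>M.dual. \<psi> n = w (rk m \<psi>))" by auto
  from someI_ex[OF this, folded \<epsilon>_fun_def]
  show "\<epsilon>_fun w m \<in> carrier M" "\<psi> \<in> M.dual \<Longrightarrow> \<psi> (\<epsilon>_fun w m) = w (rk m \<psi>)" by auto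
qed

lemma \<epsilon>_fun_hom:
  assumes w: "w \<in> dual"
  shows "\<epsilon>_fun w \<in> rmod_hom K B M M"
proof (rule rmod_homI)
  fix m n assume "m \<in> carrier M" "n \<in> carrier M"
  then show "\<epsilon>_fun w (m \<oplus>\<^bsub>M\<^esub> n) = \<epsilon>_fun w m \<oplus>\<^bsub>M\<^esub> \<epsilon>_fun w n"
    using w by (intro M.dual_eq_points[OF M_fin])
      (auto simp: \<epsilon>_fun M.dual_add rk_add_left rk_closed dual_add)
next
  fix k m assume "k \<in> carrier K" "m \<in> carrier M"
  then show "\<epsilon>_fun w (k \<odot>\<^bsub>M\<^esub> m) = k \<odot>\<^bsub>M\<^esub> \<epsilon>_fun w m"
    using w by (intro M.dual_eq_points[OF M_fin])
      (auto simp: \<epsilon>_fun M.dual_smult rk_smult_left rk_closed dual_smult)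
next
  fix m b assume mb: "m \<in> carrier M" "b \<in> carrier B"
  show "\<epsilon>_fun w (m \<triangleleft>\<^bsub>M\<^esub> b) = \<epsilon>_fun w m \<triangleleft>\<^bsub>M\<^esub> b"
  proof (rule M.dual_eq_points[OF M_fin])
    fix \<psi> assume \<psi>: "\<psi> \<in> M.dual"
    have "\<psi> (\<epsilon>_fun w m \<triangleleft>\<^bsub>M\<^esub> b) = twist b \<psi> (\<epsilon>_fun w m)"
      using w mb by (simp add: twist_def \<epsilon>_fun)
    also have "\<dots> = w (rk m (twist b \<psi>))" using w mb \<psi> by (intro \<epsilon>_fun twist_dual)
    finally show "\<psi> (\<epsilon>_fun w (m \<triangleleft>\<^bsub>M\<^esub> b)) = \<psi> (\<epsilon>_fun w m \<triangleleft>\<^bsub>M\<^esub> b)"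
      using w mb \<psi> by (simp add: \<epsilon>_fun M.ract_closed rk_ract)
  qed (use w mb in \<open>auto simp: \<epsilon>_fun M.ract_closed\<close>)
qed (use w \<epsilon>_fun in blast)

definition \<epsilon> where "\<epsilon> w = (SOME a. a \<in> carrier A \<and> (\<forall>m\<in>carrier M. a \<cdot> m = \<epsilon>_fun w m))"

lemma \<epsilon>:
  assumes w: "w \<in> dual"
  shows eps_closed: "\<epsilon> w \<in> carrier A"
    and eps_act: "\<lbrakk>m \<in> carrier M; \<psi> \<in> M.dual\<rbrakk> \<Longrightarrow> \<psi> (\<epsilon> w \<cdot> m) = w (rk m \<psi>)"
proof -
  have "\<exists>a. a \<in> carrier A \<and> (\<forall>m\<in>carrier M. a \<cdot> m = \<epsilon>_fun w m)"
    using act_surj[OF \<epsilon>_fun_hom[OF w]] by blast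
  from someI_ex[OF this, folded \<epsilon>_def] \<epsilon>_fun[OF w]
  show "\<epsilon> w \<in> carrier A" "\<lbrakk>m \<in> carrier M; \<psi> \<in> M.dual\<rbrakk> \<Longrightarrow> \<psi> (\<epsilon> w \<cdot> m) = w (rk m \<psi>)" by auto
qed

lemma eps_eqI:
  assumes "w \<in> dual" "a \<in> carrier A"
    "\<And>m \<psi>. \<lbrakk>m \<in> carrier M; \<psi> \<in> M.dual\<rbrakk> \<Longrightarrow> \<psi> (a \<cdot> m) = w (rk m \<psi>)"
  shows "\<epsilon> w = a"
proof (rule act_inj)
  fix m assume "m \<in> carrier M"
  then show "\<epsilon> w \<cdot> m = a \<cdot> m"
    using assms by (intro M.dual_eq_points[OF M_fin]) (auto simp: \<epsilon> act_closed)
qed (use assms \<epsilon> in auto)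

lemma eps_hom: "\<epsilon> \<in> bimod_hom K A \<D> (regular_bimod A)"
proof (rule bimod_homI; unfold regular_simps)
  fix v w assume "v \<in> dual" "w \<in> dual"
  then show "\<epsilon> (v \<oplus>\<^bsub>\<D>\<^esub> w) = \<epsilon> v \<oplus> \<epsilon> w"
    by (intro eps_eqI) (auto simp: \<epsilon> act_add M.dual_add act_closed dual_act_apply rk_closed)
next
  fix k w assume "k \<in> carrier K" "w \<in> dual"
  then show "\<epsilon> (k \<odot>\<^bsub>\<D>\<^esub> w) = k \<odot> \<epsilon> w"
    by (intro eps_eqI) (auto simp: \<epsilon> act_smult M.dual_smult act_closed dual_act_apply rk_closed)
next
  fix w a assume wa: "w \<in> dual" "a \<in> carrier A"
  show "\<epsilon> (w \<triangleleft>\<^bsub>\<D>\<^esub> a) = \<epsilon> w \<otimes> a"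
    using wa by (intro eps_eqI)
      (auto simp: \<epsilon> act_mult act_closed dual_act_apply rk_closed rk_lmult W.ract_closed)
  show "\<epsilon> (a \<triangleright>\<^bsub>\<D>\<^esub> w) = a \<otimes> \<epsilon> w"
  proof (rule eps_eqI)
    fix m \<psi> assume m: "m \<in> carrier M" and \<psi>: "\<psi> \<in> M.dual"
    have "\<psi> ((a \<otimes> \<epsilon> w) \<cdot> m) = pull a \<psi> (\<epsilon> w \<cdot> m)"
      using wa m by (simp add: pull_def act_mult \<epsilon> act_closed)
    also have "\<dots> = w (rk m (pull a \<psi>))" using wa m \<psi> by (intro eps_act pull_dual)
    also have "\<dots> = (a \<triangleright>\<^bsub>\<D>\<^esub> w) (rk m \<psi>)"
      using wa m \<psi> by (simp add: rk_rmult dual_act_apply rk_closed)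
    finally show "\<psi> ((a \<otimes> \<epsilon> w) \<cdot> m) = (a \<triangleright>\<^bsub>\<D>\<^esub> w) (rk m \<psi>)" .
  qed (use wa \<epsilon> in \<open>auto intro: W.lact_closed\<close>)
qed (rule \<epsilon>)

lemmas eps_simps = bimod_homD[OF eps_hom, unfolded regular_simps]

text \<open>Both sides of the defining equation are traces of the product of
  \<open>sharp \<chi> m\<close> and \<open>sharp \<psi> n\<close>, in the two possible
  orders.\<close>

lemma eps_matrix_coeff:
  assumes m: "m \<in> carrier M" and \<psi>: "\<psi> \<in> M.dual"
  shows "\<epsilon> (matrix_coeff m \<psi>) = rk m \<psi>"
proof (rule eps_eqI)
  fix n \<chi> assume n: "n \<in> carrier M" "\<chi> \<in> M.dual"
  have "\<chi> (rk m \<psi> \<cdot> n) = \<tau> (sharp \<chi> m \<otimes>\<^bsub>B\<^esub> sharp \<psi> n)"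
    using assms n by (simp add: rk sharp)
  also have "\<dots> = \<tau> (sharp \<psi> n \<otimes>\<^bsub>B\<^esub> sharp \<chi> m)" using assms n by (intro \<tau>_sym sharp_closed)
  also have "\<dots> = \<psi> (rk n \<chi> \<cdot> m)" using assms n by (simp add: rk sharp)
  finally show "\<chi> (rk m \<psi> \<cdot> n) = matrix_coeff m \<psi> (rk n \<chi>)" using n by (simp add: matrix_coeff_def rk_closed)
qed (use assms in \<open>auto intro: matrix_coeff_dual rk_closed\<close>)

text \<open>The identity is linear in \<open>u\<close>, so a coefficient functional may be taken.
  Both sides at \<open>x\<close> are then \<psi>(\<epsilon>(v) x m), by the transposition
  formula.\<close>

lemma eps_symmetric:
  assumes "u \<in> dual" "v \<in> dual"
  shows "\<epsilon> u \<triangleright>\<^bsub>\<D>\<^esub> v = u \<triangleleft>\<^bsub>\<D>\<^esub> \<epsilon> v"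
proof -
  let ?U = "{u \<in> dual. \<epsilon> u \<triangleright>\<^bsub>\<D>\<^esub> v = u \<triangleleft>\<^bsub>\<D>\<^esub> \<epsilon> v}"
  have "?U = dual"
  proof (rule matrix_coeff_span)
    have "\<epsilon> \<zero>\<^bsub>\<D>\<^esub> = \<zero>"
      using eps_simps(2)[of "\<zero>\<^bsub>\<D>\<^esub>" "\<zero>\<^bsub>\<D>\<^esub>"] eps_closed[of "\<zero>\<^bsub>\<D>\<^esub>"]
      by simp
    then have zero: "\<zero>\<^bsub>\<D>\<^esub> \<in> ?U"
      using assms(2) by (auto simp: dual_bimod_def fun_eq_iff dual_zero eps_closed)
    show "submodule K ?U \<D>"
      using zero assms(2) by unfold_locales
        (auto simp: eps_simps W.lact_add_left W.ract_add_left W.lact_smult_left W.ract_smult_left)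
    fix m \<psi> assume m: "m \<in> carrier M" "\<psi> \<in> M.dual"
    have "\<epsilon> (matrix_coeff m \<psi>) \<triangleright>\<^bsub>\<D>\<^esub> v = matrix_coeff m \<psi> \<triangleleft>\<^bsub>\<D>\<^esub> \<epsilon> v"
    proof (rule dual_eqI)
      fix x assume x: "x \<in> carrier A"
      have "(\<epsilon> (matrix_coeff m \<psi>) \<triangleright>\<^bsub>\<D>\<^esub> v) x = v (rk (x \<cdot> m) \<psi>)"
        using x m by (simp add: eps_matrix_coeff dual_act_apply rk_lmult)
      also have "\<dots> = \<psi> (\<epsilon> v \<cdot> x \<cdot> m)" using x m assms(2) by (simp add: eps_act act_closed)
      also have "\<dots> = (matrix_coeff m \<psi> \<triangleleft>\<^bsub>\<D>\<^esub> \<epsilon> v) x"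
        using x m assms(2) by (simp add: dual_act_apply matrix_coeff_def eps_closed act_mult)
      finally show "(\<epsilon> (matrix_coeff m \<psi>) \<triangleright>\<^bsub>\<D>\<^esub> v) x = (matrix_coeff m \<psi> \<triangleleft>\<^bsub>\<D>\<^esub> \<epsilon> v) x" .
    qed (use m assms(2) in \<open>auto intro!: W.lact_closed W.ract_closed eps_closed matrix_coeff_dual\<close>)
    then show "matrix_coeff m \<psi> \<in> ?U" using m matrix_coeff_dual by simp
  qed
  then show ?thesis using assms by blast
qed

sublocale counit_data K A \<epsilon>
  by unfold_locales (use eps_hom eps_symmetric in auto)

text \<open>If \<open>x\<close> annihilates all counit values, it annihilates the operators
  \<open>rk m (\<phi> i)\<close>. Evaluating at \<open>s i\<close> and summing over \<open>i\<close>
  gives x m = 0, because \<open>sharp (\<phi> i) (s i)\<close> sums to the unit.\<close>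

lemma eps_faithful:
  assumes x: "x \<in> carrier A" and zero: "\<And>u. u \<in> dual \<Longrightarrow> x \<otimes> \<epsilon> u = \<zero>"
  shows "x = \<zero>"
proof (rule act_inj[OF x A.zero_closed])
  fix m assume m: "m \<in> carrier M"
  have "(x \<cdot> m) \<triangleleft>\<^bsub>M\<^esub> sharp (\<phi> i) (s i) = \<zero>\<^bsub>M\<^esub>" if i: "i \<in> I" for i
  proof -
    have "x \<otimes> rk m (\<phi> i) = \<zero>" using zero[OF matrix_coeff_dual[OF m \<phi>[OF i]]] m \<phi>[OF i] by (simp add: eps_matrix_coeff)
    then have "rk (x \<cdot> m) (\<phi> i) = \<zero>" using m x \<phi>[OF i] by (simp add: rk_lmult)
    then have "rk (x \<cdot> m) (\<phi> i) \<cdot> s i = \<zero>\<^bsub>M\<^esub>" using act_zero s[OF i] by simp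
    then show ?thesis using m x \<phi>[OF i] s[OF i] by (simp add: rk act_closed)
  qed
  then have "x \<cdot> m = (\<Oplus>\<^bsub>M\<^esub>i\<in>I. \<zero>\<^bsub>M\<^esub>)"
    using module_expand[OF act_closed[OF x m]] by (simp cong: M.M.finsum_cong')
  then show "x \<cdot> m = \<zero> \<cdot> m" using m by (simp add: act_zero)
qed

text \<open>The value of \<epsilon>(u) v at \<open>x\<close> is v(x \<epsilon>(u)), so a point
  killed by the whole image is zero by \<open>eps_faithful\<close>.\<close>

lemma \<nu>_surj: "\<nu>.lift ` carrier WW.T = dual"
proof (rule dual_submodule_eqI[OF finite_dimensional])
  interpret T: bimodule K A WW.T by (rule WW.tensor_bimodule)
  note D = bimod_homD[OF \<nu>_hom]
  show "submodule K (\<nu>.lift ` carrier WW.T) \<D>"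
  proof unfold_locales
    show "\<zero>\<^bsub>\<D>\<^esub> \<in> \<nu>.lift ` carrier WW.T"
      using \<nu>.lift_zero T.M.zero_closed by (metis imageI)
  qed (auto simp: D(1) simp flip: D(2,3))
  fix x assume x: "x \<in> carrier A" and zero: "\<And>w. w \<in> \<nu>.lift ` carrier WW.T \<Longrightarrow> w x = \<zero>\<^bsub>K\<^esub>"
  show "x = \<zero>"
  proof (rule eps_faithful[OF x])
    fix u assume u: "u \<in> dual"
    show "x \<otimes> \<epsilon> u = \<zero>"
    proof (rule dual_separates_points[OF finite_dimensional])
      fix v assume v: "v \<in> dual"
      have "\<nu>.lift (WW.pt u v) x = \<zero>\<^bsub>K\<^esub>" using u v WW.pure_closed by (intro zero imageI)
      then show "v (x \<otimes> \<epsilon> u) = \<zero>\<^bsub>K\<^esub>" using u v x by (simp add: \<nu>.lift_pure dual_act_apply)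
    qed (use x u eps_closed in simp)
  qed
qed

text \<open>A right linear \<open>\<theta> : D(A) \<rightarrow> A\<close> is determined by the endomorphism
  \<open>\<alpha>(m) = \<Sum> \<theta>(matrix_coeff m (\<phi> i)) (s i)\<close> of \<open>M\<close>.\<close>

lemma right_linear_eps:
  assumes \<theta>: "\<And>w. w \<in> dual \<Longrightarrow> \<theta> w \<in> carrier A"
    "\<And>v w. \<lbrakk>v \<in> dual; w \<in> dual\<rbrakk> \<Longrightarrow> \<theta> (v \<oplus>\<^bsub>\<D>\<^esub> w) = \<theta> v \<oplus> \<theta> w"
    "\<And>k w. \<lbrakk>k \<in> carrier K; w \<in> dual\<rbrakk> \<Longrightarrow> \<theta> (k \<odot>\<^bsub>\<D>\<^esub> w) = k \<odot> \<theta> w"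
    "\<And>w a. \<lbrakk>w \<in> dual; a \<in> carrier A\<rbrakk> \<Longrightarrow> \<theta> (w \<triangleleft>\<^bsub>\<D>\<^esub> a) = \<theta> w \<otimes> a"
  obtains a where "a \<in> carrier A" "\<And>w. w \<in> dual \<Longrightarrow> \<theta> w = a \<otimes> \<epsilon> w"
proof -
  define \<alpha> where "\<alpha> m = (\<Oplus>\<^bsub>M\<^esub>i\<in>I. \<theta> (matrix_coeff m (\<phi> i)) \<cdot> s i)" for m
  have term_closed: "\<theta> (matrix_coeff m \<psi>) \<cdot> n \<in> carrier M" if "m \<in> carrier M" "\<psi> \<in> M.dual" "n \<in> carrier M" for m \<psi> n
    using that by (intro act_closed \<theta> matrix_coeff_dual)
  have \<alpha>_closed: "\<alpha> m \<in> carrier M" if "m \<in> carrier M" for m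
    unfolding \<alpha>_def using that term_closed \<phi> s by (intro M.M.finsum_closed) auto
  have matrix_coeff_add: "matrix_coeff (m \<oplus>\<^bsub>M\<^esub> n) \<psi> = matrix_coeff m \<psi> \<oplus>\<^bsub>\<D>\<^esub> matrix_coeff n \<psi>"
    if "m \<in> carrier M" "n \<in> carrier M" "\<psi> \<in> M.dual" for m n \<psi>
    using that by (auto simp: matrix_coeff_def dual_ops fun_eq_iff act_add_right M.dual_add act_closed)
  have \<alpha>_add: "\<alpha> (m \<oplus>\<^bsub>M\<^esub> n) = \<alpha> m \<oplus>\<^bsub>M\<^esub> \<alpha> n" if mn: "m \<in> carrier M" "n \<in> carrier M" for m n
  proof -
    have "\<alpha> (m \<oplus>\<^bsub>M\<^esub> n) = (\<Oplus>\<^bsub>M\<^esub>i\<in>I. \<theta> (matrix_coeff m (\<phi> i)) \<cdot> s i \<oplus>\<^bsub>M\<^esub> \<theta> (matrix_coeff n (\<phi> i)) \<cdot> s i)"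
      unfolding \<alpha>_def using mn \<phi> s term_closed
      by (intro M.M.finsum_cong') (auto simp: matrix_coeff_add \<theta> matrix_coeff_dual act_add)
    also have "\<dots> = \<alpha> m \<oplus>\<^bsub>M\<^esub> \<alpha> n"
      unfolding \<alpha>_def using mn \<phi> s term_closed by (intro M.M.finsum_addf) auto
    finally show ?thesis .
  qed
  \<comment> \<open>The value depends on \<open>m\<close>, \<open>\<psi>\<close>, \<open>n\<close>
    only through the product of \<open>m\<close> with \<open>sharp \<psi> n\<close>. Expanding
    \<open>n\<close> by \<open>module_expand\<close> reduces this to the single terms compared in
    \<open>term_eq\<close>.\<close>
  have key: "\<theta> (matrix_coeff m \<psi>) \<cdot> n = \<alpha> (m \<triangleleft>\<^bsub>M\<^esub> sharp \<psi> n)"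
    if m: "m \<in> carrier M" and \<psi>: "\<psi> \<in> M.dual" and n: "n \<in> carrier M" for m \<psi> n
  proof -
    have term_eq: "\<theta> (matrix_coeff m \<psi>) \<cdot> (n \<triangleleft>\<^bsub>M\<^esub> sharp (\<phi> i) (s i)) = \<theta> (matrix_coeff (m \<triangleleft>\<^bsub>M\<^esub> sharp \<psi> n) (\<phi> i)) \<cdot> s i"
      if i: "i \<in> I" for i
    proof -
      \<comment> \<open>Symmetry of \<open>\<tau>\<close> exchanges \<open>sharp \<psi> n\<close>
        with \<open>sharp (\<phi> i) (x \<cdot> m)\<close>. Right linearity of
        \<open>\<theta>\<close> then carries the identity over to A.\<close>
      have "matrix_coeff m \<psi> \<triangleleft>\<^bsub>\<D>\<^esub> rk n (\<phi> i) = matrix_coeff (m \<triangleleft>\<^bsub>M\<^esub> sharp \<psi> n) (\<phi> i)"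
      proof (rule dual_eqI)
        fix x assume x: "x \<in> carrier A"
        have xm: "x \<cdot> m \<in> carrier M" using x m act_closed by blast
        have "(matrix_coeff m \<psi> \<triangleleft>\<^bsub>\<D>\<^esub> rk n (\<phi> i)) x = \<psi> (n \<triangleleft>\<^bsub>M\<^esub> sharp (\<phi> i) (x \<cdot> m))"
          using x m n xm \<phi>[OF i] by (simp add: dual_act_apply matrix_coeff_def rk act_mult)
        also have "\<dots> = \<tau> (sharp \<psi> n \<otimes>\<^bsub>B\<^esub> sharp (\<phi> i) (x \<cdot> m))"
          using n \<psi> xm \<phi>[OF i] by (simp add: sharp)
        also have "\<dots> = \<tau> (sharp (\<phi> i) (x \<cdot> m) \<otimes>\<^bsub>B\<^esub> sharp \<psi> n)"
          using n \<psi> xm \<phi>[OF i] by (intro \<tau>_sym sharp_closed)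
        also have "\<dots> = \<phi> i (x \<cdot> (m \<triangleleft>\<^bsub>M\<^esub> sharp \<psi> n))"
          using n \<psi> m x xm \<phi>[OF i] by (simp add: sharp act_ract)
        finally show "(matrix_coeff m \<psi> \<triangleleft>\<^bsub>\<D>\<^esub> rk n (\<phi> i)) x = matrix_coeff (m \<triangleleft>\<^bsub>M\<^esub> sharp \<psi> n) (\<phi> i) x"
          using x by (simp add: matrix_coeff_def)
      qed (use m n \<psi> \<phi>[OF i] in \<open>auto intro!: W.ract_closed matrix_coeff_dual rk_closed M.ract_closed sharp_closed\<close>)
      then have "\<theta> (matrix_coeff (m \<triangleleft>\<^bsub>M\<^esub> sharp \<psi> n) (\<phi> i)) = \<theta> (matrix_coeff m \<psi>) \<otimes> rk n (\<phi> i)"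
        using \<theta>(4)[of "matrix_coeff m \<psi>" "rk n (\<phi> i)"] m n \<psi> \<phi>[OF i] by (simp add: matrix_coeff_dual rk_closed)
      then show ?thesis
        using m n \<psi> \<phi>[OF i] s[OF i] by (simp add: act_mult \<theta> matrix_coeff_dual rk)
    qed
    have "\<theta> (matrix_coeff m \<psi>) \<cdot> n = \<theta> (matrix_coeff m \<psi>) \<cdot> (\<Oplus>\<^bsub>M\<^esub>i\<in>I. n \<triangleleft>\<^bsub>M\<^esub> sharp (\<phi> i) (s i))"
      using module_expand[OF n] by simp
    also have "\<dots> = (\<Oplus>\<^bsub>M\<^esub>i\<in>I. \<theta> (matrix_coeff m \<psi>) \<cdot> (n \<triangleleft>\<^bsub>M\<^esub> sharp (\<phi> i) (s i)))"
      using m n \<psi> \<phi> s \<theta>(1) matrix_coeff_dual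
      by (intro finsum_additive M.M.abelian_group_axioms I)
        (auto simp: M.ract_closed sharp_closed act_closed act_add_right)
    also have "\<dots> = \<alpha> (m \<triangleleft>\<^bsub>M\<^esub> sharp \<psi> n)"
      unfolding \<alpha>_def using m n \<psi> \<phi> s
      by (intro M.M.finsum_cong') (auto simp: term_eq intro!: term_closed M.ract_closed sharp_closed)
    finally show ?thesis .
  qed
  have \<alpha>_ract: "\<alpha> (m \<triangleleft>\<^bsub>M\<^esub> b) = \<alpha> m \<triangleleft>\<^bsub>M\<^esub> b" if m: "m \<in> carrier M" and b: "b \<in> carrier B" for m b
  proof -
    have "\<alpha> m \<triangleleft>\<^bsub>M\<^esub> b = (\<Oplus>\<^bsub>M\<^esub>i\<in>I. (\<theta> (matrix_coeff m (\<phi> i)) \<cdot> s i) \<triangleleft>\<^bsub>M\<^esub> b)"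
      unfolding \<alpha>_def using m b \<phi> s term_closed
      by (intro finsum_additive M.M.abelian_group_axioms I) (auto simp: M.ract_closed M.ract_add_left)
    also have "\<dots> = (\<Oplus>\<^bsub>M\<^esub>i\<in>I. \<alpha> ((m \<triangleleft>\<^bsub>M\<^esub> sharp (\<phi> i) (s i)) \<triangleleft>\<^bsub>M\<^esub> b))"
    proof (rule M.M.finsum_cong')
      fix i assume i: "i \<in> I"
      have "(\<theta> (matrix_coeff m (\<phi> i)) \<cdot> s i) \<triangleleft>\<^bsub>M\<^esub> b = \<theta> (matrix_coeff m (\<phi> i)) \<cdot> (s i \<triangleleft>\<^bsub>M\<^esub> b)"
        using m b \<phi>[OF i] s[OF i] \<theta>(1) matrix_coeff_dual by (simp add: act_ract)
      also have "\<dots> = \<alpha> ((m \<triangleleft>\<^bsub>M\<^esub> sharp (\<phi> i) (s i)) \<triangleleft>\<^bsub>M\<^esub> b)"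
        using m b \<phi>[OF i] s[OF i] by (simp add: key M.ract_closed sharp_ract M.ract_mult sharp_closed)
      finally show "(\<theta> (matrix_coeff m (\<phi> i)) \<cdot> s i) \<triangleleft>\<^bsub>M\<^esub> b = \<alpha> ((m \<triangleleft>\<^bsub>M\<^esub> sharp (\<phi> i) (s i)) \<triangleleft>\<^bsub>M\<^esub> b)" .
    qed (use m b \<phi> s in \<open>auto intro!: \<alpha>_closed M.ract_closed sharp_closed\<close>)
    also have "\<dots> = \<alpha> ((\<Oplus>\<^bsub>M\<^esub>i\<in>I. m \<triangleleft>\<^bsub>M\<^esub> sharp (\<phi> i) (s i)) \<triangleleft>\<^bsub>M\<^esub> b)"
      using m b \<phi> s
      by (intro finsum_additive[symmetric, of M M I "\<lambda>i. m \<triangleleft>\<^bsub>M\<^esub> sharp (\<phi> i) (s i)" "\<lambda>n. \<alpha> (n \<triangleleft>\<^bsub>M\<^esub> b)"]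
          M.M.abelian_group_axioms I)
        (auto simp: M.ract_closed sharp_closed \<alpha>_closed M.ract_add_left \<alpha>_add)
    finally show ?thesis using module_expand[OF m] by simp
  qed
  \<comment> \<open>K acts on M through B, so K-linearity of \<open>\<alpha>\<close> is an instance
    of \<open>\<alpha>_ract\<close>.\<close>
  have smult_ract: "k \<odot>\<^bsub>M\<^esub> m = m \<triangleleft>\<^bsub>M\<^esub> (k \<odot>\<^bsub>B\<^esub> \<one>\<^bsub>B\<^esub>)" if "k \<in> carrier K" "m \<in> carrier M" for k m
    using that by (simp add: M.ract_smult_right M.ract_one)
  have "\<alpha> \<in> rmod_hom K B M M"
  proof (rule rmod_homI)
    fix k m assume "k \<in> carrier K" "m \<in> carrier M"
    then show "\<alpha> (k \<odot>\<^bsub>M\<^esub> m) = k \<odot>\<^bsub>M\<^esub> \<alpha> m"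
      by (simp add: smult_ract \<alpha>_closed \<alpha>_ract)
  qed (use \<alpha>_closed \<alpha>_add \<alpha>_ract in auto)
  then obtain a where a: "a \<in> carrier A" "\<And>m. m \<in> carrier M \<Longrightarrow> a \<cdot> m = \<alpha> m"
    using act_surj by blast
  let ?U = "{w \<in> dual. \<theta> w = a \<otimes> \<epsilon> w}"
  have "?U = dual"
  proof (rule matrix_coeff_span)
    have "\<theta> \<zero>\<^bsub>\<D>\<^esub> = \<zero>" "\<epsilon> \<zero>\<^bsub>\<D>\<^esub> = \<zero>"
      using \<theta>(2)[of "\<zero>\<^bsub>\<D>\<^esub>" "\<zero>\<^bsub>\<D>\<^esub>"] \<theta>(1)[of "\<zero>\<^bsub>\<D>\<^esub>"]
        \<epsilon>_add[of "\<zero>\<^bsub>\<D>\<^esub>" "\<zero>\<^bsub>\<D>\<^esub>"] \<epsilon>_closed[of "\<zero>\<^bsub>\<D>\<^esub>"]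
      by simp_all
    then show "submodule K ?U \<D>"
      using a(1) by unfold_locales (auto simp: \<theta> \<epsilon>_simps A.r_distr smult_mult_right)
    fix m \<psi> assume m: "m \<in> carrier M" and \<psi>: "\<psi> \<in> M.dual"
    have "\<theta> (matrix_coeff m \<psi>) = a \<otimes> rk m \<psi>"
    proof (rule act_inj)
      fix n assume "n \<in> carrier M"
      then show "\<theta> (matrix_coeff m \<psi>) \<cdot> n = (a \<otimes> rk m \<psi>) \<cdot> n"
        using a m \<psi> by (simp add: key act_mult rk M.ract_closed sharp_closed)
    qed (use a m \<psi> in \<open>auto intro!: \<theta> matrix_coeff_dual rk_closed\<close>)
    then show "matrix_coeff m \<psi> \<in> ?U" using m \<psi> by (simp add: eps_matrix_coeff matrix_coeff_dual)
  qed
  then show ?thesis using a(1) by (intro that) blast+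
qed

text \<open>It suffices that every functional F on the tensor product factors through the
  multiplication. By reflexivity F(u \<otimes> v) = v(\<theta>(u)) for some \<open>\<theta>\<close>,
  which is right linear because F is balanced. So \<theta>(u) = a \<epsilon>(u) by
  \<open>right_linear_eps\<close>, and F is the multiplication followed by evaluation at
  \<open>a\<close>.\<close>

lemma \<nu>_inj: "inj_on \<nu>.lift (carrier WW.T)"
proof -
  interpret T: bimodule K A WW.T by (rule WW.tensor_bimodule)
  have fin: "vectorspace.fin_dim K WW.T"
    by (rule WW.tensor_fin_dim) (rule dual_fin_dim[OF finite_dimensional])+
  show ?thesis
  proof (rule inj_onI)
    fix t t' assume t: "t \<in> carrier WW.T" "t' \<in> carrier WW.T" "\<nu>.lift t = \<nu>.lift t'"
    show "t = t'"
    proof (rule T.dual_eq_points[OF fin t(1,2)])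
      fix F assume F: "F \<in> T.dual"
      have ex: "\<exists>a. a \<in> carrier A \<and> (\<forall>v\<in>dual. F (WW.pt u v) = v a)" if u: "u \<in> dual" for u
      proof -
        obtain a where "a \<in> carrier A" "\<And>v. v \<in> dual \<Longrightarrow> F (WW.pt u v) = v a"
        proof (rule dual_reflexive[OF finite_dimensional, of "\<lambda>v. F (WW.pt u v)"])
          fix v w assume "v \<in> dual" "w \<in> dual"
          then show "F (WW.pt u (v \<oplus>\<^bsub>\<D>\<^esub> w)) = F (WW.pt u v) \<oplus>\<^bsub>K\<^esub> F (WW.pt u w)"
            using u by (simp add: WW.pure_add_right T.dual_add[OF F] WW.pure_closed)
        next
          fix k v assume kv: "k \<in> carrier K" "v \<in> dual"
          have "WW.pt u (k \<odot>\<^bsub>\<D>\<^esub> v) = k \<odot>\<^bsub>WW.T\<^esub> WW.pt u v"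
            using u kv by (simp add: WW.tensor_smult_pure WW.smult_pure_right)
          then show "F (WW.pt u (k \<odot>\<^bsub>\<D>\<^esub> v)) = k \<otimes>\<^bsub>K\<^esub> F (WW.pt u v)"
            using u kv by (simp add: T.dual_smult[OF F] WW.pure_closed)
        qed (use u T.dual_closed[OF F] WW.pure_closed in blast)+
        then show ?thesis by blast
      qed
      define \<theta> where "\<theta> u = (SOME a. a \<in> carrier A \<and> (\<forall>v\<in>dual. F (WW.pt u v) = v a))" for u
      have \<theta>: "\<theta> u \<in> carrier A" "\<And>v. v \<in> dual \<Longrightarrow> v (\<theta> u) = F (WW.pt u v)" if "u \<in> dual" for u
        using someI_ex[OF ex[OF that]] unfolding \<theta>_def by auto
      obtain a where a: "a \<in> carrier A" "\<And>w. w \<in> dual \<Longrightarrow> \<theta> w = a \<otimes> \<epsilon> w"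
      proof (rule right_linear_eps[of \<theta>])
        fix v w assume "v \<in> dual" "w \<in> dual"
        then show "\<theta> (v \<oplus>\<^bsub>\<D>\<^esub> w) = \<theta> v \<oplus> \<theta> w"
          by (intro dual_eq_points[OF finite_dimensional])
            (auto simp: \<theta> dual_add WW.pure_add_left T.dual_add[OF F] WW.pure_closed)
      next
        fix k w assume "k \<in> carrier K" "w \<in> dual"
        then show "\<theta> (k \<odot>\<^bsub>\<D>\<^esub> w) = k \<odot> \<theta> w"
          by (intro dual_eq_points[OF finite_dimensional])
            (auto simp: \<theta> dual_smult T.dual_smult[OF F] WW.pure_closed simp flip: WW.tensor_smult_pure)
      next
        fix w b assume wb: "w \<in> dual" "b \<in> carrier A"
        show "\<theta> (w \<triangleleft>\<^bsub>\<D>\<^esub> b) = \<theta> w \<otimes> b"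
        proof (rule dual_eq_points[OF finite_dimensional])
          fix v assume v: "v \<in> dual"
          \<comment> \<open>Balancedness in action: v(\<theta>(w) b) = F(w \<otimes> b v) = F(w b
            \<otimes> v).\<close>
          have "v (\<theta> w \<otimes> b) = (b \<triangleright>\<^bsub>\<D>\<^esub> v) (\<theta> w)"
            using wb by (simp add: dual_act_apply \<theta>)
          also have "\<dots> = F (WW.pt w (b \<triangleright>\<^bsub>\<D>\<^esub> v))"
            using wb v by (intro \<theta> W.lact_closed)
          also have "\<dots> = v (\<theta> (w \<triangleleft>\<^bsub>\<D>\<^esub> b))"
            using wb v by (simp add: \<theta> W.ract_closed WW.pure_balanced)
          finally show "v (\<theta> (w \<triangleleft>\<^bsub>\<D>\<^esub> b)) = v (\<theta> w \<otimes> b)" by simp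
        qed (use wb in \<open>auto intro!: \<theta>(1) W.ract_closed\<close>)
      qed (use \<theta> in blast)+
      have "F r = \<nu>.lift r a" if "r \<in> carrier WW.T" for r
        using that
      proof (induction r rule: WW.tensor_induct)
        case (pure u v)
        then have "F (WW.pt u v) = v (a \<otimes> \<epsilon> u)" using \<theta>(2)[of u v] a by simp
        then show ?case using pure a by (simp add: \<nu>.lift_pure dual_act_apply)
      qed (use a in \<open>simp add: T.dual_add[OF F] \<nu>.lift_add dual_act_apply\<close>)
      then show "F t = F t'" using t by simp
    qed
  qed
qed

lemma comultiplication_exists: "\<exists>\<mu>. bocs K A (dual_bimod K A) \<mu> \<epsilon>"
  using \<nu>_inj \<nu>_surj by (intro bocs_of_bijective) (simp add: bij_betw_def)

end

text \<open>Let \<open>h\<close> be the projection from the power of M onto the summand isomorphic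
  to B, followed by the inverse isomorphism. The maps \<open>p i\<close> are \<open>h\<close> on the
  coordinate inclusions and the \<open>s i\<close> are the coordinates of the image of the unit, so
  the sum is \<open>h\<close> of that image.\<close>

lemma generator_module_expand:
  assumes M: "right_module K B M" and gen: "generator_module K B M"
  obtains n :: nat and p s where "\<And>i. i < n \<Longrightarrow> p i \<in> rmod_hom K B M (regular_bimod B)"
    "\<And>i. i < n \<Longrightarrow> s i \<in> carrier M" "(\<Oplus>\<^bsub>B\<^esub>i\<in>{..<n}. p i (s i)) = \<one>\<^bsub>B\<^esub>"
proof -
  interpret B: fd_alg K B
    using M by (simp add: right_module_def fd_alg_def fd_algebra_def vectorspace_def)
  interpret M: right_module K B M by fact
  obtain n U V f where U: "rsubmodule K B U (rmod_power n M)" and V: "rsubmodule K B V (rmod_power n M)"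
    and UV: "U \<inter> V = {\<zero>\<^bsub>rmod_power n M\<^esub>}"
    and sum: "\<And>x. x \<in> carrier (rmod_power n M) \<Longrightarrow> \<exists>u\<in>U. \<exists>v\<in>V. x = u \<oplus>\<^bsub>rmod_power n M\<^esub> v"
    and f: "f \<in> rmod_hom K B (regular_bimod B) ((rmod_power n M)\<lparr>carrier := U\<rparr>)"
    and bij: "bij_betw f (carrier B) U"
    using gen
    by (auto simp: generator_module_def direct_summand_def rmod_isomorphic_def regular_bimod_def)
  let ?P = "rmod_power n M"
  have Us: "submodule K U ?P" and Vs: "submodule K V ?P"
    and ract: "\<And>x b. \<lbrakk>x \<in> U; b \<in> carrier B\<rbrakk> \<Longrightarrow> x \<triangleleft>\<^bsub>?P\<^esub> b \<in> U"
      "\<And>x b. \<lbrakk>x \<in> V; b \<in> carrier B\<rbrakk> \<Longrightarrow> x \<triangleleft>\<^bsub>?P\<^esub> b \<in> V"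
    using U V by (auto simp: rsubmodule_def)
  interpret U: submodule K U ?P by (rule Us)
  interpret V: submodule K V ?P by (rule Vs)
  interpret P: module K ?P by (rule U.module)
  have Uc: "u \<in> carrier ?P" if "u \<in> U" for u using that U.subset by blast
  have Vc: "v \<in> carrier ?P" if "v \<in> V" for v using that V.subset by blast
  have neg: "\<ominus>\<^bsub>?P\<^esub> u \<in> U" if "u \<in> U" for u
    using that U.smult_closed[of "\<ominus>\<^bsub>K\<^esub> \<one>\<^bsub>K\<^esub>" u] Uc by (simp add: P.smult_minus_1)
  have negV: "\<ominus>\<^bsub>?P\<^esub> u \<in> V" if "u \<in> V" for u
    using that V.smult_closed[of "\<ominus>\<^bsub>K\<^esub> \<one>\<^bsub>K\<^esub>" u] Vc by (simp add: P.smult_minus_1)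
  have uniq: "u = u'" if "u \<in> U" "u' \<in> U" "v \<in> V" "v' \<in> V" "u \<oplus>\<^bsub>?P\<^esub> v = u' \<oplus>\<^bsub>?P\<^esub> v'" for u u' v v'
  proof -
    have c: "u \<in> carrier ?P" "u' \<in> carrier ?P" "v \<in> carrier ?P" "v' \<in> carrier ?P"
      using that Uc Vc by auto
    have "\<ominus>\<^bsub>?P\<^esub> u' \<oplus>\<^bsub>?P\<^esub> u = \<ominus>\<^bsub>?P\<^esub> u' \<oplus>\<^bsub>?P\<^esub> (u \<oplus>\<^bsub>?P\<^esub> v) \<oplus>\<^bsub>?P\<^esub> \<ominus>\<^bsub>?P\<^esub> v"
      using c by (simp add: P.M.a_assoc P.M.r_neg)
    also have "\<dots> = v' \<oplus>\<^bsub>?P\<^esub> \<ominus>\<^bsub>?P\<^esub> v"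
      unfolding that(5) using c by (simp add: P.M.r_neg1)
    finally have eq: "\<ominus>\<^bsub>?P\<^esub> u' \<oplus>\<^bsub>?P\<^esub> u = v' \<oplus>\<^bsub>?P\<^esub> \<ominus>\<^bsub>?P\<^esub> v" .
    have "\<ominus>\<^bsub>?P\<^esub> u' \<oplus>\<^bsub>?P\<^esub> u \<in> U" using that neg by blast
    moreover have "\<ominus>\<^bsub>?P\<^esub> u' \<oplus>\<^bsub>?P\<^esub> u \<in> V" unfolding eq using that negV by blast
    ultimately have "\<ominus>\<^bsub>?P\<^esub> u' \<oplus>\<^bsub>?P\<^esub> u = \<zero>\<^bsub>?P\<^esub>" using UV by blast
    then have "u' \<oplus>\<^bsub>?P\<^esub> (\<ominus>\<^bsub>?P\<^esub> u' \<oplus>\<^bsub>?P\<^esub> u) = u'" using c by simp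
    then show ?thesis using c by (simp add: P.M.r_neg2)
  qed
  note fD = rmod_homD[OF f, unfolded B.regular_simps]
  \<comment> \<open>Directness of the decomposition (\<open>uniq\<close>) and injectivity of
    \<open>f\<close> determine \<open>b\<close>; \<open>h_eq\<close> reads it off from any
    decomposition.\<close>
  define h where "h x = (SOME b. b \<in> carrier B \<and> (\<exists>v\<in>V. x = f b \<oplus>\<^bsub>?P\<^esub> v))" for x
  have h: "h x \<in> carrier B" "\<exists>v\<in>V. x = f (h x) \<oplus>\<^bsub>?P\<^esub> v" if x: "x \<in> carrier ?P" for x
  proof -
    obtain u v where uv: "u \<in> U" "v \<in> V" "x = u \<oplus>\<^bsub>?P\<^esub> v" using sum[OF x] by blast
    then obtain b where "b \<in> carrier B" "u = f b" using bij by (auto simp: bij_betw_def)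
    then have "\<exists>b. b \<in> carrier B \<and> (\<exists>v\<in>V. x = f b \<oplus>\<^bsub>?P\<^esub> v)" using uv by blast
    from someI_ex[OF this, folded h_def]
    show "h x \<in> carrier B" "\<exists>v\<in>V. x = f (h x) \<oplus>\<^bsub>?P\<^esub> v" by auto
  qed
  have fU: "f b \<in> U" if "b \<in> carrier B" for b using bij that by (auto simp: bij_betw_def)
  have h_eq: "h x = b" if b: "b \<in> carrier B" "v \<in> V" "x = f b \<oplus>\<^bsub>?P\<^esub> v" for x b v
  proof -
    have x: "x \<in> carrier ?P" using b Uc fU Vc by simp
    obtain v' where "v' \<in> V" "x = f (h x) \<oplus>\<^bsub>?P\<^esub> v'" using h(2)[OF x] by blast
    then have "f (h x) = f b" using uniq[of "f (h x)" "f b" v' v] fU h(1)[OF x] b by metis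
    then show ?thesis using bij h(1)[OF x] b(1) by (auto simp: bij_betw_def inj_on_def)
  qed
  have h_add: "h (x \<oplus>\<^bsub>?P\<^esub> y) = h x \<oplus>\<^bsub>B\<^esub> h y" if xy: "x \<in> carrier ?P" "y \<in> carrier ?P" for x y
  proof -
    obtain v w where vw: "v \<in> V" "x = f (h x) \<oplus>\<^bsub>?P\<^esub> v" "w \<in> V" "y = f (h y) \<oplus>\<^bsub>?P\<^esub> w"
      using h(2) xy by metis
    have "x \<oplus>\<^bsub>?P\<^esub> y = (f (h x) \<oplus>\<^bsub>?P\<^esub> v) \<oplus>\<^bsub>?P\<^esub> (f (h y) \<oplus>\<^bsub>?P\<^esub> w)" using vw by simp
    also have "\<dots> = (f (h x) \<oplus>\<^bsub>?P\<^esub> f (h y)) \<oplus>\<^bsub>?P\<^esub> (v \<oplus>\<^bsub>?P\<^esub> w)"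
      using vw(1,3) Vc Uc[OF fU[OF h(1)]] xy by (simp add: P.M.add.m_ac)
    also have "f (h x) \<oplus>\<^bsub>?P\<^esub> f (h y) = f (h x \<oplus>\<^bsub>B\<^esub> h y)" using fD(2) h(1) xy by simp
    finally show ?thesis using vw xy h(1) by (intro h_eq) auto
  qed
  have P_ops: "(k \<odot>\<^bsub>?P\<^esub> x) i = k \<odot>\<^bsub>M\<^esub> x i" "(x \<triangleleft>\<^bsub>?P\<^esub> b) i = x i \<triangleleft>\<^bsub>M\<^esub> b" "(x \<oplus>\<^bsub>?P\<^esub> y) i = x i \<oplus>\<^bsub>M\<^esub> y i"
    if "i < n" for k x y b i
    using that by (auto simp: rmod_power_def)
  have P_mem: "x i \<in> carrier M" if "x \<in> carrier ?P" "i < n" for x i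
    using that by (auto simp: rmod_power_def)
  have P_ract_add: "(x \<oplus>\<^bsub>?P\<^esub> y) \<triangleleft>\<^bsub>?P\<^esub> b = x \<triangleleft>\<^bsub>?P\<^esub> b \<oplus>\<^bsub>?P\<^esub> y \<triangleleft>\<^bsub>?P\<^esub> b"
    if "x \<in> carrier ?P" "y \<in> carrier ?P" "b \<in> carrier B" for x y b
    using P_mem[OF that(1)] P_mem[OF that(2)] that(3)
    by (intro ext) (simp add: rmod_power_def M.ract_add_left)
  have P_ract: "x \<triangleleft>\<^bsub>?P\<^esub> b \<in> carrier ?P" if "x \<in> carrier ?P" "b \<in> carrier B" for x b
    using that P_mem[OF that(1)] by (simp add: rmod_power_def M.ract_closed)
  have h_smult: "h (k \<odot>\<^bsub>?P\<^esub> x) = k \<odot>\<^bsub>B\<^esub> h x" if kx: "k \<in> carrier K" "x \<in> carrier ?P" for k x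
  proof -
    obtain v where v: "v \<in> V" "x = f (h x) \<oplus>\<^bsub>?P\<^esub> v" using h(2) kx by metis
    have "k \<odot>\<^bsub>?P\<^esub> x = k \<odot>\<^bsub>?P\<^esub> (f (h x) \<oplus>\<^bsub>?P\<^esub> v)" using v by simp
    also have "\<dots> = f (k \<odot>\<^bsub>B\<^esub> h x) \<oplus>\<^bsub>?P\<^esub> k \<odot>\<^bsub>?P\<^esub> v"
      using fD(3)[of k "h x"] kx h(1) v(1) Vc Uc[OF fU[OF h(1)[OF kx(2)]]] by (simp add: P.smult_r_distr)
    finally show ?thesis using kx h(1) v(1) by (intro h_eq) auto
  qed
  have h_ract: "h (x \<triangleleft>\<^bsub>?P\<^esub> b) = h x \<otimes>\<^bsub>B\<^esub> b" if xb: "x \<in> carrier ?P" "b \<in> carrier B" for x b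
  proof -
    obtain v where v: "v \<in> V" "x = f (h x) \<oplus>\<^bsub>?P\<^esub> v" using h(2) xb by metis
    have "x \<triangleleft>\<^bsub>?P\<^esub> b = (f (h x) \<oplus>\<^bsub>?P\<^esub> v) \<triangleleft>\<^bsub>?P\<^esub> b" using v by simp
    also have "\<dots> = f (h x \<otimes>\<^bsub>B\<^esub> b) \<oplus>\<^bsub>?P\<^esub> v \<triangleleft>\<^bsub>?P\<^esub> b"
      using fD(4)[of "h x" b] xb h(1) v(1) Vc Uc[OF fU[OF h(1)[OF xb(1)]]] by (simp add: P_ract_add)
    finally show ?thesis using xb h(1) v(1) ract(2) P_ract by (intro h_eq) auto
  qed
  define \<iota> where "\<iota> i m = (\<lambda>j\<in>{..<n}. if j = i then m else \<zero>\<^bsub>M\<^esub>)" for i m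
  have \<iota>: "\<iota> i m \<in> carrier ?P" if "m \<in> carrier M" for i m
    using that by (simp add: \<iota>_def rmod_power_def)
  have M_zero: "\<zero>\<^bsub>M\<^esub> \<triangleleft>\<^bsub>M\<^esub> b = \<zero>\<^bsub>M\<^esub>" if "b \<in> carrier B" for b
    using M.ract_add_left[of "\<zero>\<^bsub>M\<^esub>" "\<zero>\<^bsub>M\<^esub>" b] M.ract_closed[of "\<zero>\<^bsub>M\<^esub>" b] that
    by simp
  have \<iota>_add: "\<iota> i (x \<oplus>\<^bsub>M\<^esub> y) = \<iota> i x \<oplus>\<^bsub>?P\<^esub> \<iota> i y" if "x \<in> carrier M" "y \<in> carrier M" for i x y
    using that by (intro ext) (simp add: \<iota>_def rmod_power_def)
  have \<iota>_smult: "\<iota> i (k \<odot>\<^bsub>M\<^esub> x) = k \<odot>\<^bsub>?P\<^esub> \<iota> i x" if "k \<in> carrier K" for i k x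
    using M.smult_r_null[OF that] by (intro ext) (simp add: \<iota>_def rmod_power_def)
  have \<iota>_ract: "\<iota> i (x \<triangleleft>\<^bsub>M\<^esub> b) = \<iota> i x \<triangleleft>\<^bsub>?P\<^esub> b" if "b \<in> carrier B" for i x b
    using M_zero[OF that] by (intro ext) (simp add: \<iota>_def rmod_power_def)
  have h_sum: "h x = (\<Oplus>\<^bsub>B\<^esub>i\<in>{..<n}. h (\<iota> i (x i)))" if x: "x \<in> carrier ?P" for x
  proof -
    \<comment> \<open>Truncation to the first \<open>k\<close> coordinates, so that the coordinate
      decomposition of \<open>x\<close> follows by induction on \<open>k\<close> up to
      \<open>n\<close>.\<close>
    define cut where "cut k = (\<lambda>j\<in>{..<n}. if j < k then x j else \<zero>\<^bsub>M\<^esub>)" for k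
    have cut: "cut k \<in> carrier ?P" for k
      using P_mem[OF x] by (simp add: cut_def rmod_power_def)
    have "h (cut k) = (\<Oplus>\<^bsub>B\<^esub>i\<in>{..<k}. h (\<iota> i (x i)))" if "k \<le> n" for k
      using that
    proof (induction k)
      case 0
      have "h \<zero>\<^bsub>?P\<^esub> = \<zero>\<^bsub>B\<^esub>"
        using h_add[of "\<zero>\<^bsub>?P\<^esub>" "\<zero>\<^bsub>?P\<^esub>"] h(1)[of "\<zero>\<^bsub>?P\<^esub>"] by simp
      moreover have "cut 0 = \<zero>\<^bsub>?P\<^esub>" by (auto simp: cut_def rmod_power_def)
      ultimately show ?case by simp
    next
      case (Suc k)
      have "cut (Suc k) = \<iota> k (x k) \<oplus>\<^bsub>?P\<^esub> cut k"
        using Suc.prems P_mem[OF x] by (intro ext) (auto simp: cut_def \<iota>_def rmod_power_def less_Suc_eq)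
      then have "h (cut (Suc k)) = h (\<iota> k (x k)) \<oplus>\<^bsub>B\<^esub> h (cut k)"
        using Suc.prems P_mem[OF x] \<iota> cut by (simp add: h_add)
      also have "\<dots> = (\<Oplus>\<^bsub>B\<^esub>i\<in>insert k {..<k}. h (\<iota> i (x i)))"
        using Suc P_mem[OF x] \<iota> h(1) by (subst B.A.finsum_insert) auto
      finally show ?case by (simp add: lessThan_Suc)
    qed
    moreover have "cut n = x"
      using x by (intro ext) (auto simp: cut_def rmod_power_def PiE_iff extensional_def)
    ultimately show ?thesis by force
  qed
  have one: "f \<one>\<^bsub>B\<^esub> \<in> carrier ?P" using Uc fU by simp
  show ?thesis
  proof (rule that[of n "\<lambda>i m. h (\<iota> i m)" "f \<one>\<^bsub>B\<^esub>"])
    fix i assume i: "i < n"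
    show "(\<lambda>m. h (\<iota> i m)) \<in> rmod_hom K B M (regular_bimod B)"
      by (rule rmod_homI; unfold B.regular_simps)
        (simp_all add: \<iota> h h_add h_smult h_ract \<iota>_add \<iota>_smult \<iota>_ract)
    show "f \<one>\<^bsub>B\<^esub> i \<in> carrier M" using P_mem[OF one i] .
  next
    have "h (f \<one>\<^bsub>B\<^esub>) = \<one>\<^bsub>B\<^esub>"
      using one by (intro h_eq[OF _ V.zero_closed]) auto
    then show "(\<Oplus>\<^bsub>B\<^esub>i\<in>{..<n}. h (\<iota> i (f \<one>\<^bsub>B\<^esub> i))) = \<one>\<^bsub>B\<^esub>"
      using h_sum[OF one] by simp
  qed
qed

lemma gendo_symmetric_imp_bocs:
  assumes A: "fd_algebra K A" and gs: "gendo_symmetric K A"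
  shows "\<exists>\<mu> \<epsilon>. bocs K A (dual_bimod K A) \<mu> \<epsilon>"
proof -
  obtain B :: "('a, nat \<Rightarrow> 'a) module" and M :: "('a, nat \<Rightarrow> 'a, nat \<Rightarrow> 'a) rmod"
    where sym: "symmetric_algebra K B" and M: "right_module K B M" and fin: "vectorspace.fin_dim K M"
      and gen: "generator_module K B M" and iso: "alg_isomorphic K A (end_algebra K B M)"
    using gs unfolding gendo_symmetric_def by blast
  interpret A: fd_alg K A
    using A by (simp add: fd_alg_def fd_algebra_def vectorspace_def)
  obtain \<tau> where \<tau>: "trace_form K B \<tau>" using symmetric_algebra_trace_form[OF sym] .
  interpret T: trace_form_module K B \<tau> M
    using \<tau> M by (simp add: trace_form_module_def)
  obtain n :: nat and p s where p: "\<And>i. i < n \<Longrightarrow> p i \<in> rmod_hom K B M (regular_bimod B)"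
    and s: "\<And>i. i < n \<Longrightarrow> s i \<in> carrier M" and one: "(\<Oplus>\<^bsub>B\<^esub>i\<in>{..<n}. p i (s i)) = \<one>\<^bsub>B\<^esub>"
    using generator_module_expand[OF M gen] by blast
  obtain F where F: "F \<in> module_hom K A (end_algebra K B M)" "F \<in> ring_hom A (end_algebra K B M)"
    and bij: "bij_betw F (carrier A) (carrier (end_algebra K B M))"
    using iso by (auto simp: alg_isomorphic_def)
  \<comment> \<open>Composing with \<open>\<tau>\<close> turns the maps \<open>p i\<close> into
    functionals, and \<open>sharp\<close> inverts this.\<close>
  define \<phi> where "\<phi> i = (\<lambda>m\<in>carrier M. \<tau> (p i m))" for i
  note pD = rmod_homD[OF p, unfolded T.B.regular_simps]
  have \<phi>: "\<phi> i \<in> T.M.dual" if "i < n" for i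
    unfolding \<phi>_def using that
    by (intro T.M.dual_restrictI)
      (auto simp: pD T.B.dual_closed[OF T.\<tau>_dual] T.B.dual_add[OF T.\<tau>_dual] T.B.dual_smult[OF T.\<tau>_dual])
  have sharp: "T.sharp (\<phi> i) m = p i m" if "i < n" "m \<in> carrier M" for i m
    using that by (intro T.sharp_eqI[OF \<phi>]) (auto simp: \<phi>_def pD T.M.ract_closed)
  have Fc: "F a \<in> rmod_hom K B M M" "F a \<in> extensional (carrier M)" if "a \<in> carrier A" for a
    using bij that by (auto simp: bij_betw_def end_algebra_def)
  have "endomorphism_action K A B \<tau> M F {..<n} \<phi> s"
  proof unfold_locales
    fix a b m assume a: "a \<in> carrier A" "b \<in> carrier A" and m: "m \<in> carrier M"
    show "F (a \<oplus>\<^bsub>A\<^esub> b) m = F a m \<oplus>\<^bsub>M\<^esub> F b m"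
      using module_hom_add[OF F(1) a] m by (simp add: end_algebra_def)
    show "F (a \<otimes>\<^bsub>A\<^esub> b) m = F a (F b m)"
      using ring_hom_mult[OF F(2) a] m by (simp add: end_algebra_def compose_def)
  next
    fix k a m assume "k \<in> carrier K" "a \<in> carrier A" "m \<in> carrier M"
    then show "F (k \<odot>\<^bsub>A\<^esub> a) m = k \<odot>\<^bsub>M\<^esub> F a m"
      using module_hom_smult[OF F(1)] by (simp add: end_algebra_def)
  next
    fix a b assume ab: "a \<in> carrier A" "b \<in> carrier A" "\<And>m. m \<in> carrier M \<Longrightarrow> F a m = F b m"
    then have "F a = F b" by (intro extensionalityI[of _ "carrier M"] Fc) auto
    then show "a = b" using bij ab by (auto simp: bij_betw_def inj_on_def)
  next
    fix f assume f: "f \<in> rmod_hom K B M M"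
    \<comment> \<open>Elements of \<open>end_algebra\<close> are extensional, while \<open>f\<close>
      is arbitrary outside M; only its restriction is in the range of \<open>F\<close>.\<close>
    have "restrict f (carrier M) \<in> carrier (end_algebra K B M)"
      using f T.M.ract_closed by (auto simp: end_algebra_def rmod_hom_def module_hom_def)
    then have "restrict f (carrier M) \<in> F ` carrier A"
      using bij by (simp add: bij_betw_def)
    then obtain a where "a \<in> carrier A" "F a = restrict f (carrier M)" by auto
    then show "\<exists>a\<in>carrier A. \<forall>m\<in>carrier M. F a m = f m"
      by (intro bexI[of _ a]) auto
  next
    have "(\<Oplus>\<^bsub>B\<^esub>i\<in>{..<n}. T.sharp (\<phi> i) (s i)) = (\<Oplus>\<^bsub>B\<^esub>i\<in>{..<n}. p i (s i))"
      using s by (intro T.B.A.finsum_cong') (auto simp: sharp pD)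
    then show "(\<Oplus>\<^bsub>B\<^esub>i\<in>{..<n}. T.sharp (\<phi> i) (s i)) = \<one>\<^bsub>B\<^esub>" using one by simp
  qed (use fin Fc \<phi> s in auto)
  from endomorphism_action.comultiplication_exists[OF this] show ?thesis by blast
qed

theorem theoremA:
  fixes K :: "'k ring" and A :: "('k, 'a) module"
  assumes "field K" and "fd_algebra K A"
  shows "gendo_symmetric K A \<longleftrightarrow> (\<exists>\<mu> \<epsilon>. bocs K A (dual_bimod K A) \<mu> \<epsilon>)"
proof
  assume "gendo_symmetric K A"
  then show "\<exists>\<mu> \<epsilon>. bocs K A (dual_bimod K A) \<mu> \<epsilon>"
    by (rule gendo_symmetric_imp_bocs[OF assms(2)])
next
  assume "\<exists>\<mu> \<epsilon>. bocs K A (dual_bimod K A) \<mu> \<epsilon>"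
  then obtain \<mu> \<epsilon> where "bocs K A (dual_bimod K A) \<mu> \<epsilon>" by blast
  moreover have "fd_alg K A"
    using assms by (simp add: fd_alg_def fd_algebra_def)
  ultimately interpret dual_bocs K A \<mu> \<epsilon> by (simp add: dual_bocs_def)
  show "gendo_symmetric K A" by (rule gendo_symmetric)
qed

end
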